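(* Let $T=T_{\mathrm{rg}}(\tau;\alpha,\beta)$ be an exceptional Jacobi operator in the rational gauge. Then the spectral diagram of $T$ is related to the spectral diagram of a classical Jacobi operator by a spectral shift and finitely many label changes: there exist $a,b,c\in\mathbb{R}$ such that $\sigma_{\mathrm{qr}}(T)=\{\lambda+c:\lambda\in\sigma_{\mathrm{qr}}(T(a,b))\}$ and the label of $\lambda+c$ for $T$ coincides with the label of $\lambda$ for $T(a,b)$ for all but finitely many $\lambda\in\sigma_{\mathrm{qr}}(T(a,b))$.
   Context: $D=d/dx$; $\eta(x;\alpha,\beta)=\frac{\alpha+1}{x-1}+\frac{\beta+1}{x+1}$. The classical Jacobi operator is $T(a,b)=(x^2-1)(D^2+\eta(x;a,b)D)$. For a polynomial $\tau$ with $\tau(\pm1)\neq0$: $T_{\mathrm{ng}}(\tau;\alpha,\beta)=(x^2-1)\big(D^2-2\frac{\tau'}{\tau}D+\frac{\tau''}{\tau}+\eta(D-\frac{\tau'}{\tau})\big)+2x\frac{\tau'}{\tau}$, $T_{\mathrm{rg}}(\tau;\alpha,\beta)=T(\alpha,\beta)+2(x^2-1)u'+2xu$, $u=\tau'/\tau$. $T_{\mathrm{rg}}(\tau;\alpha,\beta)$ is an exceptional Jacobi operator if $T_{\mathrm{ng}}(\tau;\alpha,\beta)$ has a nonzero polynomial eigenfunction of degree $n$ for all but finitely many $n\in\mathbb{N}_0$. For $T=pD^2+qD+r$ and constant $\lambda$, $\mathrm{Ric}_\lambda(T)$ is the set of rational $w$ with $p(w'+w^2)+qw+r=\lambda$ (log-derivatives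 of quasi-rational eigenfunctions, i.e. eigenfunctions $\phi$ with $\phi'/\phi$ rational), and $\sigma_{\mathrm{qr}}(T)=\{\lambda:\mathrm{Ric}_\lambda(T)\ne\emptyset\}$. Asymptotic type of a rational $w$: 1 if regular at $x=\pm1$; 2 if poles at both; 3 if pole at $x=1$ only; 4 if pole at $x=-1$ only. The label of $\lambda\in\sigma_{\mathrm{qr}}(T)$ is (cardinality of $\mathrm{Ric}_\lambda(T)$, set of asymptotic types of its elements); the spectral diagram is the map $\lambda\mapsto$ label. *)

theory Defs
  imports "HOL-Computational_Algebra.Computational_Algebra"
          "HOL-Computational_Algebra.Normalized_Fraction"
          "HOL-Computational_Algebra.Field_as_Ring"
          "HOL-Library.Extended_Nat"
begin

type_synonym rfun = "real poly fract"

definition rX :: rfun where "rX = to_fract [:0, 1:]"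
definition rC :: "real \<Rightarrow> rfun" where "rC c = to_fract [:c:]"

definition rderiv :: "rfun \<Rightarrow> rfun" where
  "rderiv w = (case quot_of_fract w of (P, Q) \<Rightarrow>
      Fract (pderiv P * Q - P * pderiv Q) (Q ^ 2))"

definition has_pole :: "rfun \<Rightarrow> real \<Rightarrow> bool" where
  "has_pole w x0 \<longleftrightarrow> poly (snd (quot_of_fract w)) x0 = 0"

text \<open>A second order operator p D^2 + q D + r with rational coefficients, as a triple (p,q,r).\<close>
type_synonym rop = "rfun \<times> rfun \<times> rfun"

definition op_apply :: "rop \<Rightarrow> rfun \<Rightarrow> rfun" where
  "op_apply T y = (case T of (p, q, r) \<Rightarrow> p * rderiv (rderiv y) + q * rderiv y + r * y)"

definition eta :: "real \<Rightarrow> real \<Rightarrow> rfun" where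
  "eta a b = rC (a + 1) / (rX - 1) + rC (b + 1) / (rX + 1)"

definition jacobi_op :: "real \<Rightarrow> real \<Rightarrow> rop" where
  "jacobi_op a b = (rX ^ 2 - 1, (rX ^ 2 - 1) * eta a b, 0)"

definition logder :: "real poly \<Rightarrow> rfun" where
  "logder \<tau> = to_fract (pderiv \<tau>) / to_fract \<tau>"

definition T_ng :: "real poly \<Rightarrow> real \<Rightarrow> real \<Rightarrow> rop" where
  "T_ng \<tau> \<alpha> \<beta> =
    (let u = logder \<tau>; t2 = to_fract (pderiv (pderiv \<tau>)) / to_fract \<tau>; e = eta \<alpha> \<beta> in
     (rX ^ 2 - 1,
      (rX ^ 2 - 1) * (- 2 * u + e),
      (rX ^ 2 - 1) * (t2 - e * u) + 2 * rX * u))"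

definition T_rg :: "real poly \<Rightarrow> real \<Rightarrow> real \<Rightarrow> rop" where
  "T_rg \<tau> \<alpha> \<beta> =
    (let u = logder \<tau> in
     (rX ^ 2 - 1, (rX ^ 2 - 1) * eta \<alpha> \<beta>, 2 * (rX ^ 2 - 1) * rderiv u + 2 * rX * u))"

definition has_poly_eigenfunction_deg :: "rop \<Rightarrow> nat \<Rightarrow> bool" where
  "has_poly_eigenfunction_deg T n \<longleftrightarrow>
     (\<exists>y :: real poly. \<exists>l :: real. y \<noteq> 0 \<and> degree y = n \<and>
        op_apply T (to_fract y) = rC l * to_fract y)"

definition exceptional_jacobi :: "real poly \<Rightarrow> real \<Rightarrow> real \<Rightarrow> bool" where
  "exceptional_jacobi \<tau> \<alpha> \<beta> \<longleftrightarrow>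
     poly \<tau> 1 \<noteq> 0 \<and> poly \<tau> (-1) \<noteq> 0 \<and>
     finite {n. \<not> has_poly_eigenfunction_deg (T_ng \<tau> \<alpha> \<beta>) n}"

definition Ric :: "rop \<Rightarrow> real \<Rightarrow> rfun set" where
  "Ric T l = {w. case T of (p, q, r) \<Rightarrow>
                   p * (rderiv w + w ^ 2) + q * w + r = rC l}"

definition sigma_qr :: "rop \<Rightarrow> real set" where
  "sigma_qr T = {l. Ric T l \<noteq> {}}"

definition asym_type :: "rfun \<Rightarrow> nat" where
  "asym_type w =
    (if \<not> has_pole w 1 \<and> \<not> has_pole w (-1) then 1
     else if has_pole w 1 \<and> has_pole w (-1) then 2
     else if has_pole w 1 then 3 else 4)"

definition set_card :: "'a set \<Rightarrow> enat" where
  "set_card A = (if finite A then enat (card A) else \<infinity>)"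

definition label :: "rop \<Rightarrow> real \<Rightarrow> enat \<times> nat set" where
  "label T l = (set_card (Ric T l), asym_type ` Ric T l)"

end

theory Submission
  imports Defs
begin

text \<open>
  The classical operator with the same parameters \<open>\<alpha>\<close>, \<open>\<beta>\<close> serves, without any shift, for
  \<open>T = T_rg \<tau> \<alpha> \<beta>\<close>; the case \<open>\<tau> = 1\<close> of one computation gives the classical diagram.

  The eigenpolynomials show that the largest \<open>T\<close>-invariant space \<open>U\<close> of polynomials divided by
  \<open>\<tau>\<close> has finite codimension, so it also contains all multiples of a power of \<open>\<tau>\<close>. On
  \<open>U\<close> the operator is triangular with respect to the degree, so each degree \<open>i\<close> occurring in
  \<open>U\<close> makes \<open>i (i + \<alpha> + \<beta> + 1)\<close> an eigenvalue. The annihilator of \<open>U\<close> under the residue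
  pairing at infinity is invariant under the adjoint operator, which is \<open>T\<close> in the gauge
  \<open>(1 - x)^\<alpha> (1 + x)^\<beta>\<close> up to a constant, and contains the degree \<open>- 1 - i\<close> exactly when
  \<open>i\<close> is missing in \<open>U\<close>. Hence every integer \<open>i\<close> contributes to the spectrum. Conjugation by
  \<open>(x - 1)^t\<close> depends polynomially on \<open>t\<close> and is harmless for natural \<open>t\<close>, hence for
  \<open>t = - \<alpha>\<close>, which yields the remaining two families.

  Conversely, rational solutions of the Riccati equation have simple poles with integer residues
  off \<open>x = 1, -1\<close>. For large eigenvalues they all have the same exponent at infinity, which makes
  them determined by their residues at \<open>x = 1, -1\<close>, and the possible residues depend only on
  \<open>\<alpha>\<close>, \<open>\<beta>\<close> and the eigenvalue.
\<close>

subsection \<open>Derivation and logarithmic derivative\<close>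

text \<open>At infinity the terms of order zero in \<open>Vpot \<tau>\<close> cancel, so exponents
  \<open>s\<close> there obey the classical equation
  \<open>l = s (s + \<alpha> + \<beta> + 1)\<close>; and \<open>\<tau>\<close> does not vanish at 1
  and -1, so the exponents there are classical too. This is why neither parameters nor eigenvalues
  have to be shifted.

  The equation for \<open>s\<close> has two roots. For large \<open>l\<close> the larger one is
  forced because the exponents at infinity are bounded below uniformly in \<open>l\<close>:
  subtracting one known rational logarithmic derivative from a solution removes the potential and
  leaves a Riccati equation whose coefficient has fixed poles, and away from these a solution can
  only have residue 1.

  The eigenpolynomials enter through an invariant space squeezed between
  \<open>\<tau>^M R[x]\<close> and \<open>\<tau>^(-M) R[x]\<close>. This property, unlike statements
  about single eigenfunctions, can be carried over to a reflected parameter although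
  \<open>(x - 1)^(-\<alpha>)\<close> is not rational in general. Eigenfunctions with real exponents
  are handled through their logarithmic derivatives, where the exponents are mere residues.\<close>

lemma rfun_cases:
  fixes w :: rfun
  obtains P Q where "Q \<noteq> 0" "w = to_fract P / to_fract Q"
  by (metis Fract_conv_to_fract Fract_quot_of_fract snd_quot_of_fract_nonzero)

lemma rfun_cases_nonzero:
  fixes w :: rfun
  assumes "w \<noteq> 0"
  obtains P Q where "P \<noteq> 0" "Q \<noteq> 0" "w = to_fract P / to_fract Q"
  using assms by (cases w rule: rfun_cases) auto

text \<open>\<open>rderiv\<close> is computed from the reduced fraction; any other representation
  obeys the same rule because differentiating the cross-multiplied identity
  \<open>P * B = A * Q\<close> relates the two numerators.\<close>

lemma rderiv_quot:
  assumes "Q \<noteq> 0"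
  shows "rderiv (to_fract P / to_fract Q) =
           to_fract (pderiv P * Q - P * pderiv Q) / to_fract (Q ^ 2)"
proof -
  obtain A B where AB: "quot_of_fract (to_fract P / to_fract Q) = (A, B)"
    by force
  then have B0: "B \<noteq> 0" and "to_fract P / to_fract Q = to_fract A / to_fract B"
    by (metis snd_conv snd_quot_of_fract_nonzero,
        metis AB Fract_conv_to_fract Fract_quot_of_fract fst_conv snd_conv)
  then have "to_fract (P * B) = to_fract (A * Q)"
    using assms by (simp add: field_simps)
  then have PB: "P * B = A * Q"
    by (simp only: to_fract_eq_iff)
  then have dPB: "pderiv P * B + P * pderiv B = pderiv A * Q + A * pderiv Q"
    by (metis pderiv_mult add.commute mult.commute)
  have "(pderiv A * B - A * pderiv B) * Q ^ 2 = (pderiv P * Q - P * pderiv Q) * B ^ 2"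
    using PB dPB by algebra
  then have "to_fract (pderiv A * B - A * pderiv B) * to_fract (Q ^ 2)
      = to_fract (pderiv P * Q - P * pderiv Q) * to_fract (B ^ 2)"
    by (metis to_fract_mult)
  moreover have "to_fract (Q ^ 2) \<noteq> 0" "to_fract (B ^ 2) \<noteq> 0"
    using assms B0 by auto
  ultimately show ?thesis
    unfolding rderiv_def AB by (simp add: Fract_conv_to_fract frac_eq_eq del: to_fract_diff to_fract_mult)
qed

lemma to_fract_power [simp]: "to_fract (p ^ n) = to_fract p ^ n"
  by (induction n) auto

lemma rderiv_to_fract [simp]: "rderiv (to_fract P) = to_fract (pderiv P)"
  using rderiv_quot[of 1 P] by simp

lemma rderiv_add [simp]: "rderiv (v + w) = rderiv v + rderiv w"
proof -
  obtain P Q where 1: "Q \<noteq> 0" "v = to_fract P / to_fract Q" by (rule rfun_cases)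
  obtain A B where 2: "B \<noteq> 0" "w = to_fract A / to_fract B" by (rule rfun_cases)
  have "v + w = to_fract (P * B + A * Q) / to_fract (Q * B)"
    using 1 2 by (simp add: field_simps)
  then have "rderiv (v + w) = rderiv (to_fract (P * B + A * Q) / to_fract (Q * B))"
    by (rule arg_cong)
  also have "\<dots> = rderiv (to_fract P / to_fract Q) + rderiv (to_fract A / to_fract B)"
    using 1(1) 2(1)
    by (subst (1 2 3) rderiv_quot)
      (simp_all add: pderiv_mult pderiv_add field_simps power2_eq_square)
  finally show ?thesis by (simp only: 1 2)
qed

lemma rderiv_mult [simp]: "rderiv (v * w) = rderiv v * w + v * rderiv w"
proof -
  obtain P Q where 1: "Q \<noteq> 0" "v = to_fract P / to_fract Q" by (rule rfun_cases)
  obtain A B where 2: "B \<noteq> 0" "w = to_fract A / to_fract B" by (rule rfun_cases)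
  have "v * w = to_fract (P * A) / to_fract (Q * B)"
    by (simp add: 1 2)
  then have "rderiv (v * w) = rderiv (to_fract (P * A) / to_fract (Q * B))"
    by (rule arg_cong)
  also have "\<dots> = rderiv (to_fract P / to_fract Q) * (to_fract A / to_fract B)
      + (to_fract P / to_fract Q) * rderiv (to_fract A / to_fract B)"
    using 1(1) 2(1)
    by (subst (1 2 3) rderiv_quot)
      (simp_all add: pderiv_mult field_simps power2_eq_square)
  finally show ?thesis by (simp only: 1 2)
qed

lemma rderiv_0 [simp]: "rderiv 0 = 0" and rderiv_1 [simp]: "rderiv 1 = 0"
  using rderiv_to_fract[of 0] rderiv_to_fract[of 1] by simp_all

lemma rderiv_uminus [simp]: "rderiv (- w) = - rderiv w"
  using rderiv_add[of w "- w"] by (simp add: add_eq_0_iff)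

lemma rderiv_diff [simp]: "rderiv (v - w) = rderiv v - rderiv w"
  using rderiv_add[of v "- w"] by simp

lemma rderiv_inverse: "w \<noteq> 0 \<Longrightarrow> rderiv (inverse w) = - rderiv w / w ^ 2"
proof -
  assume "w \<noteq> 0"
  then have "rderiv w * inverse w + w * rderiv (inverse w) = 0"
    using rderiv_mult[of w "inverse w"] by simp
  with \<open>w \<noteq> 0\<close> show ?thesis
    by (simp add: field_simps power2_eq_square eq_neg_iff_add_eq_0)
qed

lemma rderiv_divide: "w \<noteq> 0 \<Longrightarrow> rderiv (v / w) = (rderiv v * w - v * rderiv w) / w ^ 2"
  unfolding divide_inverse[of v w] rderiv_mult
  by (subst rderiv_inverse) (auto simp: field_simps power2_eq_square)

lemma rC_add: "rC (a + b) = rC a + rC b" and rC_diff: "rC (a - b) = rC a - rC b"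
  and rC_mult: "rC (a * b) = rC a * rC b" and rC_uminus: "rC (- a) = - rC a"
  and rC_0 [simp]: "rC 0 = 0" and rC_1 [simp]: "rC 1 = 1"
  by (simp_all add: rC_def flip: to_fract_add to_fract_diff to_fract_mult to_fract_uminus one_pCons)

lemma rC_of_nat: "rC (of_nat n) = of_nat n"
  by (induction n) (simp_all add: rC_add)

lemma rC_numeral [simp]: "rC (numeral n) = numeral n"
  using rC_of_nat[of "numeral n"] by simp

lemma rC_eq_iff [simp]: "rC a = rC b \<longleftrightarrow> a = b"
  by (simp add: rC_def)

lemma rC_eq_0_iff [simp]: "rC a = 0 \<longleftrightarrow> a = 0"
  by (simp add: rC_def)

lemma rC_inverse: "rC (inverse a) = inverse (rC a)"
proof (cases "a = 0")
  case False
  then have "rC a * rC (inverse a) = 1" by (simp flip: rC_mult)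
  then show ?thesis by (simp add: inverse_unique)
qed simp

lemma rC_divide: "rC (a / b) = rC a / rC b"
  by (simp add: divide_inverse rC_mult rC_inverse)

lemmas rC_hom = rC_add rC_diff rC_mult rC_uminus rC_divide

lemma rderiv_rC [simp]: "rderiv (rC c) = 0"
  by (simp add: rC_def pderiv_pCons)

lemma rderiv_rX [simp]: "rderiv rX = 1"
  by (simp add: rX_def pderiv_pCons flip: one_pCons)

lemma rderiv_numeral [simp]: "rderiv (numeral n) = 0"
  by (metis rC_numeral rderiv_rC)

definition ld :: "rfun \<Rightarrow> rfun" where
  "ld w = rderiv w / w"

lemma rderiv_eq_ld: "f \<noteq> 0 \<Longrightarrow> rderiv f = ld f * f"
  by (simp add: ld_def)

lemma rderiv2_eq_ld: "f \<noteq> 0 \<Longrightarrow> rderiv (rderiv f) = (rderiv (ld f) + ld f ^ 2) * f"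
  by (simp add: ld_def rderiv_divide field_simps power2_eq_square)

lemma ld_mult: "f \<noteq> 0 \<Longrightarrow> g \<noteq> 0 \<Longrightarrow> ld (f * g) = ld f + ld g"
  by (simp add: ld_def field_simps)

lemma ld_1 [simp]: "ld 1 = 0"
  by (simp add: ld_def)

lemma ld_inverse: "f \<noteq> 0 \<Longrightarrow> ld (inverse f) = - ld f"
  unfolding ld_def by (subst rderiv_inverse) (auto simp: power2_eq_square)

lemma ld_divide: "f \<noteq> 0 \<Longrightarrow> g \<noteq> 0 \<Longrightarrow> ld (f / g) = ld f - ld g"
  unfolding divide_inverse[of f g] by (simp add: ld_mult ld_inverse)

lemma ld_power: "f \<noteq> 0 \<Longrightarrow> ld (f ^ n) = of_nat n * ld f"
  by (induction n) (simp_all add: ld_mult algebra_simps)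

lemma ld_power_int: "f \<noteq> 0 \<Longrightarrow> ld (f powi n) = rC (of_int n) * ld f"
proof (cases n rule: int_cases2)
  case (nonneg m)
  assume "f \<noteq> 0" then show ?thesis by (simp add: nonneg ld_power rC_of_nat)
next
  case (nonpos m)
  assume "f \<noteq> 0" then show ?thesis
    by (simp add: nonpos power_int_minus ld_inverse ld_power rC_of_nat rC_uminus)
qed

lemma ld_prod: "finite A \<Longrightarrow> (\<And>x. x \<in> A \<Longrightarrow> f x \<noteq> 0) \<Longrightarrow> ld (prod f A) = (\<Sum>x\<in>A. ld (f x))"
  by (induction A rule: finite_induct) (simp_all add: ld_mult)

subsection \<open>Degree at infinity\<close>

definition fdeg :: "rfun \<Rightarrow> int" where
  "fdeg w = int (degree (fst (quot_of_fract w))) - int (degree (snd (quot_of_fract w)))"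

lemma fdeg_quot:
  assumes "P \<noteq> 0" "Q \<noteq> 0"
  shows "fdeg (to_fract P / to_fract Q) = int (degree P) - int (degree Q)"
proof -
  define A B where "A = fst (quot_of_fract (to_fract P / to_fract Q))"
    and "B = snd (quot_of_fract (to_fract P / to_fract Q))"
  have B0: "B \<noteq> 0" and eq: "to_fract P / to_fract Q = to_fract A / to_fract B"
    by (auto simp: A_def B_def simp flip: Fract_conv_to_fract)
  have A0: "A \<noteq> 0" using eq assms by auto
  from eq B0 assms have "to_fract (P * B) = to_fract (A * Q)"
    by (simp add: field_simps)
  then have "P * B = A * Q" by (simp only: to_fract_eq_iff)
  then have "degree P + degree B = degree A + degree Q"
    using assms A0 B0 by (metis degree_mult_eq)
  then show ?thesis
    unfolding fdeg_def A_def[symmetric] B_def[symmetric] by simp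
qed

lemma fdeg_to_fract: "fdeg (to_fract P) = int (degree P)"
  by (simp add: fdeg_def)

lemma fdeg_mult: "f \<noteq> 0 \<Longrightarrow> g \<noteq> 0 \<Longrightarrow> fdeg (f * g) = fdeg f + fdeg g"
proof -
  assume "f \<noteq> 0" "g \<noteq> 0"
  obtain P Q where 1: "P \<noteq> 0" "Q \<noteq> 0" "f = to_fract P / to_fract Q"
    using \<open>f \<noteq> 0\<close> by (rule rfun_cases_nonzero)
  obtain A B where 2: "A \<noteq> 0" "B \<noteq> 0" "g = to_fract A / to_fract B"
    using \<open>g \<noteq> 0\<close> by (rule rfun_cases_nonzero)
  have "f * g = to_fract (P * A) / to_fract (Q * B)"
    using 1 2 by simp
  then have "fdeg (f * g) = int (degree (P * A)) - int (degree (Q * B))"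
    using 1 2 fdeg_quot[of "P * A" "Q * B"] by simp
  then show ?thesis
    using 1 2 by (simp add: fdeg_quot degree_mult_eq)
qed

lemma fdeg_rC [simp]: "fdeg (rC c) = 0"
  by (simp add: rC_def fdeg_to_fract)

lemma fdeg_1 [simp]: "fdeg 1 = 0"
  using fdeg_rC[of 1] by simp

lemma fdeg_rX [simp]: "fdeg rX = 1"
  by (simp add: rX_def fdeg_to_fract)

lemma rX_nonzero [simp]: "rX \<noteq> 0"
  by (simp add: rX_def)

lemma fdeg_uminus [simp]: "fdeg (- f) = fdeg f"
  by (cases "f = 0") (use fdeg_mult[of "rC (-1)" f] fdeg_rC[of "-1"] in \<open>simp_all add: rC_uminus\<close>)

lemma fdeg_inverse: "f \<noteq> 0 \<Longrightarrow> fdeg (inverse f) = - fdeg f"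
  using fdeg_mult[of f "inverse f"] by simp

lemma fdeg_divide: "f \<noteq> 0 \<Longrightarrow> g \<noteq> 0 \<Longrightarrow> fdeg (f / g) = fdeg f - fdeg g"
  unfolding divide_inverse by (simp add: fdeg_mult fdeg_inverse)

lemma fdeg_power: "f \<noteq> 0 \<Longrightarrow> fdeg (f ^ n) = int n * fdeg f"
  by (induction n) (simp_all add: fdeg_mult algebra_simps)

lemma fdeg_power_int: "f \<noteq> 0 \<Longrightarrow> fdeg (f powi n) = n * fdeg f"
  by (cases n rule: int_cases2) (simp_all add: fdeg_power power_int_minus fdeg_inverse)

lemma fdeg_prod: "finite A \<Longrightarrow> (\<And>x. x \<in> A \<Longrightarrow> f x \<noteq> 0) \<Longrightarrow> fdeg (prod f A) = (\<Sum>x\<in>A. fdeg (f x))"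
  by (induction A rule: finite_induct) (simp_all add: fdeg_mult)

text \<open>Functions of order \<open>x^k\<close> at infinity. Zero needs its own disjunct, since
  \<open>fdeg 0 = 0\<close>.\<close>

definition Oinf :: "int \<Rightarrow> rfun set" where
  "Oinf k = {w. w = 0 \<or> fdeg w \<le> k}"

lemma Oinf_0 [simp]: "0 \<in> Oinf k"
  by (simp add: Oinf_def)

lemma Oinf_mono: "f \<in> Oinf j \<Longrightarrow> j \<le> k \<Longrightarrow> f \<in> Oinf k"
  by (auto simp: Oinf_def)

lemma Oinf_mult: "f \<in> Oinf j \<Longrightarrow> g \<in> Oinf k \<Longrightarrow> f * g \<in> Oinf (j + k)"
  by (cases "f = 0"; cases "g = 0") (auto simp: Oinf_def fdeg_mult)

lemma Oinf_mult': "f \<in> Oinf j \<Longrightarrow> g \<in> Oinf k \<Longrightarrow> j + k \<le> l \<Longrightarrow> f * g \<in> Oinf l"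
  by (blast intro: Oinf_mult Oinf_mono)

lemma Oinf_uminus: "f \<in> Oinf k \<Longrightarrow> - f \<in> Oinf k"
  by (auto simp: Oinf_def)

lemma Oinf_quot:
  assumes "Q \<noteq> 0"
  shows "to_fract P / to_fract Q \<in> Oinf k \<longleftrightarrow> P = 0 \<or> int (degree P) - int (degree Q) \<le> k"
  using assms by (cases "P = 0") (auto simp: Oinf_def fdeg_quot)

lemma Oinf_add: "f \<in> Oinf k \<Longrightarrow> g \<in> Oinf k \<Longrightarrow> f + g \<in> Oinf k"
proof -
  assume *: "f \<in> Oinf k" "g \<in> Oinf k"
  obtain P Q where 1: "Q \<noteq> 0" "f = to_fract P / to_fract Q" by (rule rfun_cases)
  obtain A B where 2: "B \<noteq> 0" "g = to_fract A / to_fract B" by (rule rfun_cases)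
  have eq: "f + g = to_fract (P * B + A * Q) / to_fract (Q * B)"
    using 1 2 by (simp add: field_simps)
  have le1: "int (degree (P * B)) \<le> int (degree Q) + int (degree B) + k \<or> P * B = 0"
    using * 1 2 by (cases "P = 0") (auto simp: Oinf_quot degree_mult_eq)
  have le2: "int (degree (A * Q)) \<le> int (degree Q) + int (degree B) + k \<or> A * Q = 0"
    using * 1 2 by (cases "A = 0") (auto simp: Oinf_quot degree_mult_eq)
  have "degree (P * B + A * Q) \<le> max (degree (P * B)) (degree (A * Q))"
    by (rule degree_add_le_max)
  then have "P * B + A * Q = 0 \<or>
      int (degree (P * B + A * Q)) \<le> int (degree Q) + int (degree B) + k"
    using le1 le2 by (cases "P * B = 0"; cases "A * Q = 0") auto
  then show ?thesis
    unfolding eq using 1 2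
    by (subst Oinf_quot) (auto simp: degree_mult_eq)
qed

lemma Oinf_diff: "f \<in> Oinf k \<Longrightarrow> g \<in> Oinf k \<Longrightarrow> f - g \<in> Oinf k"
  using Oinf_add[of f k "- g"] Oinf_uminus[of g k] by simp

lemma Oinf_sum: "(\<And>x. x \<in> A \<Longrightarrow> f x \<in> Oinf k) \<Longrightarrow> sum f A \<in> Oinf k"
  by (induction A rule: infinite_finite_induct) (auto intro: Oinf_add)

lemma Oinf_rC: "rC c \<in> Oinf 0"
  by (simp add: Oinf_def)

lemma Oinf_rX: "rX \<in> Oinf 1"
  by (simp add: Oinf_def)

lemma Oinf_smult: "f \<in> Oinf k \<Longrightarrow> rC c * f \<in> Oinf k"
  using Oinf_mult[OF Oinf_rC] by fastforce

lemma Oinf_rC_over_rX: "rC c / rX \<in> Oinf (-1)"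
  by (cases "c = 0") (simp_all add: Oinf_def fdeg_divide)

lemma Oinf_fdeg: "f \<in> Oinf (fdeg f)"
  by (simp add: Oinf_def)

lemma rC_in_Oinf_neg: "rC c \<in> Oinf (-1) \<Longrightarrow> c = 0"
  by (auto simp: Oinf_def)

lemma Oinf_to_fract_neg: "to_fract P \<in> Oinf (-1) \<Longrightarrow> P = 0"
  by (auto simp: Oinf_def fdeg_to_fract)

lemma Oinf_rderiv: "w \<in> Oinf k \<Longrightarrow> rderiv w \<in> Oinf (k - 1)"
proof -
  assume w: "w \<in> Oinf k"
  obtain P Q where 1: "Q \<noteq> 0" "w = to_fract P / to_fract Q" by (rule rfun_cases)
  show ?thesis
  proof (cases "pderiv P * Q - P * pderiv Q = 0")
    case True
    then show ?thesis using 1 by (simp add: rderiv_quot del: to_fract_diff to_fract_mult)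
  next
    case False
    have P0: "P \<noteq> 0" using False by auto
    have d0: "degree P + degree Q > 0"
    proof (rule ccontr)
      assume "\<not> ?thesis"
      then have "pderiv P = 0" "pderiv Q = 0" by (auto simp: pderiv_eq_0_iff)
      with False show False by simp
    qed
    have a: "degree (pderiv P * Q) < degree P + degree Q"
    proof (cases "degree P = 0")
      case True
      then have "pderiv P = 0" by (simp add: pderiv_eq_0_iff)
      then show ?thesis using d0 by simp
    qed (use degree_mult_le[of "pderiv P" Q] degree_pderiv[of P] in linarith)
    have b: "degree (P * pderiv Q) < degree P + degree Q"
    proof (cases "degree Q = 0")
      case True
      then have "pderiv Q = 0" by (simp add: pderiv_eq_0_iff)
      then show ?thesis using d0 by simp
    qed (use degree_mult_le[of P "pderiv Q"] degree_pderiv[of Q] in linarith)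
    have "degree (pderiv P * Q - P * pderiv Q) < degree P + degree Q"
      using a b by (rule degree_diff_less)
    moreover have "int (degree P) - int (degree Q) \<le> k"
      using w 1 P0 by (simp add: Oinf_quot)
    moreover have "degree (Q ^ 2) = 2 * degree Q"
      using 1 by (simp add: degree_power_eq)
    ultimately show ?thesis
      using 1 by (simp add: rderiv_quot Oinf_quot del: to_fract_diff to_fract_mult to_fract_power)
  qed
qed

lemma leading_term:
  assumes "f \<noteq> 0" "g \<noteq> 0" "fdeg f = fdeg g"
  obtains c where "c \<noteq> 0" "f - rC c * g \<in> Oinf (fdeg g - 1)"
proof -
  obtain P Q where 1: "P \<noteq> 0" "Q \<noteq> 0" "f / g = to_fract P / to_fract Q"
    using assms by (metis rfun_cases_nonzero divide_eq_0_iff)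
  have "fdeg (f / g) = 0" using assms by (simp add: fdeg_divide)
  then have deg: "degree P = degree Q" using 1 by (simp add: fdeg_quot)
  define c where "c = lead_coeff P / lead_coeff Q"
  have c0: "c \<noteq> 0" using 1 by (simp add: c_def)
  have eq: "f / g - rC c = to_fract (P - smult c Q) / to_fract Q"
    using 1 by (simp add: rC_def field_simps flip: to_fract_mult)
  have le: "degree (P - smult c Q) \<le> degree Q"
    using deg by (metis degree_diff_le degree_smult_le order_refl)
  have "coeff (P - smult c Q) (degree Q) = 0"
    using 1 deg by (simp add: c_def)
  then have "P - smult c Q = 0 \<or> degree (P - smult c Q) < degree Q"
    using le by (metis leading_coeff_0_iff le_neq_implies_less)
  then have "f / g - rC c \<in> Oinf (-1)"
    unfolding eq using 1 by (subst Oinf_quot) auto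
  then have "(f / g - rC c) * g \<in> Oinf (fdeg g - 1)"
    using Oinf_mult[OF _ Oinf_fdeg] by fastforce
  moreover have "(f / g - rC c) * g = f - rC c * g"
    using assms by (simp add: field_simps)
  ultimately show ?thesis using c0 that by metis
qed

text \<open>The Euler operator \<open>x d/dx - n\<close> removes the coefficient of
  \<open>x^n\<close>, so for a polynomial \<open>P\<close> of degree \<open>n\<close> the difference
  has a numerator of degree less than \<open>n\<close> over the denominator \<open>x * P\<close>.
  Quotients follow by subtraction.\<close>

lemma ld_asymptotics:
  assumes "w \<noteq> 0"
  shows "ld w - rC (of_int (fdeg w)) / rX \<in> Oinf (-2)"
proof -
  have *: "ld (to_fract P) - rC (of_nat (degree P)) / rX \<in> Oinf (-2)" if "P \<noteq> 0" for P
  proof -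
    define n where "n = degree P"
    define R where "R = [:0,1:] * pderiv P - smult (of_nat n) P"
    have eq: "ld (to_fract P) - rC (of_nat n) / rX = to_fract R / to_fract ([:0,1:] * P)"
    proof -
      have "to_fract R = rX * to_fract (pderiv P) - rC (of_nat n) * to_fract P"
        by (simp add: R_def rX_def rC_def flip: to_fract_mult)
      moreover have "to_fract ([:0,1:] * P) = rX * to_fract P"
        by (simp add: rX_def flip: to_fract_mult)
      ultimately show ?thesis using that by (simp add: ld_def field_simps)
    qed
    have "coeff R k = (of_nat k - of_nat n) * coeff P k" for k
      by (cases k) (simp_all add: R_def coeff_pderiv algebra_simps)
    then have "coeff R k = 0" if "k \<ge> n" for k
      using that coeff_eq_0[of P k] by (cases "k = n") (auto simp: n_def)
    then have "R = 0 \<or> degree R < n"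
      by (metis leading_coeff_0_iff not_le)
    then show ?thesis
      using that unfolding n_def[symmetric] eq
      by (subst Oinf_quot) (auto simp: degree_mult_eq n_def simp del: mult_pCons_left)
  qed
  obtain P Q where 1: "P \<noteq> 0" "Q \<noteq> 0" "w = to_fract P / to_fract Q"
    using assms by (rule rfun_cases_nonzero)
  have "ld w - rC (of_int (fdeg w)) / rX =
     (ld (to_fract P) - rC (of_nat (degree P)) / rX) - (ld (to_fract Q) - rC (of_nat (degree Q)) / rX)"
    using 1 by (simp add: ld_divide fdeg_quot rC_diff diff_divide_distrib)
  then show ?thesis using *[OF 1(1)] *[OF 1(2)] by (simp add: Oinf_diff)
qed

lemma ld_Oinf: "ld w \<in> Oinf (-1)"
proof (cases "w = 0")
  case False
  have "rC (of_int (fdeg w)) / rX \<in> Oinf (-1)"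
    by (rule Oinf_rC_over_rX)
  moreover have "ld w - rC (of_int (fdeg w)) / rX \<in> Oinf (-1)"
    using ld_asymptotics[OF False] by (rule Oinf_mono) simp
  ultimately show ?thesis
    using Oinf_add by fastforce
qed (simp add: ld_def)

lemma Oinf_rX_mult: "f \<in> Oinf k \<Longrightarrow> rX * f \<in> Oinf (k + 1)"
  using Oinf_mult[OF Oinf_rX, of f k] by (simp add: add.commute)

subsection \<open>Residue at infinity\<close>

text \<open>\<open>c\<close> is the coefficient of \<open>1/x\<close> in the Laurent expansion at
  infinity, so minus the usual residue there; \<open>g\<close> is the polynomial part.\<close>

definition has_res :: "rfun \<Rightarrow> real \<Rightarrow> bool" where
  "has_res w c \<longleftrightarrow> (\<exists>g. w - to_fract g - rC c / rX \<in> Oinf (-2))"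

lemma has_res_add: "has_res v c \<Longrightarrow> has_res w d \<Longrightarrow> has_res (v + w) (c + d)"
proof -
  assume "has_res v c" "has_res w d"
  then obtain g h where *: "v - to_fract g - rC c / rX \<in> Oinf (-2)"
      "w - to_fract h - rC d / rX \<in> Oinf (-2)"
    by (auto simp: has_res_def)
  have "v + w - to_fract (g + h) - rC (c + d) / rX =
      (v - to_fract g - rC c / rX) + (w - to_fract h - rC d / rX)"
    by (simp add: rC_add add_divide_distrib)
  with Oinf_add[OF *] show ?thesis unfolding has_res_def by metis
qed

lemma has_res_smult: "has_res w d \<Longrightarrow> has_res (rC c * w) (c * d)"
proof -
  assume "has_res w d"
  then obtain g where "w - to_fract g - rC d / rX \<in> Oinf (-2)"
    by (auto simp: has_res_def)
  then have "rC c * (w - to_fract g - rC d / rX) \<in> Oinf (-2)"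
    by (rule Oinf_smult)
  moreover have "rC c * (w - to_fract g - rC d / rX)
      = rC c * w - to_fract ([:c:] * g) - rC (c * d) / rX"
    unfolding to_fract_mult rC_mult by (simp add: rC_def algebra_simps)
  ultimately show ?thesis unfolding has_res_def by metis
qed

lemma has_res_unique: "has_res w c \<Longrightarrow> has_res w d \<Longrightarrow> c = d"
proof -
  assume "has_res w c" "has_res w d"
  then obtain g h where *: "w - to_fract g - rC c / rX \<in> Oinf (-2)"
      "w - to_fract h - rC d / rX \<in> Oinf (-2)"
    by (auto simp: has_res_def)
  have "rX * ((w - to_fract g - rC c / rX) - (w - to_fract h - rC d / rX)) \<in> Oinf (-1)"
    using Oinf_rX_mult[OF Oinf_diff[OF *]] by simp
  moreover have "rX * ((w - to_fract g - rC c / rX) - (w - to_fract h - rC d / rX))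
      = to_fract (pCons (d - c) (h - g))"
  proof -
    have "pCons (d - c) (h - g) = [:d - c:] + [:0, 1:] * (h - g)" by simp
    then have "to_fract (pCons (d - c) (h - g)) = rC (d - c) + rX * to_fract (h - g)"
      by (simp only: rC_def rX_def to_fract_add to_fract_mult)
    then show ?thesis by (simp add: right_diff_distrib distrib_left rC_diff)
  qed
  ultimately have "pCons (d - c) (h - g) = 0"
    by (metis Oinf_to_fract_neg)
  then show ?thesis by simp
qed

lemma has_res_exists: "\<exists>c. has_res w c"
proof -
  obtain P Q where 1: "Q \<noteq> 0" "w = to_fract P / to_fract Q" by (rule rfun_cases)
  define R where "R = P mod Q"
  have P: "P = (P div Q) * Q + R" by (simp add: R_def)
  have w: "w = to_fract (P div Q) + to_fract R / to_fract Q"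
    using 1 P by (metis add_divide_distrib nonzero_mult_div_cancel_right to_fract_add
        to_fract_eq_0_iff to_fract_mult)
  have R: "R = 0 \<or> degree R < degree Q"
    using 1 degree_mod_less R_def by blast
  have "\<exists>c. to_fract R / to_fract Q - rC c / rX \<in> Oinf (-2)"
  proof (cases "R \<noteq> 0 \<and> degree Q = Suc (degree R)")
    case True
    define f where "f = to_fract R / to_fract Q"
    have "f \<noteq> 0" "fdeg f = fdeg (1 / rX)" "fdeg (1 / rX) = -1"
      using 1 True by (simp_all add: f_def fdeg_to_fract fdeg_divide)
    then show ?thesis
      using leading_term[of f "1 / rX"] by (simp add: f_def) blast
  next
    case False
    then have "to_fract R / to_fract Q \<in> Oinf (-2)"
      using R 1 by (subst Oinf_quot) auto
    then show ?thesis by (intro exI[of _ 0]) simp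
  qed
  then show ?thesis unfolding has_res_def w
    by (metis add_diff_cancel_left')
qed

definition res :: "rfun \<Rightarrow> real" where
  "res w = (THE c. has_res w c)"

lemma res_eqI: "has_res w c \<Longrightarrow> res w = c"
  unfolding res_def using has_res_unique by blast

lemma has_res_res: "has_res w (res w)"
  using has_res_exists res_eqI by metis

lemma res_add: "res (v + w) = res v + res w"
  by (intro res_eqI has_res_add has_res_res)

lemma res_smult: "res (rC c * w) = c * res w"
  by (intro res_eqI has_res_smult has_res_res)

lemma res_uminus: "res (- w) = - res w"
  using res_smult[of "-1" w] by (simp add: rC_uminus)

lemma res_diff: "res (v - w) = res v - res w"
  using res_add[of v "- w"] by (simp add: res_uminus)

lemma res_to_fract: "res (to_fract g) = 0"
  by (intro res_eqI) (auto simp: has_res_def intro!: exI[of _ g])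

lemma res_Oinf: "w \<in> Oinf (-2) \<Longrightarrow> res w = 0"
  by (intro res_eqI) (auto simp: has_res_def intro!: exI[of _ 0])

lemma res_nonzero:
  assumes "w \<noteq> 0" "fdeg w = -1"
  shows "res w \<noteq> 0"
proof -
  have "fdeg w = fdeg (1 / rX)" "fdeg (1 / rX) = -1"
    using assms by (simp_all add: fdeg_divide)
  then obtain c where c: "c \<noteq> 0" "w - rC c * (1 / rX) \<in> Oinf (-2)"
    using leading_term[of w "1 / rX"] assms by auto
  then have "has_res w c"
    unfolding has_res_def by (intro exI[of _ 0]) simp
  with c show ?thesis using res_eqI by metis
qed

lemma res_rderiv: "res (rderiv w) = 0"
proof -
  obtain g where g: "w - to_fract g - rC (res w) / rX \<in> Oinf (-2)"
    using has_res_res by (auto simp: has_res_def)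
  define e where "e = w - to_fract g"
  have "e \<in> Oinf (-1)"
    using Oinf_add[OF Oinf_mono[OF g, of "-1"] Oinf_rC_over_rX[of "res w"]]
    by (simp add: e_def)
  then have "rderiv e \<in> Oinf (-2)"
    using Oinf_rderiv by fastforce
  then have "res (rderiv e) = 0" by (rule res_Oinf)
  then show ?thesis
    by (simp add: e_def res_diff res_to_fract)
qed

text \<open>A nonzero proper part \<open>R / Q\<close> has degree \<open>-1 - k\<close> with
  \<open>k\<close> natural; pairing it with \<open>x^k\<close> gives degree -1 and hence a nonzero
  residue. The polynomials are thus their own annihilator under the residue pairing.\<close>

lemma polynomial_if_res_zero:
  assumes "\<And>g. res (to_fract g * F) = 0"
  obtains G where "F = to_fract G"
proof -
  obtain P Q where 1: "Q \<noteq> 0" "F = to_fract P / to_fract Q" by (rule rfun_cases)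
  define R where "R = P mod Q"
  have P: "P = (P div Q) * Q + R" by (simp add: R_def)
  have w: "F = to_fract (P div Q) + to_fract R / to_fract Q"
    using 1 P by (metis add_divide_distrib nonzero_mult_div_cancel_right to_fract_add
        to_fract_eq_0_iff to_fract_mult)
  have R: "R = 0 \<or> degree R < degree Q"
    using 1 degree_mod_less R_def by blast
  have "R = 0"
  proof (rule ccontr)
    assume R0: "R \<noteq> 0"
    define k where "k = degree Q - 1 - degree R"
    define g where "g = (monom 1 k :: real poly)"
    have g0: "g \<noteq> 0" "degree g = k" by (simp_all add: g_def degree_monom_eq)
    have "to_fract g * F = to_fract (g * (P div Q)) + to_fract g * (to_fract R / to_fract Q)"
      by (simp add: w algebra_simps)
    then have "res (to_fract g * (to_fract R / to_fract Q)) = 0"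
      using assms[of g] res_to_fract[of "g * (P div Q)"] by (simp add: res_add)
    moreover have "fdeg (to_fract g * (to_fract R / to_fract Q)) = -1"
      using g0 R R0 1 by (simp add: fdeg_mult fdeg_divide fdeg_to_fract k_def)
    ultimately show False using g0 R0 1 res_nonzero by force
  qed
  then show ?thesis using w that by simp
qed

subsection \<open>Rational functions regular at a point\<close>

definition Reg :: "real \<Rightarrow> rfun set" where
  "Reg x0 = {w. \<exists>P Q. poly Q x0 \<noteq> 0 \<and> w = to_fract P / to_fract Q}"

lemma Reg_quot: "poly Q x0 \<noteq> 0 \<Longrightarrow> to_fract P / to_fract Q \<in> Reg x0"
  by (auto simp: Reg_def)

lemma RegE:
  assumes "w \<in> Reg x0"
  obtains P Q where "poly Q x0 \<noteq> 0" "Q \<noteq> 0" "w = to_fract P / to_fract Q"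
  using assms by (auto simp: Reg_def) (metis poly_0)

lemma Reg_to_fract: "to_fract P \<in> Reg x0"
  using Reg_quot[of 1 x0 P] by simp

lemma Reg_rC: "rC c \<in> Reg x0" and Reg_rX: "rX \<in> Reg x0"
  by (simp_all add: rC_def rX_def Reg_to_fract)

lemma Reg_0 [simp]: "0 \<in> Reg x0" and Reg_1 [simp]: "1 \<in> Reg x0"
  using Reg_to_fract[of 0] Reg_to_fract[of 1] by auto

lemma Reg_numeral [simp]: "numeral n \<in> Reg x0"
  using Reg_rC[of "numeral n"] by simp

lemma Reg_mult: "v \<in> Reg x0 \<Longrightarrow> w \<in> Reg x0 \<Longrightarrow> v * w \<in> Reg x0"
proof -
  assume "v \<in> Reg x0" "w \<in> Reg x0"
  then obtain P Q A B where "poly Q x0 \<noteq> 0" "v = to_fract P / to_fract Q"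
    "poly B x0 \<noteq> 0" "w = to_fract A / to_fract B" by (elim RegE) blast
  then show ?thesis using Reg_quot[of "Q * B" x0 "P * A"] by simp
qed

lemma Reg_add: "v \<in> Reg x0 \<Longrightarrow> w \<in> Reg x0 \<Longrightarrow> v + w \<in> Reg x0"
proof -
  assume "v \<in> Reg x0" "w \<in> Reg x0"
  then obtain P Q A B where *: "poly Q x0 \<noteq> 0" "Q \<noteq> 0" "v = to_fract P / to_fract Q"
    "poly B x0 \<noteq> 0" "B \<noteq> 0" "w = to_fract A / to_fract B" by (elim RegE) blast
  then have "v + w = to_fract (P * B + A * Q) / to_fract (Q * B)"
    by (simp add: add_frac_eq)
  then show ?thesis using * Reg_quot[of "Q * B" x0 "P * B + A * Q"] by simp
qed

lemma Reg_uminus: "w \<in> Reg x0 \<Longrightarrow> - w \<in> Reg x0"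
  using Reg_mult[OF Reg_rC[of "-1"]] by (fastforce simp: rC_uminus)

lemma Reg_diff: "v \<in> Reg x0 \<Longrightarrow> w \<in> Reg x0 \<Longrightarrow> v - w \<in> Reg x0"
  using Reg_add[of v x0 "- w"] Reg_uminus by simp

lemma Reg_power: "w \<in> Reg x0 \<Longrightarrow> w ^ n \<in> Reg x0"
  by (induction n) (auto intro: Reg_mult)

lemma Reg_sum: "(\<And>x. x \<in> A \<Longrightarrow> f x \<in> Reg x0) \<Longrightarrow> sum f A \<in> Reg x0"
  by (induction A rule: infinite_finite_induct) (auto intro: Reg_add)

lemma Reg_rderiv: "w \<in> Reg x0 \<Longrightarrow> rderiv w \<in> Reg x0"
proof -
  assume "w \<in> Reg x0"
  then obtain P Q where "poly Q x0 \<noteq> 0" "Q \<noteq> 0" "w = to_fract P / to_fract Q" by (rule RegE)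
  then show ?thesis
    using Reg_quot[of "Q ^ 2" x0 "pderiv P * Q - P * pderiv Q"] by (simp add: rderiv_quot)
qed

lemma Reg_ld_to_fract: "poly P x0 \<noteq> 0 \<Longrightarrow> ld (to_fract P) \<in> Reg x0"
  by (simp add: ld_def Reg_quot)

lemmas Reg_intros = Reg_add Reg_mult Reg_diff Reg_uminus Reg_power Reg_rC Reg_rX Reg_0 Reg_1
  Reg_numeral Reg_rderiv

lemma has_pole_iff: "has_pole w x0 \<longleftrightarrow> w \<notin> Reg x0"
proof -
  define A B where "A = fst (quot_of_fract w)" and "B = snd (quot_of_fract w)"
  have B0: "B \<noteq> 0" and w: "w = to_fract A / to_fract B" and cop: "coprime A B"
    by (auto simp: A_def B_def coprime_quot_of_fract simp flip: Fract_conv_to_fract)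
  have "poly B x0 \<noteq> 0" if reg: "w \<in> Reg x0"
  proof
    assume Bx: "poly B x0 = 0"
    obtain P Q where 1: "poly Q x0 \<noteq> 0" "Q \<noteq> 0" "w = to_fract P / to_fract Q"
      using reg by (rule RegE)
    then have "to_fract (A * Q) = to_fract (P * B)"
      using w B0 by (simp add: frac_eq_eq)
    then have "A * Q = P * B" by (simp only: to_fract_eq_iff)
    then have "poly A x0 * poly Q x0 = poly P x0 * poly B x0" by (metis poly_mult)
    with Bx 1 have "poly A x0 = 0" by simp
    with Bx cop show False
      by (metis coprime_def is_unit_poly_iff dvd_refl poly_eq_0_iff_dvd pCons_eq_0_iff
          is_unit_pCons_iff zero_neq_one one_neq_zero)
  qed
  then show ?thesis
    unfolding has_pole_def B_def[symmetric] using w by (auto simp: Reg_def)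
qed

lemma Reg_simple_pole:
  assumes "rC k / (rX - rC x0) \<in> Reg x0"
  shows "k = 0"
proof -
  obtain P Q where 1: "poly Q x0 \<noteq> 0" "Q \<noteq> 0" "rC k / (rX - rC x0) = to_fract P / to_fract Q"
    using assms by (rule RegE)
  have X: "rX - rC x0 = to_fract [:- x0, 1:]"
    by (simp add: rX_def rC_def flip: to_fract_diff)
  have "[:- x0, 1:] \<noteq> 0" by simp
  then have "to_fract ([:k:] * Q) = to_fract (P * [:- x0, 1:])"
    using 1 unfolding X to_fract_mult by (simp add: frac_eq_eq rC_def)
  then have "[:k:] * Q = P * [:- x0, 1:]" by (simp only: to_fract_eq_iff)
  then have "poly ([:k:] * Q) x0 = poly (P * [:- x0, 1:]) x0" by simp
  then show ?thesis using 1 by simp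
qed

subsection \<open>Jacobi type operators and their Riccati form\<close>

definition qJ :: "real \<Rightarrow> real \<Rightarrow> rfun" where
  "qJ a b = rC (a + 1) * (rX + 1) + rC (b + 1) * (rX - 1)"

definition LJ :: "rfun \<Rightarrow> real \<Rightarrow> real \<Rightarrow> rfun \<Rightarrow> rfun" where
  "LJ r a b f = (rX ^ 2 - 1) * rderiv (rderiv f) + qJ a b * rderiv f + r * f"

definition RJ :: "rfun \<Rightarrow> real \<Rightarrow> real \<Rightarrow> rfun \<Rightarrow> rfun" where
  "RJ r a b w = (rX ^ 2 - 1) * (rderiv w + w ^ 2) + qJ a b * w + r"

lemma LJ_eq_RJ: "f \<noteq> 0 \<Longrightarrow> LJ r a b f = RJ r a b (ld f) * f"
  unfolding LJ_def RJ_def rderiv2_eq_ld by (simp add: rderiv_eq_ld algebra_simps)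

lemma LJ_eigen_iff: "f \<noteq> 0 \<Longrightarrow> LJ r a b f = rC l * f \<longleftrightarrow> RJ r a b (ld f) = rC l"
  by (simp add: LJ_eq_RJ)

lemma LJ_add: "LJ r a b (f + g) = LJ r a b f + LJ r a b g"
  by (simp add: LJ_def algebra_simps)

lemma LJ_smult: "LJ r a b (rC c * f) = rC c * LJ r a b f"
  by (simp add: LJ_def algebra_simps)

lemma rX_pm_nonzero [simp]: "rX - 1 \<noteq> 0" "rX + 1 \<noteq> 0" "rX ^ 2 - 1 \<noteq> 0" "rX \<noteq> 1"
proof -
  have "rX - 1 = to_fract [:-1, 1:]" "rX + 1 = to_fract [:1, 1:]"
    by (simp_all add: rX_def one_pCons flip: to_fract_1 to_fract_add to_fract_diff)
  then show 1: "rX - 1 \<noteq> 0" "rX + 1 \<noteq> 0" by simp_all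
  then show "rX \<noteq> 1" by auto
  have "rX ^ 2 - 1 = (rX - 1) * (rX + 1)" by (simp add: power2_eq_square algebra_simps)
  with 1 show "rX ^ 2 - 1 \<noteq> 0" by simp
qed

lemma rX_square_minus_one: "rX ^ 2 - 1 = (rX - 1) * (rX + 1)"
  by (simp add: power2_eq_square algebra_simps)

lemma eta_mult: "(rX ^ 2 - 1) * eta a b = qJ a b"
proof -
  have "A * B * (c / A + d / B) = c * B + d * A" if "A \<noteq> 0" "B \<noteq> 0" for A B c d :: rfun
    using that by (simp add: field_simps)
  then show ?thesis unfolding rX_square_minus_one eta_def qJ_def by simp
qed

text \<open>The constant is the indicial polynomial at infinity: \<open>s^2 - s\<close> comes from
  the second-order part and \<open>(a + b + 2) s\<close> from \<open>qJ a b\<close>, while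
  \<open>r\<close> decays.\<close>

lemma RJ_asymptotics:
  assumes r: "r \<in> Oinf (-1)" and w: "w - rC s / rX \<in> Oinf (-2)"
  shows "RJ r a b w - rC (s * (s + a + b + 1)) \<in> Oinf (-1)"
proof -
  define e where "e = w - rC s / rX"
  have e: "e \<in> Oinf (-2)" using w by (simp add: e_def)
  have e': "rderiv e \<in> Oinf (-3)" using Oinf_rderiv[OF e] by simp
  have w_eq: "w = rC s / rX + e" by (simp add: e_def)
  have x: "(1 :: rfun) / rX \<in> Oinf (-1)" using Oinf_rC_over_rX[of 1] by simp
  have x2: "rX ^ 2 - 1 \<in> Oinf 2"
    by (intro Oinf_diff) (auto simp: Oinf_def fdeg_power)
  have q: "qJ a b \<in> Oinf 1"
    unfolding qJ_def by (intro Oinf_add Oinf_smult Oinf_diff) (auto simp: Oinf_def)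
  have dw: "rderiv (rC s / rX) = - rC s / rX ^ 2" by (simp add: rderiv_divide)
  have "RJ r a b w - rC (s * (s + a + b + 1)) =
     rC (s - s ^ 2) * ((1 / rX) * (1 / rX)) + (rX ^ 2 - 1) * rderiv e
     + rC (2 * s) * ((rX ^ 2 - 1) * (e * (1 / rX))) + (rX ^ 2 - 1) * (e * e)
     + rC ((a - b) * s) * (1 / rX) + qJ a b * e + r"
    unfolding RJ_def w_eq rderiv_add dw
    by (simp add: qJ_def rC_hom power2_eq_square field_simps)
  moreover have "\<dots> \<in> Oinf (-1)"
    by (intro Oinf_add Oinf_smult r x Oinf_mult'[OF x2 e'] Oinf_mult'[OF x2 Oinf_mult[OF e x]]
        Oinf_mult'[OF x2 Oinf_mult[OF e e]] Oinf_mult'[OF q e] Oinf_mult'[OF x x]) simp_all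
  ultimately show ?thesis by simp
qed

lemma RJ_exponent:
  assumes r: "r \<in> Oinf (-1)" and w: "w - rC s / rX \<in> Oinf (-2)" and "RJ r a b w = rC l"
  shows "l = s * (s + a + b + 1)"
  using RJ_asymptotics[OF r w, of a b] assms(3) rC_in_Oinf_neg[of "l - s * (s + a + b + 1)"]
  by (simp add: rC_diff)

lemma LJ_leading:
  assumes r: "r \<in> Oinf (-1)" and f: "f \<noteq> 0"
  defines "s \<equiv> of_int (fdeg f)"
  shows "LJ r a b f - rC (s * (s + a + b + 1)) * f \<in> Oinf (fdeg f - 1)"
proof -
  have "RJ r a b (ld f) - rC (s * (s + a + b + 1)) \<in> Oinf (-1)"
    unfolding s_def by (intro RJ_asymptotics r ld_asymptotics f)
  from Oinf_mult[OF this Oinf_fdeg[of f]]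
  show ?thesis using f by (simp add: LJ_eq_RJ algebra_simps)
qed

text \<open>Conjugation by \<open>(x - 1)^(-a)\<close>. In Riccati form it is a translation by a
  rational function, so it is available for every real \<open>a\<close>.\<close>

lemma RJ_gauge_right:
  "RJ r a b (w - rC a / (rX - 1)) = RJ r (- a) b w - rC (a * (b + 1))"
proof -
  define y where "y = 1 / (rX - 1)"
  have y: "y * (rX - 1) = 1" by (simp add: y_def)
  have dy: "rderiv y = - (y ^ 2)" by (simp add: y_def rderiv_divide power_divide)
  have eq: "rC a / (rX - 1) = rC a * y" by (simp add: y_def)
  show ?thesis
    unfolding eq RJ_def rderiv_diff rderiv_mult dy rderiv_rC qJ_def rC_hom rC_1
    using y by algebra
qed

lemma RJ_gauge_left:
  "RJ r a b (w - rC b / (rX + 1)) = RJ r a (- b) w - rC (b * (a + 1))"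
proof -
  define y where "y = 1 / (rX + 1)"
  have y: "y * (rX + 1) = 1" by (simp add: y_def)
  have dy: "rderiv y = - (y ^ 2)" by (simp add: y_def rderiv_divide power_divide)
  have eq: "rC b / (rX + 1) = rC b * y" by (simp add: y_def)
  show ?thesis
    unfolding eq RJ_def rderiv_diff rderiv_mult dy rderiv_rC qJ_def rC_hom rC_1
    using y by algebra
qed

lemma indicial_right:
  assumes g: "g \<in> Reg 1" and r: "r \<in> Reg 1" and l: "RJ r a b (rC s / (rX - 1) + g) = rC l"
  shows "s = 0 \<or> s = - a"
proof -
  \<comment> \<open>\<open>2 * k\<close> is the coefficient of \<open>1/(x - 1)\<close> in the
    equation; the extra constant \<open>k\<close> in \<open>R\<close> arises from
    \<open>(x + 1)/(x - 1) = 1 + 2/(x - 1)\<close>.\<close>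
  define k where "k = s ^ 2 + a * s"
  define R where "R = rC k + 2 * (rX + 1) * rC s * g + qJ a b * g + (rX ^ 2 - 1) * (rderiv g + g ^ 2)
      + rC ((b + 1) * s) + r - rC l"
  have reg: "R \<in> Reg 1"
    unfolding R_def qJ_def by (intro Reg_intros g r)
  define y where "y = 1 / (rX - 1)"
  have y: "y * (rX - 1) = 1" by (simp add: y_def)
  have dy: "rderiv y = - (y ^ 2)" by (simp add: y_def rderiv_divide power_divide)
  have eq: "rC c / (rX - 1) = rC c * y" for c by (simp add: y_def)
  have "RJ r a b (rC s / (rX - 1) + g) - rC l = rC (2 * k) / (rX - 1) + R"
    unfolding eq unfolding RJ_def rderiv_add rderiv_mult dy rderiv_rC qJ_def R_def k_def rC_hom rC_1
      rC_numeral power2_eq_square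
    using y by algebra
  then have "rC (2 * k) / (rX - rC 1) = - R"
    using l by (simp add: eq_neg_iff_add_eq_0)
  then have "2 * k = 0"
    using Reg_simple_pole Reg_uminus[OF reg] by metis
  then have "s * (s + a) = 0" by (simp add: k_def power2_eq_square algebra_simps)
  then show ?thesis by auto
qed

lemma indicial_left:
  assumes g: "g \<in> Reg (-1)" and r: "r \<in> Reg (-1)" and l: "RJ r a b (rC s / (rX + 1) + g) = rC l"
  shows "s = 0 \<or> s = - b"
proof -
  define k where "k = s ^ 2 + b * s"
  define R where "R = rC k + 2 * (rX - 1) * rC s * g + qJ a b * g + (rX ^ 2 - 1) * (rderiv g + g ^ 2)
      + rC ((a + 1) * s) + r - rC l"
  have reg: "R \<in> Reg (-1)"
    unfolding R_def qJ_def by (intro Reg_intros g r)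
  define y where "y = 1 / (rX + 1)"
  have y: "y * (rX + 1) = 1" by (simp add: y_def)
  have dy: "rderiv y = - (y ^ 2)" by (simp add: y_def rderiv_divide power_divide)
  have eq: "rC c / (rX + 1) = rC c * y" for c by (simp add: y_def)
  have "RJ r a b (rC s / (rX + 1) + g) - rC l = rC (- 2 * k) / (rX + 1) + R"
    unfolding eq unfolding RJ_def rderiv_add rderiv_mult dy rderiv_rC qJ_def R_def k_def rC_hom rC_1
      rC_numeral power2_eq_square
    using y by algebra
  then have "rC (- 2 * k) / (rX - rC (-1)) = - R"
    using l by (simp add: eq_neg_iff_add_eq_0 rC_uminus)
  then have "- 2 * k = 0"
    using Reg_simple_pole Reg_uminus[OF reg] by metis
  then have "s * (s + b) = 0" by (simp add: k_def power2_eq_square algebra_simps)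
  then show ?thesis by auto
qed

section \<open>The potential of an exceptional operator\<close>

definition Vpot :: "real poly \<Rightarrow> rfun" where
  "Vpot \<tau> = 2 * (rX ^ 2 - 1) * rderiv (logder \<tau>) + 2 * rX * logder \<tau>"

lemma logder_eq_ld: "logder \<tau> = ld (to_fract \<tau>)"
  by (simp add: logder_def ld_def)

text \<open>If \<open>\<tau>\<close> has degree \<open>N\<close>, then \<open>logder \<tau>\<close>
  is \<open>N/x\<close> up to order \<open>1/x^2\<close>, and the constant terms \<open>-2 N\<close>
  and \<open>2 N\<close> of the two summands cancel.\<close>

lemma Vpot_Oinf: "Vpot \<tau> \<in> Oinf (-1)"
proof (cases "\<tau> = 0")
  case False
  define N where "N = rC (of_int (fdeg (to_fract \<tau>)))"
  define e where "e = logder \<tau> - N / rX"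
  have e: "e \<in> Oinf (-2)"
    using ld_asymptotics[of "to_fract \<tau>"] False by (simp add: e_def N_def logder_eq_ld)
  have e': "rderiv e \<in> Oinf (-3)" using Oinf_rderiv[OF e] by simp
  have x2: "rX ^ 2 - 1 \<in> Oinf 2"
    by (intro Oinf_diff) (auto simp: Oinf_def fdeg_power)
  have x: "(1 :: rfun) / rX \<in> Oinf (-1)" using Oinf_rC_over_rX[of 1] by simp
  define y where "y = 1 / rX"
  have y: "y * rX = 1" and dy: "rderiv y = - (y ^ 2)"
    by (simp_all add: y_def rderiv_divide power_divide)
  have u: "logder \<tau> = N * y + e" by (simp add: e_def y_def)
  have "rderiv N = 0" by (simp add: N_def)
  then have "Vpot \<tau> = rC 2 * (N * ((1 / rX) * (1 / rX))) + rC 2 * ((rX ^ 2 - 1) * rderiv e)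
      + rC 2 * (rX * e)"
    unfolding Vpot_def u rderiv_add rderiv_mult dy y_def[symmetric] rC_numeral
    using y by algebra
  moreover have "\<dots> \<in> Oinf (-1)"
    unfolding N_def
    by (intro Oinf_add Oinf_smult Oinf_mult'[OF x x] Oinf_mult'[OF x2 e'] Oinf_mult'[OF Oinf_rX e])
       simp_all
  ultimately show ?thesis by simp
qed (simp add: Vpot_def logder_def)

lemma Vpot_Reg: "poly \<tau> x0 \<noteq> 0 \<Longrightarrow> Vpot \<tau> \<in> Reg x0"
  unfolding Vpot_def logder_eq_ld by (intro Reg_intros Reg_ld_to_fract)

subsection \<open>Triangular operators on spaces of rational functions\<close>

definition rsub :: "rfun set \<Rightarrow> bool" where
  "rsub U \<longleftrightarrow> 0 \<in> U \<and> (\<forall>f\<in>U. \<forall>g\<in>U. f + g \<in> U) \<and> (\<forall>c. \<forall>f\<in>U. rC c * f \<in> U)"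

lemma rsub_0: "rsub U \<Longrightarrow> 0 \<in> U"
  and rsub_add: "rsub U \<Longrightarrow> f \<in> U \<Longrightarrow> g \<in> U \<Longrightarrow> f + g \<in> U"
  and rsub_smult: "rsub U \<Longrightarrow> f \<in> U \<Longrightarrow> rC c * f \<in> U"
  by (auto simp: rsub_def)

lemma rsub_uminus: "rsub U \<Longrightarrow> f \<in> U \<Longrightarrow> - f \<in> U"
  using rsub_smult[of U f "-1"] by (simp add: rC_uminus)

lemma rsub_diff: "rsub U \<Longrightarrow> f \<in> U \<Longrightarrow> g \<in> U \<Longrightarrow> f - g \<in> U"
  using rsub_add[of U f "- g"] rsub_uminus by simp

text \<open>If a lower degree in \<open>U\<close> carries the same diagonal entry, the search
  restarts there; otherwise \<open>L - l\<close> can be inverted on the lower degrees, and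
  correcting \<open>f\<close> by a solution of smaller degree gives the eigenvector. The lower bound
  \<open>- K\<close> makes both descents end. The eigenvector may have smaller degree than
  \<open>f\<close>.\<close>

lemma triangular_eigenvector:
  assumes U: "rsub U"
    and L_add: "\<And>f g. L (f + g) = L f + L g" and L_smult: "\<And>c f. L (rC c * f) = rC c * L f"
    and inv: "\<And>f. f \<in> U \<Longrightarrow> L f \<in> U"
    and lead: "\<And>f. f \<in> U \<Longrightarrow> f \<noteq> 0 \<Longrightarrow> L f - rC (e (fdeg f)) * f \<in> Oinf (fdeg f - 1)"
    and lb: "\<And>f. f \<in> U \<Longrightarrow> f \<noteq> 0 \<Longrightarrow> fdeg f \<ge> - K"
    and f: "f \<in> U" "f \<noteq> 0"
  shows "\<exists>g\<in>U. g \<noteq> 0 \<and> L g = rC (e (fdeg f)) * g"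
  using f
proof (induction "nat (fdeg f + K)" arbitrary: f rule: less_induct)
  case less
  define l where "l = e (fdeg f)"
  have L0: "L 0 = 0" using L_smult[of 0 0] by simp
  have L_diff: "L (f - g) = L f - L g" for f g
    using L_add[of f "- g"] L_smult[of "-1" g] by (simp add: rC_uminus)
  show ?case
  proof (cases "\<exists>g\<in>U. g \<noteq> 0 \<and> fdeg g < fdeg f \<and> e (fdeg g) = l")
    case True
    then obtain g where g: "g \<in> U" "g \<noteq> 0" "fdeg g < fdeg f" "e (fdeg g) = l" by blast
    then have "nat (fdeg g + K) < nat (fdeg f + K)"
      using lb[OF g(1,2)] lb[OF less.prems] by linarith
    from less.hyps[OF this g(1,2)] g(4) show ?thesis by (simp add: l_def)
  next
    case False
    have solve: "\<exists>k\<in>U. L k - rC l * k = h \<and> k \<in> Oinf (fdeg f - 1)"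
      if "h \<in> U" "h \<in> Oinf (fdeg f - 1)" for h
      using that
    \<comment> \<open>The measure reserves 0 for \<open>h = 0\<close>, where \<open>fdeg\<close>
      carries no information.\<close>
    proof (induction "if h = 0 then 0 else Suc (nat (fdeg h + K))" arbitrary: h rule: less_induct)
      case less
      show ?case
      proof (cases "h = 0")
        case True
        then show ?thesis using U by (intro bexI[of _ 0]) (auto simp: L0 rsub_0)
      next
        case h0: False
        then have "fdeg h < fdeg f" using less.prems by (auto simp: Oinf_def)
        with False h0 less.prems have ne: "e (fdeg h) \<noteq> l" by blast
        \<comment> \<open>With this factor the image of \<open>c * h\<close> under
          \<open>L - l\<close> has the leading term of \<open>h\<close>, so that \<open>h'\<close>
          has smaller degree.\<close>
        define c where "c = 1 / (e (fdeg h) - l)"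
        define h' where "h' = h - (L (rC c * h) - rC l * (rC c * h))"
        have "rC c * rC (e (fdeg h) - l) = 1"
          using ne by (simp add: c_def flip: rC_mult)
        then have "rC c * rC (e (fdeg h)) - rC c * rC l = 1"
          by (simp add: rC_diff algebra_simps)
        then have "h' = - (rC c * (L h - rC (e (fdeg h)) * h))"
          unfolding h'_def L_smult by algebra
        then have h'_O: "h' \<in> Oinf (fdeg h - 1)"
          using lead[OF less.prems(1) h0] by (simp only:) (intro Oinf_uminus Oinf_smult)
        have h'_U: "h' \<in> U"
          unfolding h'_def by (intro rsub_diff[OF U] rsub_smult[OF U] inv less.prems)
        have "(if h' = 0 then 0 else Suc (nat (fdeg h' + K))) < Suc (nat (fdeg h + K))"
          using h'_O lb[OF h'_U] lb[OF less.prems(1) h0] by (auto simp: Oinf_def)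
        then have "(if h' = 0 then 0 else Suc (nat (fdeg h' + K)))
            < (if h = 0 then 0 else Suc (nat (fdeg h + K)))" using h0 by simp
        moreover have "h' \<in> Oinf (fdeg f - 1)"
          using h'_O \<open>fdeg h < fdeg f\<close> by (elim Oinf_mono) simp
        ultimately obtain k where k: "k \<in> U" "L k - rC l * k = h'" "k \<in> Oinf (fdeg f - 1)"
          using less.hyps h'_U by blast
        show ?thesis
        proof (intro bexI[of _ "k + rC c * h"] conjI)
          show "L (k + rC c * h) - rC l * (k + rC c * h) = h"
            using k(2) by (simp add: h'_def L_add algebra_simps)
        qed (intro rsub_add[OF U] rsub_smult[OF U] Oinf_add Oinf_smult k less.prems)+
      qed
    qed
    have "L f - rC l * f \<in> U"
      by (intro rsub_diff[OF U] rsub_smult[OF U] inv less.prems)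
    moreover have "L f - rC l * f \<in> Oinf (fdeg f - 1)"
      unfolding l_def by (intro lead less.prems)
    ultimately obtain k where k: "k \<in> U" "L k - rC l * k = L f - rC l * f" "k \<in> Oinf (fdeg f - 1)"
      using solve by blast
    show ?thesis
    proof (intro bexI[of _ "f - k"] conjI)
      show "f - k \<noteq> 0" using k(3) less.prems by (auto simp: Oinf_def)
      show "L (f - k) = rC (e (fdeg f)) * (f - k)"
        using k(2) by (simp add: L_diff l_def algebra_simps)
    qed (intro rsub_diff[OF U] k less.prems)
  qed
qed

subsection \<open>Commensurable subspaces and their duals\<close>

definition Vden :: "real poly \<Rightarrow> nat \<Rightarrow> rfun set" where
  "Vden \<tau> M = {f. \<exists>g. to_fract \<tau> ^ M * f = to_fract g}"

lemma rsub_Vden: "rsub (Vden \<tau> M)"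
  unfolding rsub_def
proof (intro conjI ballI allI)
  show "0 \<in> Vden \<tau> M" by (auto simp: Vden_def intro: exI[of _ 0])
next
  fix f g assume "f \<in> Vden \<tau> M" "g \<in> Vden \<tau> M"
  then obtain a b where "to_fract \<tau> ^ M * f = to_fract a" "to_fract \<tau> ^ M * g = to_fract b"
    by (auto simp: Vden_def)
  then have "to_fract \<tau> ^ M * (f + g) = to_fract (a + b)" by (simp add: distrib_left)
  then show "f + g \<in> Vden \<tau> M" by (auto simp: Vden_def simp del: to_fract_add)
next
  fix c f assume "f \<in> Vden \<tau> M"
  then obtain a where "to_fract \<tau> ^ M * f = to_fract a" by (auto simp: Vden_def)
  then have "to_fract \<tau> ^ M * (rC c * f) = to_fract ([:c:] * a)"
    unfolding to_fract_mult rC_def by (metis mult.left_commute)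
  then show "rC c * f \<in> Vden \<tau> M" by (auto simp: Vden_def simp del: to_fract_mult)
qed

lemma Vden_Reg:
  assumes "poly \<tau> x0 \<noteq> 0" "f \<in> Vden \<tau> M"
  shows "f \<in> Reg x0"
proof -
  obtain g where "to_fract \<tau> ^ M * f = to_fract g" using assms by (auto simp: Vden_def)
  moreover have "\<tau> \<noteq> 0" using assms by auto
  ultimately have "f = to_fract g / to_fract (\<tau> ^ M)" by (simp add: field_simps)
  with assms show ?thesis by (simp add: Reg_quot del: to_fract_power)
qed

lemma Vden_fdeg:
  assumes "\<tau> \<noteq> 0" "f \<in> Vden \<tau> M" "f \<noteq> 0"
  shows "fdeg f \<ge> - int (M * degree \<tau>)"
proof -
  obtain g where g: "to_fract \<tau> ^ M * f = to_fract g" using assms by (auto simp: Vden_def)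
  have "fdeg (to_fract \<tau> ^ M * f) = int (M * degree \<tau>) + fdeg f"
    using assms by (simp add: fdeg_mult fdeg_power fdeg_to_fract)
  then show ?thesis unfolding g by (simp add: fdeg_to_fract)
qed

lemma Vden_elem_of_fdeg:
  assumes "\<tau> \<noteq> 0" "j \<ge> - int (M * degree \<tau>)"
  obtains b where "b \<in> Vden \<tau> M" "b \<noteq> 0" "fdeg b = j"
proof
  define g :: "real poly" where "g = monom 1 (nat (j + int (M * degree \<tau>)))"
  define b where "b = to_fract g / to_fract \<tau> ^ M"
  have g: "g \<noteq> 0" "int (degree g) = j + int (M * degree \<tau>)"
    using assms by (simp_all add: g_def degree_monom_eq)
  show "b \<in> Vden \<tau> M" using assms by (auto simp: Vden_def b_def)
  show "b \<noteq> 0" using assms g by (simp add: b_def)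
  show "fdeg b = j" using assms g by (simp add: b_def fdeg_divide fdeg_power fdeg_to_fract)
qed

definition perp :: "rfun set \<Rightarrow> rfun set" where
  "perp U = {h. \<forall>f\<in>U. res (f * h) = 0}"

lemma rsub_perp: "rsub (perp U)"
  unfolding rsub_def perp_def
  by (auto simp: res_to_fract[of 0, simplified] distrib_left res_add mult.left_commute[of _ "rC _"] res_smult)

lemma perp_subset_Vden:
  assumes "\<And>g. to_fract \<tau> ^ M * to_fract g \<in> U"
  shows "perp U \<subseteq> Vden \<tau> M"
proof
  fix h assume h: "h \<in> perp U"
  have "res (to_fract g * (to_fract \<tau> ^ M * h)) = 0" for g
    using h assms[of g] by (auto simp: perp_def mult_ac)
  then obtain G where "to_fract \<tau> ^ M * h = to_fract G"
    by (rule polynomial_if_res_zero)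
  then show "h \<in> Vden \<tau> M" by (auto simp: Vden_def)
qed

text \<open>Any function of degree \<open>-1 - i\<close> in \<open>Vden \<tau> M\<close> is
  orthogonal to the elements of \<open>U\<close> of degree at most \<open>i\<close>, since degree
  \<open>i\<close> itself is missing. Orthogonality is then extended one degree at a time. Finitely
  many corrections suffice: from degree \<open>N\<close> on, \<open>U\<close> has multiples of
  \<open>\<tau>^M\<close> of every degree, and these are orthogonal to \<open>Vden \<tau> M\<close>
  automatically.\<close>

lemma perp_elem_of_fdeg:
  assumes \<tau>: "\<tau> \<noteq> 0" and U: "rsub U" and sup: "\<And>g. to_fract \<tau> ^ M * to_fract g \<in> U"
    and gap: "\<And>f. f \<in> U \<Longrightarrow> f \<noteq> 0 \<Longrightarrow> fdeg f \<noteq> i"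
  obtains h where "h \<in> perp U" "h \<noteq> 0" "fdeg h = - 1 - i"
proof -
  define N where "N = int (M * degree \<tau>)"
  have top: "\<exists>g. fdeg (to_fract \<tau> ^ M * to_fract g) = m \<and> g \<noteq> 0" if "m \<ge> N" for m
  proof (intro exI[of _ "monom 1 (nat (m - N))"] conjI)
    show "fdeg (to_fract \<tau> ^ M * to_fract (monom 1 (nat (m - N)))) = m"
      using that \<tau> by (simp add: fdeg_mult fdeg_power fdeg_to_fract degree_monom_eq N_def)
  qed simp
  have iN: "i < N"
  proof (rule ccontr)
    assume "\<not> i < N"
    then obtain g where "fdeg (to_fract \<tau> ^ M * to_fract g) = i" "g \<noteq> 0" using top[of i] by auto
    with gap[OF sup[of g]] \<tau> show False by simp
  qed
  have "\<exists>h\<in>Vden \<tau> M. h \<noteq> 0 \<and> fdeg h = - 1 - i \<and> (\<forall>f\<in>U. f \<in> Oinf (i + int d) \<longrightarrow> res (f * h) = 0)"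
    if "i + int d < N" for d
    using that
  proof (induction d)
    case 0
    have "- 1 - i \<ge> - int (M * degree \<tau>)" using iN by (simp add: N_def)
    then obtain b where b: "b \<in> Vden \<tau> M" "b \<noteq> 0" "fdeg b = - 1 - i"
      using Vden_elem_of_fdeg[OF \<tau>] by metis
    have "res (f * b) = 0" if "f \<in> U" "f \<in> Oinf i" for f
    proof -
      have "f \<in> Oinf (i - 1)" using that gap[of f] by (cases "f = 0") (auto simp: Oinf_def)
      from Oinf_mult[OF this Oinf_fdeg[of b]] show ?thesis
        by (simp add: b res_Oinf)
    qed
    with b show ?case by auto
  next
    case (Suc d)
    then obtain h where h: "h \<in> Vden \<tau> M" "h \<noteq> 0" "fdeg h = - 1 - i"
      "\<And>f. f \<in> U \<Longrightarrow> f \<in> Oinf (i + int d) \<Longrightarrow> res (f * h) = 0" by auto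
    define m where "m = i + int (Suc d)"
    show ?case
    proof (cases "\<exists>f\<in>U. f \<noteq> 0 \<and> fdeg f = m")
      case False
      then have "f \<in> Oinf (i + int d)" if "f \<in> U" "f \<in> Oinf m" for f
      proof (cases "f = 0")
        case nz: False
        have "fdeg f \<noteq> m" using False nz that(1) by blast
        then show ?thesis using that(2) nz by (auto simp: Oinf_def m_def)
      qed simp
      with h show ?thesis by (auto simp: m_def)
    next
      case True
      then obtain g where g: "g \<in> U" "g \<noteq> 0" "fdeg g = m" by blast
      \<comment> \<open>A function of degree \<open>-1 - m\<close> pairs to zero with degrees below
        \<open>m\<close> and nontrivially with degree \<open>m\<close>, so a multiple of
        \<open>b\<close> corrects \<open>h\<close> at \<open>m\<close> without spoiling the lower
        degrees or the leading term of \<open>h\<close>.\<close>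
      have "- 1 - m \<ge> - int (M * degree \<tau>)" using Suc.prems by (simp add: N_def m_def)
      then obtain b where b: "b \<in> Vden \<tau> M" "b \<noteq> 0" "fdeg b = - 1 - m"
        using Vden_elem_of_fdeg[OF \<tau>] by metis
      have gb: "res (g * b) \<noteq> 0"
        using g b by (intro res_nonzero) (auto simp: fdeg_mult)
      define c where "c = res (g * h) / res (g * b)"
      define h' where "h' = h - rC c * b"
      have low: "res (f * h') = 0" if "f \<in> U" "f \<in> Oinf (i + int d)" for f
      proof -
        have "f * b \<in> Oinf (-2)"
          by (rule Oinf_mult'[OF that(2) Oinf_fdeg[of b]]) (simp add: b m_def)
        then have "res (f * b) = 0" by (rule res_Oinf)
        then show ?thesis
          using h(4)[OF that]
          by (simp add: h'_def right_diff_distrib res_diff mult.left_commute[of _ "rC _"] res_smult)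
      qed
      have gh': "res (g * h') = 0"
        using gb by (simp add: h'_def right_diff_distrib res_diff mult.left_commute[of _ "rC _"]
            res_smult c_def)
      have "res (f * h') = 0" if "f \<in> U" "f \<in> Oinf m" for f
      proof (cases "f = 0 \<or> fdeg f < m")
        case True
        then show ?thesis using that by (intro low) (auto simp: Oinf_def m_def)
      next
        case False
        then have "f \<noteq> 0" "fdeg f = fdeg g" using that g by (auto simp: Oinf_def)
        then obtain k where k: "f - rC k * g \<in> Oinf (fdeg g - 1)"
          using g(2) leading_term[of f g] by metis
        have "f - rC k * g \<in> U" by (intro rsub_diff[OF U] rsub_smult[OF U] g that)
        then have "res ((f - rC k * g) * h') = 0"
          using k g by (intro low) (auto simp: m_def)
        then show ?thesis
          using gh' by (simp add: left_diff_distrib res_diff mult.assoc res_smult)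
      qed
      moreover have "rC c * b \<in> Oinf (- 2 - i)"
        using b by (intro Oinf_smult) (auto simp: Oinf_def m_def)
      then have "h' \<noteq> 0 \<and> fdeg h' = - 1 - i"
      proof -
        assume cb: "rC c * b \<in> Oinf (- 2 - i)"
        have "h' \<in> Oinf (- 1 - i)"
          unfolding h'_def by (intro Oinf_diff) (use h cb in \<open>auto simp: Oinf_def\<close>)
        moreover have "h' \<notin> Oinf (- 2 - i)"
        proof
          assume "h' \<in> Oinf (- 2 - i)"
          then have "h' + rC c * b \<in> Oinf (- 2 - i)" using cb by (rule Oinf_add)
          then show False using h by (simp add: h'_def Oinf_def)
        qed
        ultimately show ?thesis by (auto simp: Oinf_def)
      qed
      moreover have "h' \<in> Vden \<tau> M"
        unfolding h'_def by (intro rsub_diff[OF rsub_Vden] rsub_smult[OF rsub_Vden] h b)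
      ultimately show ?thesis by (auto simp: m_def)
    qed
  qed
  from this[of "nat (N - 1 - i)"] iN obtain h where
    h: "h \<in> Vden \<tau> M" "h \<noteq> 0" "fdeg h = - 1 - i" "\<And>f. f \<in> U \<Longrightarrow> f \<in> Oinf (N - 1) \<Longrightarrow> res (f * h) = 0"
    by auto
  obtain k where k: "to_fract \<tau> ^ M * h = to_fract k" using h by (auto simp: Vden_def)
  have "res (f * h) = 0" if "f \<in> U" "f \<in> Oinf (N - 1 + int d)" for f d
    using that
  proof (induction d arbitrary: f)
    case 0
    then show ?case using h(4) by simp
  next
    case (Suc d)
    show ?case
    proof (cases "f = 0 \<or> fdeg f \<le> N - 1 + int d")
      case True
      then show ?thesis using Suc by (auto simp: Oinf_def)
    next
      case False
      then have f: "f \<noteq> 0" "fdeg f = N + int d" using Suc.prems by (auto simp: Oinf_def)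
      then obtain g where g: "fdeg (to_fract \<tau> ^ M * to_fract g) = fdeg f" "g \<noteq> 0"
        using top[of "fdeg f"] by auto
      define b where "b = to_fract \<tau> ^ M * to_fract g"
      have "b \<noteq> 0" using g \<tau> by (simp add: b_def)
      then obtain c where c: "f - rC c * b \<in> Oinf (fdeg b - 1)"
        using f g leading_term[of f b] by (auto simp: b_def)
      have "b * h = to_fract g * (to_fract \<tau> ^ M * h)" by (simp add: b_def mult_ac)
      then have "b * h = to_fract (g * k)" by (simp add: k)
      then have "res (b * h) = 0" by (simp only: res_to_fract)
      moreover have "res ((f - rC c * b) * h) = 0"
      proof (rule Suc.IH)
        show "f - rC c * b \<in> U"
          unfolding b_def by (intro rsub_diff[OF U] rsub_smult[OF U] sup Suc.prems)
        show "f - rC c * b \<in> Oinf (N - 1 + int d)"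
          by (rule Oinf_mono[OF c]) (use f g in \<open>simp add: b_def\<close>)
      qed
      ultimately show ?thesis by (simp add: left_diff_distrib res_diff mult.assoc res_smult)
    qed
  qed
  note orth = this
  have "h \<in> perp U"
    unfolding perp_def
  proof safe
    fix f assume "f \<in> U"
    moreover have "f \<in> Oinf (N - 1 + int (nat (fdeg f - (N - 1))))" by (simp add: Oinf_def)
    ultimately show "res (f * h) = 0" by (rule orth)
  qed
  with h that show ?thesis by blast
qed

text \<open>Lagrange's identity: the difference is a derivative and has no residue. The formal
  adjoint has first-order coefficient \<open>2 p' - q\<close>, which for \<open>p = x^2 - 1\<close>
  is \<open>qJ (- a) (- b)\<close>, and \<open>p'' - q'\<close> gives the constant
  \<open>- (a + b)\<close>.\<close>

lemma res_adjoint: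
  "res (LJ r a b f * h) = res (f * (LJ r (- a) (- b) h - rC (a + b) * h))"
proof -
  have dq: "rderiv (qJ a b) = rC (a + b + 2)"
    by (simp add: qJ_def rC_hom)
  have "LJ r a b f * h - f * (LJ r (- a) (- b) h - rC (a + b) * h) =
    rderiv ((rX ^ 2 - 1) * rderiv f * h - f * rderiv ((rX ^ 2 - 1) * h) + qJ a b * f * h)"
    by (simp add: LJ_def dq) (simp add: qJ_def rC_hom algebra_simps power2_eq_square)
  then have "res (LJ r a b f * h - f * (LJ r (- a) (- b) h - rC (a + b) * h)) = 0"
    by (simp only: res_rderiv)
  then show ?thesis by (simp add: res_diff)
qed

text \<open>An invariant space commensurable with the polynomials,
  \<open>\<tau>^M R[x] \<subseteq> U \<subseteq> \<tau>^(-M) R[x]\<close>. The upper inclusion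
  bounds the degrees in \<open>U\<close> below; the lower one does the same for the annihilator, by
  placing it in \<open>Vden \<tau> M\<close>.\<close>

definition admissible :: "real poly \<Rightarrow> real \<Rightarrow> real \<Rightarrow> bool" where
  "admissible \<tau> a b \<longleftrightarrow> poly \<tau> 1 \<noteq> 0 \<and> poly \<tau> (-1) \<noteq> 0 \<and>
     (\<exists>M U. rsub U \<and> (\<forall>f\<in>U. LJ (Vpot \<tau>) a b f \<in> U) \<and> U \<subseteq> Vden \<tau> M \<and>
        (\<forall>g. to_fract \<tau> ^ M * to_fract g \<in> U))"

text \<open>The diagonal entry attached to degree \<open>i\<close>; negative degrees do occur, as
  elements of \<open>U\<close> have denominators.\<close>

definition eJ :: "real \<Rightarrow> real \<Rightarrow> int \<Rightarrow> real" where
  "eJ a b i = of_int i * (of_int i + a + b + 1)"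

definition reg_eigenvalue :: "real poly \<Rightarrow> real \<Rightarrow> real \<Rightarrow> real \<Rightarrow> bool" where
  "reg_eigenvalue \<tau> a b l \<longleftrightarrow>
     (\<exists>f. f \<noteq> 0 \<and> f \<in> Reg 1 \<and> f \<in> Reg (-1) \<and> LJ (Vpot \<tau>) a b f = rC l * f)"

text \<open>The alternative in the last clause is whether degree \<open>i\<close> is present in
  \<open>U\<close> or missing; the first two clauses record that large degrees are always present
  and very negative ones always missing.\<close>

theorem admissible_eigenvalues:
  assumes "admissible \<tau> a b"
  shows "\<exists>K. \<forall>i. (K \<le> i \<longrightarrow> reg_eigenvalue \<tau> a b (eJ a b i)) \<and>
           (i \<le> - K \<longrightarrow> reg_eigenvalue \<tau> (- a) (- b) (eJ a b i + a + b)) \<and>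
           (reg_eigenvalue \<tau> a b (eJ a b i) \<or> reg_eigenvalue \<tau> (- a) (- b) (eJ a b i + a + b))"
proof -
  from assms obtain M U where pm: "poly \<tau> 1 \<noteq> 0" "poly \<tau> (-1) \<noteq> 0" and U: "rsub U"
    and inv: "\<And>f. f \<in> U \<Longrightarrow> LJ (Vpot \<tau>) a b f \<in> U" and sub: "U \<subseteq> Vden \<tau> M"
    and sup: "\<And>g. to_fract \<tau> ^ M * to_fract g \<in> U"
    by (auto simp: admissible_def)
  have \<tau>: "\<tau> \<noteq> 0" using pm by auto
  define N where "N = int (M * degree \<tau>)"
  have lead: "LJ (Vpot \<tau>) a b f - rC (eJ a b (fdeg f)) * f \<in> Oinf (fdeg f - 1)" if "f \<noteq> 0" for f a b
    using LJ_leading[OF Vpot_Oinf that] by (simp add: eJ_def)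
  have E1: "reg_eigenvalue \<tau> a b (eJ a b i)" if "f \<in> U" "f \<noteq> 0" "fdeg f = i" for f i
  proof -
    have "\<exists>g\<in>U. g \<noteq> 0 \<and> LJ (Vpot \<tau>) a b g = rC (eJ a b (fdeg f)) * g"
      using Vden_fdeg[OF \<tau>] sub that lead
      by (intro triangular_eigenvector[where K = N, OF U LJ_add LJ_smult inv]) (auto simp: N_def)
    then show ?thesis
      using Vden_Reg[OF pm(1)] Vden_Reg[OF pm(2)] sub that(3) unfolding reg_eigenvalue_def by blast
  qed
  have E2: "reg_eigenvalue \<tau> (- a) (- b) (eJ a b i + a + b)"
    if gap: "\<not> (\<exists>f\<in>U. f \<noteq> 0 \<and> fdeg f = i)" for i
  proof -
    obtain h where h: "h \<in> perp U" "h \<noteq> 0" "fdeg h = - 1 - i"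
      using perp_elem_of_fdeg[OF \<tau> U sup, of i] gap by metis
    note sub' = perp_subset_Vden[OF sup]
    have inv': "LJ (Vpot \<tau>) (- a) (- b) h \<in> perp U" if "h \<in> perp U" for h
      unfolding perp_def
    proof safe
      fix f assume f: "f \<in> U"
      have "res (f * (LJ (Vpot \<tau>) (- a) (- b) h - rC (a + b) * h)) = 0"
        using that inv[OF f] by (simp add: perp_def flip: res_adjoint)
      moreover have "res (f * (rC (a + b) * h)) = 0"
        using that f by (simp add: perp_def mult.left_commute[of _ "rC _"] res_smult)
      ultimately show "res (f * LJ (Vpot \<tau>) (- a) (- b) h) = 0"
        by (simp add: right_diff_distrib res_diff)
    qed
    have "\<exists>g\<in>perp U. g \<noteq> 0 \<and> LJ (Vpot \<tau>) (- a) (- b) g = rC (eJ (- a) (- b) (fdeg h)) * g"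
      using Vden_fdeg[OF \<tau>] sub' h lead
      by (intro triangular_eigenvector[where K = N, OF rsub_perp LJ_add LJ_smult inv']) (auto simp: N_def)
    \<comment> \<open>The summand \<open>a + b\<close> is the constant by which the adjoint differs
      from the reflected operator.\<close>
    moreover have "eJ (- a) (- b) (fdeg h) = eJ a b i + a + b"
      by (simp add: h eJ_def algebra_simps)
    ultimately show ?thesis
      using Vden_Reg[OF pm(1)] Vden_Reg[OF pm(2)] sub' unfolding reg_eigenvalue_def by fastforce
  qed
  have hi: "\<exists>f\<in>U. f \<noteq> 0 \<and> fdeg f = i" if "i \<ge> N" for i
  proof -
    have "to_fract \<tau> ^ M * to_fract (monom 1 (nat (i - N))) \<noteq> 0"
      "fdeg (to_fract \<tau> ^ M * to_fract (monom 1 (nat (i - N)))) = i"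
      using that \<tau> by (simp_all add: fdeg_mult fdeg_power fdeg_to_fract degree_monom_eq N_def)
    then show ?thesis using sup by blast
  qed
  have lo: "\<not> (\<exists>f\<in>U. f \<noteq> 0 \<and> fdeg f = i)" if "i \<le> - N - 1" for i
    using Vden_fdeg[OF \<tau>] sub that unfolding N_def by force
  \<comment> \<open>\<open>N + 1\<close> rather than \<open>N\<close>, since degree
    \<open>- N\<close> may still occur in \<open>U\<close>.\<close>
  show ?thesis
    using E1 E2 hi lo by (intro exI[of _ "N + 1"] allI) (smt (verit))
qed

subsection \<open>Exceptional operators are admissible\<close>

lemma Vpot_1 [simp]: "Vpot 1 = 0"
  by (simp add: Vpot_def logder_def)

lemma qJ_to_fract: "qJ a b = to_fract ([:a + 1:] * [:1, 1:] + [:b + 1:] * [:-1, 1:])"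
proof -
  have "rX + 1 = to_fract [:1, 1:]" "rX - 1 = to_fract [:-1, 1:]"
    by (simp_all add: rX_def one_pCons flip: to_fract_1 to_fract_add to_fract_diff)
  then show ?thesis by (simp only: qJ_def rC_def to_fract_add to_fract_mult)
qed

lemma rX2_to_fract: "rX ^ 2 - 1 = to_fract ([:0, 1:] ^ 2 - 1)"
  by (simp only: rX_def to_fract_diff to_fract_power to_fract_1)

lemma LJ_polynomial: "\<exists>h. LJ 0 a b (to_fract g) = to_fract h"
  unfolding LJ_def rderiv_to_fract qJ_to_fract rX2_to_fract
  by (auto simp only: mult_zero_left add_0_right simp flip: to_fract_mult to_fract_add)

lemma admissible_1: "admissible 1 a b"
  unfolding admissible_def
proof (intro conjI exI[of _ 0] exI[of _ "range to_fract"])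
  have "rC c * to_fract g = to_fract ([:c:] * g)" for c g
    by (simp only: rC_def to_fract_mult)
  then show "rsub (range to_fract)"
    unfolding rsub_def by (auto simp flip: to_fract_0 to_fract_add)
  show "\<forall>f\<in>range to_fract. LJ (Vpot 1) a b f \<in> range to_fract"
    using LJ_polynomial by (simp add: image_iff)
  show "range to_fract \<subseteq> Vden 1 0"
    by (auto simp: Vden_def)
qed auto

text \<open>Two derivatives cost two powers of \<open>\<tau>\<close>, and
  \<open>\<tau>^2 * Vpot \<tau>\<close> is a polynomial. \<open>H\<close> is the remaining cofactor,
  written out as a polynomial.\<close>

lemma LJ_tau_power:
  assumes "\<tau> \<noteq> 0"
  shows "\<exists>h. LJ (Vpot \<tau>) a b (to_fract \<tau> ^ (k + 2) * to_fract g) = to_fract \<tau> ^ k * to_fract h"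
proof -
  define t where "t = to_fract \<tau>"
  define t' where "t' = to_fract (pderiv \<tau>)"
  define t'' where "t'' = to_fract (pderiv (pderiv \<tau>))"
  define n :: rfun where "n = of_nat (k + 2)"
  define g0 g1 g2 where "g0 = to_fract g" and "g1 = to_fract (pderiv g)"
    and "g2 = to_fract (pderiv (pderiv g))"
  have t0: "t \<noteq> 0" using assms by (simp add: t_def)
  have der: "rderiv t = t'" "rderiv t' = t''" "rderiv g0 = g1" "rderiv g1 = g2" "rderiv n = 0"
    unfolding n_def rC_of_nat[symmetric]
    by (simp_all add: t_def t'_def t''_def g0_def g1_def g2_def)
  have dpow: "rderiv (t ^ m) = of_nat m * t ^ (m - 1) * t'" for m
  proof (induction m)
    case (Suc m)
    then show ?case by (cases m) (simp_all add: der algebra_simps)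
  qed simp
  have d1: "rderiv (t ^ (k + 2) * g0) = t ^ (k + 1) * (n * t' * g0 + t * g1)"
    unfolding rderiv_mult dpow der by (simp add: n_def algebra_simps)
  have dk: "rderiv (t ^ (k + 1)) = (n - 1) * t ^ k * t'"
    unfolding dpow by (simp add: n_def)
  have d2: "rderiv (t ^ (k + 1) * (n * t' * g0 + t * g1)) =
      t ^ k * ((n - 1) * t' * (n * t' * g0 + t * g1)
        + t * (n * t'' * g0 + n * t' * g1 + t' * g1 + t * g2))"
    unfolding rderiv_mult[of "t ^ (k + 1)"] dk by (simp add: der algebra_simps)
  have V: "t ^ 2 * Vpot \<tau> = 2 * (rX ^ 2 - 1) * (t'' * t - t' * t') + 2 * rX * t * t'"
  proof -
    have u: "logder \<tau> = t' / t" by (simp add: logder_def t_def t'_def)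
    have "t ^ 2 * rderiv (t' / t) = t'' * t - t' * t'"
      using t0 by (simp add: rderiv_divide der)
    moreover have "t * (t' / t) = t'" using t0 by simp
    ultimately show ?thesis
      unfolding Vpot_def u by algebra
  qed
  define N where "N = of_nat (k + 2) * pderiv \<tau> * g + \<tau> * pderiv g"
  define H where "H = ([:0, 1:] ^ 2 - 1) *
      ((of_nat (k + 2) - 1) * pderiv \<tau> * N + \<tau> * (of_nat (k + 2) * pderiv (pderiv \<tau>) * g
         + of_nat (k + 2) * pderiv \<tau> * pderiv g + pderiv \<tau> * pderiv g + \<tau> * pderiv (pderiv g)))
     + ([:a + 1:] * [:1, 1:] + [:b + 1:] * [:-1, 1:]) * \<tau> * N
     + (2 * ([:0, 1:] ^ 2 - 1) * (pderiv (pderiv \<tau>) * \<tau> - pderiv \<tau> * pderiv \<tau>)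
         + 2 * [:0, 1:] * \<tau> * pderiv \<tau>) * g"
  have to_fract_of_nat: "to_fract (of_nat m) = (of_nat m :: rfun)" for m
    by (induction m) simp_all
  have two: "to_fract 2 = (2 :: rfun)" using to_fract_of_nat[of 2] by simp
  have HN: "to_fract N = n * t' * g0 + t * g1"
    unfolding N_def n_def t_def t'_def g0_def g1_def
    by (simp only: to_fract_add to_fract_mult to_fract_of_nat)
  have "to_fract H = (rX ^ 2 - 1) * ((n - 1) * t' * (n * t' * g0 + t * g1)
        + t * (n * t'' * g0 + n * t' * g1 + t' * g1 + t * g2))
      + qJ a b * t * (n * t' * g0 + t * g1)
      + (2 * (rX ^ 2 - 1) * (t'' * t - t' * t') + 2 * rX * t * t') * g0"
    unfolding HN[symmetric] H_def qJ_to_fract rX2_to_fract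
    unfolding n_def t_def t'_def t''_def g0_def g1_def g2_def rX_def
    by (simp only: to_fract_add to_fract_mult to_fract_diff to_fract_1 to_fract_of_nat two)
  note H = this
  have "LJ (Vpot \<tau>) a b (t ^ (k + 2) * g0) = t ^ k *
     ((rX ^ 2 - 1) * ((n - 1) * t' * (n * t' * g0 + t * g1)
        + t * (n * t'' * g0 + n * t' * g1 + t' * g1 + t * g2))
      + qJ a b * t * (n * t' * g0 + t * g1) + (t ^ 2 * Vpot \<tau>) * g0)"
    unfolding LJ_def d1 d2 by (simp add: distrib_left power2_eq_square mult_ac)
  also have "\<dots> = t ^ k * to_fract H"
    by (simp only: V H)
  finally have "LJ (Vpot \<tau>) a b (t ^ (k + 2) * g0) = t ^ k * to_fract H" .
  then show ?thesis unfolding t_def g0_def by blast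
qed

text \<open>The natural gauge is the rational gauge conjugated by \<open>\<tau>\<close>, so an
  eigenpolynomial \<open>y\<close> corresponds to \<open>y / \<tau>\<close> with the same
  eigenvalue.\<close>

lemma T_ng_conjugate:
  assumes "\<tau> \<noteq> 0"
  shows "op_apply (T_ng \<tau> a b) (to_fract \<tau> * f) = to_fract \<tau> * LJ (Vpot \<tau>) a b f"
proof -
  define t where "t = to_fract \<tau>"
  define t' where "t' = to_fract (pderiv \<tau>)"
  define t'' where "t'' = to_fract (pderiv (pderiv \<tau>))"
  define i where "i = 1 / t"
  have ti: "t * i = 1" using assms by (simp add: t_def i_def)
  have u: "logder \<tau> = t' * i" "to_fract (pderiv (pderiv \<tau>)) / to_fract \<tau> = t'' * i"
    by (simp_all add: logder_def t_def t'_def t''_def i_def)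
  have der: "rderiv t = t'" "rderiv t' = t''" by (simp_all add: t_def t'_def t''_def)
  have "rderiv i = - (t' * i ^ 2)"
    using assms by (simp add: i_def rderiv_divide der power_divide t_def[symmetric])
      (simp add: t_def rderiv_divide t'_def power_divide)
  then have du: "rderiv (t' * i) = t'' * i - t' * t' * i ^ 2"
    by (simp add: der power2_eq_square)
  show ?thesis
    unfolding T_ng_def op_apply_def Let_def LJ_def Vpot_def u prod.case du
    unfolding t_def[symmetric] eta_mult[symmetric] rderiv_mult rderiv_add der
    using ti by algebra
qed

lemma rsub_subset_if_fdeg:
  assumes U: "rsub U" and W: "rsub W" "W \<subseteq> U"
    and lb: "\<And>f. f \<in> U \<Longrightarrow> f \<noteq> 0 \<Longrightarrow> fdeg f \<ge> - K"
    and deg: "\<And>f. f \<in> U \<Longrightarrow> f \<noteq> 0 \<Longrightarrow> \<exists>g\<in>W. g \<noteq> 0 \<and> fdeg g = fdeg f"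
  shows "U \<subseteq> W"
proof
  fix f assume "f \<in> U"
  then show "f \<in> W"
  proof (induction "if f = 0 then 0 else Suc (nat (fdeg f + K))" arbitrary: f rule: less_induct)
    case less
    show ?case
    proof (cases "f = 0")
      case False
      then obtain g where g: "g \<in> W" "g \<noteq> 0" "fdeg f = fdeg g" using deg less.prems by metis
      then obtain c where c: "f - rC c * g \<in> Oinf (fdeg g - 1)"
        using False leading_term[of f g] by metis
      have fU: "f - rC c * g \<in> U"
        using g W less.prems by (intro rsub_diff[OF U] rsub_smult[OF U]) auto
      have "f - rC c * g \<in> W"
        using c lb[OF fU] lb[OF less.prems False] False g
        by (intro less.hyps fU) (auto simp: Oinf_def)
      then have "f - rC c * g + rC c * g \<in> W"
        using g by (intro rsub_add[OF W(1)] rsub_smult[OF W(1)])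
      then show ?thesis by simp
    qed (use W rsub_0 in auto)
  qed
qed

lemma rsub_iterates:
  assumes "rsub X" "\<And>f g. L (f + g) = L f + L g" "\<And>c f. L (rC c * f) = rC c * L f"
  shows "rsub {f. \<forall>i. P i \<longrightarrow> (L ^^ i) f \<in> X}"
proof -
  have 1: "(L ^^ i) (f + g) = (L ^^ i) f + (L ^^ i) g" for i f g
    by (induction i) (simp_all add: assms)
  have 2: "(L ^^ i) (rC c * f) = rC c * (L ^^ i) f" for i c f
    by (induction i) (simp_all add: assms)
  have 3: "(L ^^ i) 0 = 0" for i using 2[of i 0 0] by simp
  show ?thesis
    using assms(1) unfolding rsub_def by (auto simp: 1 2 3)
qed

lemma decreasing_nat_stationary:
  fixes h :: "nat \<Rightarrow> nat"
  assumes "\<And>j. h (Suc j) \<le> h j"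
  shows "\<exists>j. h (Suc j) = h j"
proof (rule ccontr)
  assume "\<not> ?thesis"
  then have less: "h (Suc j) < h j" for j using assms le_neq_implies_less by blast
  have "h j + j \<le> h 0" for j
    by (induction j) (use less in \<open>simp_all add: Suc_leI less_le_trans\<close>, metis add_Suc_right le_trans add_le_mono1 Suc_leI add_Suc)
  from this[of "Suc (h 0)"] show False by simp
qed

text \<open>The largest invariant space \<open>W\<close> is cut out by infinitely many conditions,
  so it is not evident that it contains all multiples of a power of \<open>\<tau>\<close>. The
  finite stages \<open>V j\<close> do, and each contains all the eigenfunctions. Hence all but
  finitely many degrees are common to every stage, the number of remaining degrees stalls at some
  \<open>j\<close>, and there \<open>V j = V (Suc j)\<close> is invariant.\<close>

theorem exceptional_imp_admissible:
  assumes "exceptional_jacobi \<tau> \<alpha> \<beta>"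
  shows "admissible \<tau> \<alpha> \<beta>"
proof -
  have pm: "poly \<tau> 1 \<noteq> 0" "poly \<tau> (-1) \<noteq> 0"
    and fin: "finite {n. \<not> has_poly_eigenfunction_deg (T_ng \<tau> \<alpha> \<beta>) n}"
    using assms by (auto simp: exceptional_jacobi_def)
  have \<tau>: "\<tau> \<noteq> 0" using pm by auto
  define L where "L = LJ (Vpot \<tau>) \<alpha> \<beta>"
  define X where "X = Vden \<tau> 1"
  define N where "N = int (degree \<tau>)"
  define V where "V j = {f. \<forall>i. i \<le> j \<longrightarrow> (L ^^ i) f \<in> X}" for j :: nat
  define W where "W = {f. \<forall>i. True \<longrightarrow> (L ^^ i) f \<in> X}"
  define G where "G j = {fdeg f |f. f \<in> V j \<and> f \<noteq> 0}" for j
  define B where "B = {fdeg f |f. f \<in> W \<and> f \<noteq> 0}"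
  have rV: "rsub (V j)" for j
    unfolding V_def L_def X_def by (intro rsub_iterates rsub_Vden LJ_add LJ_smult)
  have VX: "V j \<subseteq> X" for j by (auto simp: V_def dest: spec[of _ 0])
  have V_Suc: "V (Suc j) \<subseteq> V j" for j by (auto simp: V_def)
  have lb: "fdeg f \<ge> - N" if "f \<in> V j" "f \<noteq> 0" for f j
    using Vden_fdeg[OF \<tau>, of f 1] that VX by (auto simp: X_def N_def)
  have eig: "int n - N \<in> B" if "has_poly_eigenfunction_deg (T_ng \<tau> \<alpha> \<beta>) n" for n
  proof -
    obtain y l where y: "y \<noteq> 0" "degree y = n" "op_apply (T_ng \<tau> \<alpha> \<beta>) (to_fract y) = rC l * to_fract y"
      using \<open>has_poly_eigenfunction_deg _ _\<close> by (auto simp: has_poly_eigenfunction_deg_def)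
    define f where "f = to_fract y / to_fract \<tau>"
    have yf: "to_fract y = to_fract \<tau> * f" using \<tau> by (simp add: f_def)
    have "to_fract \<tau> * L f = to_fract \<tau> * (rC l * f)"
      using y(3) unfolding yf T_ng_conjugate[OF \<tau>] L_def by (simp add: mult.left_commute)
    then have Lf: "L f = rC l * f" using \<tau> by simp
    have fX: "f \<in> X" unfolding X_def Vden_def using yf by (auto intro!: exI[of _ y])
    have "(L ^^ i) f = rC (l ^ i) * f" for i
    proof (induction i)
      case (Suc i)
      have "L (rC (l ^ i) * f) = rC (l ^ i) * L f" by (simp add: L_def LJ_smult)
      then show ?case by (simp add: Suc Lf rC_mult mult_ac)
    qed simp
    then have "f \<in> W"
      unfolding W_def using fX rsub_smult[OF rsub_Vden] by (auto simp: X_def)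
    moreover have "f \<noteq> 0" "fdeg f = int n - N"
      using y \<tau> by (simp_all add: f_def fdeg_quot N_def)
    ultimately show ?thesis by (force simp: B_def)
  qed
  have BG: "B \<subseteq> G j" for j by (auto simp: B_def G_def W_def V_def)
  have G_sub: "G j - B \<subseteq> (\<lambda>n. int n - N) ` {n. \<not> has_poly_eigenfunction_deg (T_ng \<tau> \<alpha> \<beta>) n}" for j
  proof
    fix i assume i: "i \<in> G j - B"
    then have "i \<ge> - N" using lb by (auto simp: G_def)
    then have "i = int (nat (i + N)) - N" by simp
    with i eig[of "nat (i + N)"] show "i \<in> (\<lambda>n. int n - N) ` {n. \<not> has_poly_eigenfunction_deg (T_ng \<tau> \<alpha> \<beta>) n}"
      by (intro image_eqI[of _ _ "nat (i + N)"]) auto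
  qed
  then have finG: "finite (G j - B)" for j
    using fin by (meson finite_imageI finite_subset)
  have G_Suc: "G (Suc j) \<subseteq> G j" for j using V_Suc by (fastforce simp: G_def)
  have "card (G (Suc j) - B) \<le> card (G j - B)" for j
    using G_Suc by (intro card_mono finG) blast
  then obtain j where "card (G (Suc j) - B) = card (G j - B)"
    using decreasing_nat_stationary[of "\<lambda>j. card (G j - B)"] by blast
  then have "G (Suc j) - B = G j - B"
    using G_Suc[of j] by (intro card_subset_eq finG) blast+
  then have Geq: "G (Suc j) = G j" using BG by blast
  have "V j \<subseteq> V (Suc j)"
  proof (rule rsub_subset_if_fdeg[OF rV rV V_Suc lb])
    fix f assume "f \<in> V j" "f \<noteq> 0"
    then have "fdeg f \<in> G (Suc j)" unfolding Geq by (auto simp: G_def)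
    then show "\<exists>g\<in>V (Suc j). g \<noteq> 0 \<and> fdeg g = fdeg f" by (force simp: G_def)
  qed auto
  then have inv: "L f \<in> V j" if "f \<in> V j" for f
  proof -
    have "(L ^^ i) (L f) \<in> X" if "i \<le> j" for i
    proof -
      have "(L ^^ Suc i) f \<in> X" using \<open>V j \<subseteq> V (Suc j)\<close> \<open>f \<in> V j\<close> that by (fastforce simp: V_def)
      then show ?thesis by (simp add: funpow_swap1)
    qed
    then show ?thesis by (simp add: V_def)
  qed
  \<comment> \<open>Each application of \<open>L\<close> costs two powers of \<open>\<tau>\<close>;
    the extra one makes \<open>M\<close> positive, since elements of \<open>V j\<close> may have the
    denominator \<open>\<tau>\<close> even for \<open>j = 0\<close>.\<close>
  define M where "M = 2 * j + 1"
  have "to_fract \<tau> ^ M * to_fract g \<in> V j" for g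
  proof -
    have it: "\<exists>h. (L ^^ i) (to_fract \<tau> ^ (k + 2 * i) * to_fract g) = to_fract \<tau> ^ k * to_fract h" for i k g
    proof (induction i arbitrary: k)
      case (Suc i)
      from Suc[of "k + 2"] obtain h where
        "(L ^^ i) (to_fract \<tau> ^ (k + 2 * Suc i) * to_fract g) = to_fract \<tau> ^ (k + 2) * to_fract h"
        by (auto simp: algebra_simps)
      then show ?case using LJ_tau_power[OF \<tau>, of \<alpha> \<beta> k h] by (simp add: L_def)
    qed auto
    show ?thesis unfolding V_def
    proof safe
      fix i assume "i \<le> j"
      then have "M = (M - 2 * i) + 2 * i" by (simp add: M_def)
      then obtain h where h: "(L ^^ i) (to_fract \<tau> ^ M * to_fract g) = to_fract \<tau> ^ (M - 2 * i) * to_fract h"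
        using it[of i "M - 2 * i" g] by metis
      then show "(L ^^ i) (to_fract \<tau> ^ M * to_fract g) \<in> X"
        unfolding X_def Vden_def h
        by (auto intro!: exI[of _ "\<tau> ^ Suc (M - 2 * i) * h"])
    qed
  qed
  moreover have "V j \<subseteq> Vden \<tau> M"
  proof
    fix f assume "f \<in> V j"
    then have "f \<in> Vden \<tau> 1" using VX by (auto simp: X_def)
    then obtain g where g: "to_fract \<tau> * f = to_fract g" by (auto simp: Vden_def)
    have "to_fract \<tau> ^ M * f = to_fract \<tau> ^ (2 * j) * (to_fract \<tau> * f)"
      by (simp add: M_def mult_ac)
    then have "to_fract \<tau> ^ M * f = to_fract (\<tau> ^ (2 * j) * g)" by (simp add: g)
    then show "f \<in> Vden \<tau> M" unfolding Vden_def by blast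
  qed
  ultimately show ?thesis
    unfolding admissible_def using pm rV inv L_def by blast
qed

subsection \<open>Reflecting a parameter\<close>

text \<open>Divided differences lower the degree: \<open>(P(s) - P(t0)) / (s - t0)\<close> again
  takes values in \<open>S\<close> for infinitely many \<open>s\<close>, because \<open>S\<close> is
  closed under real scalars.\<close>

lemma poly_in_rsub:
  assumes S: "rsub S" and A: "infinite A" "\<And>t. t \<in> A \<Longrightarrow> poly P (rC t) \<in> S"
  shows "poly P (rC t) \<in> S"
  using A
proof (induction "degree P" arbitrary: P A t)
  case 0
  then obtain c where "P = [:c:]" by (metis degree_eq_zeroE)
  moreover obtain t0 where "t0 \<in> A" using 0 by (metis finite.emptyI all_not_in_conv)
  ultimately show ?case using 0(3)[of t0] by simp
next
  case (Suc n)
  obtain t0 where t0: "t0 \<in> A" using Suc.prems by (metis finite.emptyI all_not_in_conv)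
  define Q where "Q = synthetic_div P (rC t0)"
  have P: "poly P (rC s) = (rC s - rC t0) * poly Q (rC s) + poly P (rC t0)" for s
  proof -
    have "poly ([:- rC t0, 1:] * Q + [:poly P (rC t0):]) (rC s) = poly P (rC s)"
      unfolding Q_def synthetic_div_correct' ..
    then show ?thesis by (simp add: algebra_simps)
  qed
  have "poly Q (rC s) \<in> S" if "s \<in> A - {t0}" for s
  proof -
    have "rC (1 / (s - t0)) * (poly P (rC s) - poly P (rC t0)) \<in> S"
      using that t0 Suc.prems by (intro rsub_smult[OF S] rsub_diff[OF S]) auto
    moreover have "poly P (rC s) - poly P (rC t0) = rC (s - t0) * poly Q (rC s)"
      by (subst P) (simp add: rC_diff)
    moreover have "rC (1 / (s - t0)) * (rC (s - t0) * poly Q (rC s)) = poly Q (rC s)"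
      using that by (simp add: rC_divide)
    ultimately show ?thesis by simp
  qed
  moreover have "infinite (A - {t0})" using Suc.prems by simp
  moreover have "n = degree Q" using Suc.hyps(2) by (simp add: Q_def degree_synthetic_div)
  ultimately have "poly Q (rC t) \<in> S" using Suc.hyps(1) by blast
  then have "rC (t - t0) * poly Q (rC t) + poly P (rC t0) \<in> S"
    using t0 Suc.prems by (intro rsub_add[OF S] rsub_smult[OF S]) auto
  then show ?case by (subst P) (simp add: rC_diff)
qed

lemma poly_map_rderiv: "poly (map_poly rderiv P) (rC t) = rderiv (poly P (rC t))"
  by (induction P) (simp_all add: map_poly_pCons)

text \<open>For natural \<open>n\<close>, \<open>N n\<close> preserves
  \<open>(x - 1)^(-n) U\<close>, so its iterates on multiples of \<open>\<tau>^M\<close> have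
  denominators dividing \<open>\<tau>^M\<close> times a power of \<open>x - 1\<close>. Since the
  iterates are polynomial in the parameter, this persists at \<open>- a\<close>. There the operator
  has coefficients regular at \<open>x = 1\<close>, which removes the powers of
  \<open>x - 1\<close>. So these multiples lie in the largest subspace of
  \<open>Vden \<tau> M\<close> invariant under the reflected operator.\<close>

lemma admissible_reflect:
  assumes "admissible \<tau> a b"
  shows "admissible \<tau> (- a) b"
proof -
  from assms obtain M U where pm: "poly \<tau> 1 \<noteq> 0" "poly \<tau> (-1) \<noteq> 0" and U: "rsub U"
    and inv: "\<And>f. f \<in> U \<Longrightarrow> LJ (Vpot \<tau>) a b f \<in> U" and sub: "U \<subseteq> Vden \<tau> M"
    and sup: "\<And>g. to_fract \<tau> ^ M * to_fract g \<in> U"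
    by (auto simp: admissible_def)
  define r where "r = Vpot \<tau>"
  define y where "y = (rX + 1) / (rX - 1)"
  define z where "z = rX - 1"
  \<comment> \<open>Up to an additive constant, this is the operator conjugated by \<open>(x - 1) ^ t\<close>.
      It makes sense for every real \<open>t\<close> and depends polynomially on \<open>t\<close>; \<open>t = - a\<close> reflects \<open>a\<close>.\<close>
  define N where "N t f = LJ r a b f + rC t * (2 * (rX + 1) * rderiv f)
      + (rC t ^ 2 + rC a * rC t) * (y * f)" for t f
  \<comment> \<open>The indeterminate \<open>[:0, 1:]\<close> stands for \<open>t\<close> and the
    coefficients are functions of \<open>x\<close>; iterating \<open>NP\<close> shows that the
    iterates of \<open>N t\<close> are polynomial in \<open>t\<close>.\<close>
  define NP where "NP P = smult (rX ^ 2 - 1) (map_poly rderiv (map_poly rderiv P))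
      + smult (qJ a b) (map_poly rderiv P) + smult r P
      + [:0, 1:] * smult (2 * (rX + 1)) (map_poly rderiv P)
      + ([:0, 1:] ^ 2 + [:0, rC a:]) * smult y P" for P
  have NP: "poly (NP P) (rC t) = N t (poly P (rC t))" for P t
    by (simp add: NP_def N_def LJ_def poly_map_rderiv algebra_simps power2_eq_square)
  have NPj: "(N t ^^ j) f = poly ((NP ^^ j) [:f:]) (rC t)" for t j f
    by (induction j) (simp_all add: NP)
  have conj: "z ^ n * N (of_nat n) f = LJ r a b (z ^ n * f) - rC (of_nat n * (b + 1)) * (z ^ n * f)" for n f
  proof -
    define c where "c = rC (of_nat n)"
    define w where "w = z ^ n"
    define i where "i = 1 / z"
    have zi: "(rX - 1) * i = 1" by (simp add: i_def z_def)
    have y: "y = (rX + 1) * i" by (simp add: y_def i_def z_def)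
    have w0: "w \<noteq> 0" by (simp add: w_def z_def)
    have "ld w = c * i"
      by (simp add: w_def ld_power z_def c_def rC_of_nat i_def) (simp add: ld_def)
    then have dw: "rderiv w = c * i * w" using rderiv_eq_ld[OF w0] by simp
    have di: "rderiv i = - (i ^ 2)" by (simp add: i_def z_def rderiv_divide power_divide)
    have dc: "rderiv c = 0" by (simp add: c_def)
    show ?thesis
      unfolding N_def LJ_def w_def[symmetric] c_def[symmetric] rC_mult y rderiv_mult dw rderiv_add di dc qJ_def
        rC_add rC_1
      using zi by algebra
  qed
  have NU: "z ^ n * (N (of_nat n) ^^ j) f \<in> U" if "z ^ n * f \<in> U" for n j f
  proof (induction j)
    case (Suc j)
    then show ?case
      by (simp add: conj r_def) (intro rsub_diff[OF U] rsub_smult[OF U] inv)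
  qed (use that in simp)
  \<comment> \<open>The exponent \<open>m\<close> is left free because the power of
    \<open>x - 1\<close> grows with the natural parameter.\<close>
  define S where "S = {F. \<exists>m. z ^ m * F \<in> Vden \<tau> M}"
  have zV: "z ^ k * F \<in> Vden \<tau> M" if F: "F \<in> Vden \<tau> M" for k F
  proof -
    obtain g where "to_fract \<tau> ^ M * F = to_fract g" using F by (auto simp: Vden_def)
    moreover have "z = to_fract [:-1, 1:]"
      by (simp add: z_def rX_def one_pCons flip: to_fract_1 to_fract_diff)
    ultimately have "to_fract \<tau> ^ M * (z ^ k * F) = to_fract ([:-1, 1:] ^ k * g)"
      unfolding to_fract_mult to_fract_power by (metis mult.left_commute)
    then show ?thesis unfolding Vden_def by blast
  qed
  have S: "rsub S"
    unfolding rsub_def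
  proof (intro conjI ballI allI)
    show "0 \<in> S" using rsub_0[OF rsub_Vden] by (auto simp: S_def)
  next
    fix f g assume "f \<in> S" "g \<in> S"
    then obtain m k where "z ^ m * f \<in> Vden \<tau> M" "z ^ k * g \<in> Vden \<tau> M" by (auto simp: S_def)
    then have "z ^ k * (z ^ m * f) + z ^ m * (z ^ k * g) \<in> Vden \<tau> M"
      using rsub_add[OF rsub_Vden] zV by blast
    then have "z ^ (k + m) * (f + g) \<in> Vden \<tau> M" by (simp add: power_add algebra_simps)
    then show "f + g \<in> S" unfolding S_def by blast
  next
    fix c f assume "f \<in> S"
    then obtain m where "z ^ m * f \<in> Vden \<tau> M" by (auto simp: S_def)
    then have "rC c * (z ^ m * f) \<in> Vden \<tau> M" by (rule rsub_smult[OF rsub_Vden])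
    then show "rC c * f \<in> S" by (auto simp: S_def mult.left_commute)
  qed
  define L' where "L' = LJ r (- a) b"
  \<comment> \<open>At \<open>t = - a\<close> the factor \<open>t^2 + a t\<close> vanishes, and with
    it the only coefficient having a pole at \<open>x = 1\<close>.\<close>
  have L': "N (- a) = L'"
    by (intro ext) (simp add: N_def L'_def LJ_def qJ_def rC_hom algebra_simps power2_eq_square)
  have key: "(L' ^^ j) (to_fract \<tau> ^ M * to_fract g) \<in> Vden \<tau> M" for j g
  proof -
    define f where "f = to_fract \<tau> ^ M * to_fract g"
    define F where "F = (L' ^^ j) f"
    have "poly ((NP ^^ j) [:f:]) (rC (of_nat n)) \<in> S" for n
    proof -
      have "z = to_fract [:-1, 1:]"
        by (simp add: z_def rX_def one_pCons flip: to_fract_1 to_fract_diff)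
      then have "z ^ n * f = to_fract \<tau> ^ M * to_fract ([:-1, 1:] ^ n * g)"
        by (simp only: f_def to_fract_mult to_fract_power mult.left_commute)
      then have "z ^ n * (N (of_nat n) ^^ j) f \<in> U" using sup by (intro NU) metis
      then show ?thesis using sub by (auto simp: S_def simp flip: NPj)
    qed
    then have "\<And>t. t \<in> range (of_nat :: nat \<Rightarrow> real) \<Longrightarrow> poly ((NP ^^ j) [:f:]) (rC t) \<in> S"
      by blast
    moreover have "infinite (range (of_nat :: nat \<Rightarrow> real))"
      by (metis finite_imageD infinite_UNIV_nat inj_of_nat)
    ultimately have "poly ((NP ^^ j) [:f:]) (rC (- a)) \<in> S"
      by (metis poly_in_rsub[OF S])
    then have "F \<in> S" by (simp add: F_def L' flip: NPj)
    then obtain m g' where g': "to_fract \<tau> ^ M * (z ^ m * F) = to_fract g'"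
      by (auto simp: S_def Vden_def)
    have "f \<in> Reg 1" unfolding f_def by (intro Reg_mult Reg_power Reg_to_fract)
    then have "F \<in> Reg 1"
      unfolding F_def
    proof (induction j)
      case (Suc j)
      then show ?case using Vpot_Reg[OF pm(1)]
        by (auto simp: L'_def LJ_def qJ_def r_def intro!: Reg_intros)
    qed simp
    then have "to_fract \<tau> ^ M * F \<in> Reg 1" by (intro Reg_mult Reg_power Reg_to_fract)
    then obtain P Q where PQ: "poly Q 1 \<noteq> 0" "Q \<noteq> 0" "to_fract \<tau> ^ M * F = to_fract P / to_fract Q"
      by (rule RegE)
    have "to_fract g' = z ^ m * (to_fract \<tau> ^ M * F)" using g' by (simp add: mult_ac)
    also have "\<dots> = to_fract ([:-1, 1:] ^ m * P) / to_fract Q"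
      by (simp add: PQ z_def rX_def one_pCons flip: to_fract_1 to_fract_diff)
    finally have "to_fract (g' * Q) = to_fract ([:-1, 1:] ^ m * P)" using PQ by (simp add: field_simps)
    then have eq: "g' * Q = [:-1, 1:] ^ m * P" by (simp only: to_fract_eq_iff)
    have "coprime ([:-1, 1:] ^ m) Q"
    proof (intro coprime_power_left_iff[THEN iffD2] disjI1)
      have "\<not> [:-1, 1:] dvd Q" using PQ(1) poly_eq_0_iff_dvd[of Q 1] by simp
      then show "coprime [:-1, 1:] Q"
        using prime_elem_linear_field_poly[of 1 "-1 :: real"] prime_elem_imp_coprime by force
    qed
    then have "[:-1, 1:] ^ m dvd g'"
      using eq by (metis coprime_dvd_mult_left_iff dvd_triv_left)
    then obtain G where G: "g' = [:-1, 1:] ^ m * G" by (auto simp: dvd_def)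
    then have "P = G * Q" using eq by simp
    then have "to_fract \<tau> ^ M * F = to_fract G" using PQ by simp
    then show ?thesis unfolding Vden_def F_def f_def by blast
  qed
  define U' where "U' = {f. \<forall>i. True \<longrightarrow> (L' ^^ i) f \<in> Vden \<tau> M}"
  have "rsub U'"
    unfolding U'_def L'_def by (intro rsub_iterates rsub_Vden LJ_add LJ_smult)
  moreover have "L' f \<in> U'" if "f \<in> U'" for f
  proof -
    have "(L' ^^ Suc i) f \<in> Vden \<tau> M" for i using that unfolding U'_def by blast
    then show ?thesis by (simp add: U'_def funpow_swap1)
  qed
  moreover have "U' \<subseteq> Vden \<tau> M" by (auto simp: U'_def dest: spec[of _ 0])
  moreover have "to_fract \<tau> ^ M * to_fract g \<in> U'" for g
    using key by (simp add: U'_def)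
  ultimately show ?thesis
    unfolding admissible_def using pm L'_def r_def by blast
qed

subsection \<open>Rational solutions of the Riccati equation\<close>

definition lds :: "real poly set \<Rightarrow> (real poly \<Rightarrow> real) \<Rightarrow> rfun" where
  "lds F c = (\<Sum>\<pi>\<in>F. rC (c \<pi>) * ld (to_fract \<pi>))"

lemma lds_Oinf: "lds F c \<in> Oinf (-1)"
  unfolding lds_def by (intro Oinf_sum Oinf_smult ld_Oinf)

lemma lds_mono_neutral:
  assumes "finite F" "E \<subseteq> F" "\<And>\<pi>. \<pi> \<in> F - E \<Longrightarrow> c \<pi> = 0"
  shows "lds F c = lds E c"
  unfolding lds_def using assms by (intro sum.mono_neutral_right) auto

lemma to_fract_prod: "to_fract (prod f A) = (\<Prod>x\<in>A. to_fract (f x))"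
  by (induction A rule: infinite_finite_induct) simp_all

lemma lds_quot:
  assumes F: "finite F" "\<And>\<pi>. \<pi> \<in> F \<Longrightarrow> \<pi> \<noteq> 0"
  shows "lds F c = to_fract (\<Sum>\<pi>\<in>F. smult (c \<pi>) (pderiv \<pi>) * \<Prod>(F - {\<pi>})) / to_fract (\<Prod>F)"
proof -
  have "rC (c \<pi>) * ld (to_fract \<pi>) =
      to_fract (smult (c \<pi>) (pderiv \<pi>) * \<Prod>(F - {\<pi>})) / to_fract (\<Prod>F)" if "\<pi> \<in> F" for \<pi>
  proof -
    have "\<Prod>F = \<pi> * \<Prod>(F - {\<pi>})" using that F by (simp add: prod.remove)
    moreover have "\<Prod>(F - {\<pi>}) \<noteq> 0" using F by auto
    moreover have "smult (c \<pi>) (pderiv \<pi>) = [:c \<pi>:] * pderiv \<pi>" by simp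
    ultimately show ?thesis
      using F that by (simp add: ld_def rC_def del: mult_pCons_left)
  qed
  then show ?thesis
    unfolding lds_def to_fract_sum sum_divide_distrib by (intro sum.cong) auto
qed

lemma prime_not_dvd_prod_primes:
  fixes F :: "real poly set"
  assumes "finite F" "\<And>\<pi>. \<pi> \<in> F \<Longrightarrow> prime \<pi>" "prime \<pi>" "\<pi> \<notin> F"
  shows "\<not> \<pi> dvd \<Prod>F"
proof
  assume "\<pi> dvd \<Prod>F"
  then obtain \<rho> where "\<rho> \<in> F" "\<pi> dvd \<rho>"
    using prime_dvd_prod_iff[of F \<pi> "\<lambda>x. x"] assms(1,3) by auto
  then show False
    using primes_dvd_imp_eq[of \<pi> \<rho>] assms by auto
qed

lemma prod_primes_dvd:
  fixes F :: "real poly set"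
  assumes "finite F" "\<And>\<pi>. \<pi> \<in> F \<Longrightarrow> prime \<pi>" "\<And>\<pi>. \<pi> \<in> F \<Longrightarrow> \<pi> dvd R"
  shows "\<Prod>F dvd R"
  using assms
proof (induction F rule: finite_induct)
  case (insert \<pi> F)
  have "coprime \<pi> (\<Prod>F)"
    using insert prime_not_dvd_prod_primes[of F \<pi>] by (intro prime_imp_coprime) auto
  then show ?case using insert by (simp add: divides_mult)
qed simp

text \<open>At a pole of \<open>z\<close> the residue \<open>\<rho>\<close> satisfies
  \<open>\<rho>^2 - \<rho> + a \<rho> = 0\<close> and is nonzero, so it equals \<open>1 - a\<close>,
  with \<open>a = 0\<close> off \<open>\<Omega>\<close>. To treat irreducible quadratics like linear
  factors, the equation is cleared of denominators and reduced modulo \<open>\<pi>\<close>, the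
  residue being expressed by divisibility of
  \<open>P - smult (g \<pi>) (pderiv \<pi> * Q1)\<close>.\<close>

lemma riccati_poles:
  assumes \<Omega>: "finite \<Omega>" "\<And>\<pi>. \<pi> \<in> \<Omega> \<Longrightarrow> prime \<pi>"
    and eq: "rderiv z + z ^ 2 + lds \<Omega> a * z = to_fract b / to_fract (\<Prod>\<Omega>)"
    and inf: "to_fract b / to_fract (\<Prod>\<Omega>) \<in> Oinf (-2)"
  obtains F where "finite F" "\<And>\<pi>. \<pi> \<in> F \<Longrightarrow> prime \<pi>"
    "z = lds F (\<lambda>\<pi>. if \<pi> \<in> \<Omega> then 1 - a \<pi> else 1)"
proof -
  define P Q where "P = fst (quot_of_fract z)" and "Q = snd (quot_of_fract z)"
  have Q0: "Q \<noteq> 0" and z: "z = to_fract P / to_fract Q" and cop: "coprime P Q"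
    and Q_norm: "normalize Q = Q"
    by (auto simp: P_def Q_def coprime_quot_of_fract normalize_snd_quot_of_fract
        simp flip: Fract_conv_to_fract)
  define S where "S = \<Prod>\<Omega>"
  define N where "N = (\<Sum>\<pi>\<in>\<Omega>. smult (a \<pi>) (pderiv \<pi>) * \<Prod>(\<Omega> - {\<pi>}))"
  have \<Omega>0: "\<pi> \<noteq> 0" if "\<pi> \<in> \<Omega>" for \<pi> using \<Omega>(2)[OF that] by auto
  have S0: "S \<noteq> 0" using \<Omega> \<Omega>0 by (auto simp: S_def)
  have lds: "lds \<Omega> a = to_fract N / to_fract S"
    unfolding N_def S_def using \<Omega>(1) \<Omega>0 by (rule lds_quot)
  have "to_fract (S * (pderiv P * Q - P * pderiv Q + P ^ 2) + N * P * Q) = to_fract (b * Q ^ 2)"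
  proof -
    have dz: "rderiv z = to_fract (pderiv P * Q - P * pderiv Q) / to_fract (Q ^ 2)"
      unfolding z by (rule rderiv_quot[OF Q0])
    have "s * (d + p ^ 2) + n * p * q = b' * q ^ 2"
      if "d / q ^ 2 + (p / q) ^ 2 + n / s * (p / q) = b' / s" "q \<noteq> 0" "s \<noteq> 0" for d p q n s b' :: rfun
    proof -
      have "s * q ^ 2 * (d / q ^ 2 + (p / q) ^ 2 + n / s * (p / q)) = s * (d + p ^ 2) + n * p * q"
        using that(2,3) by (simp add: field_simps power2_eq_square)
      moreover have "s * q ^ 2 * (b' / s) = b' * q ^ 2" using that(2,3) by simp
      ultimately show ?thesis using that(1) by simp
    qed
    from this[OF eq[unfolded dz lds, unfolded z, folded S_def, unfolded to_fract_power]] Q0 S0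
    show ?thesis by simp
  qed
  then have ident: "S * (pderiv P * Q - P * pderiv Q + P ^ 2) + N * P * Q = b * Q ^ 2"
    by (simp only: to_fract_eq_iff)
  define F where "F = prime_factors Q"
  define g where "g \<pi> = (if \<pi> \<in> \<Omega> then 1 - a \<pi> else 1)" for \<pi>
  have F: "finite F" "\<And>\<pi>. \<pi> \<in> F \<Longrightarrow> prime \<pi>" by (auto simp: F_def)
  have pole: "\<exists>Q1. Q = \<pi> * Q1 \<and> \<not> \<pi> dvd Q1 \<and> \<pi> dvd P - smult (g \<pi>) (pderiv \<pi> * Q1)" if \<pi>F: "\<pi> \<in> F" for \<pi>
  proof -
    have pr: "prime \<pi>" and "\<pi> dvd Q" using \<pi>F by (auto simp: F_def in_prime_factors_iff)
    then obtain Q1 where Q1: "Q = \<pi> * Q1" by (auto simp: dvd_def)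
    have nP: "\<not> \<pi> dvd P" using cop \<open>\<pi> dvd Q\<close> pr
      by (meson coprime_common_divisor not_prime_unit)
    have dQ: "pderiv Q = pderiv \<pi> * Q1 + \<pi> * pderiv Q1"
      unfolding Q1 pderiv_mult by (simp add: algebra_simps)
    have dvdP: "\<pi> dvd P - smult (g \<pi>) (pderiv \<pi> * Q1)"
    proof (cases "\<pi> \<in> \<Omega>")
      case False
      then have nS: "\<not> \<pi> dvd S" unfolding S_def by (intro prime_not_dvd_prod_primes \<Omega> pr)
      have "S * P * (P - pderiv \<pi> * Q1) = \<pi> * (b * \<pi> * Q1 ^ 2 - N * P * Q1 - S * pderiv P * Q1
          + S * P * pderiv Q1)"
        using ident unfolding dQ unfolding Q1 by algebra
      then have "\<pi> dvd S * P * (P - pderiv \<pi> * Q1)" by simp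
      then have "\<pi> dvd P - pderiv \<pi> * Q1"
        using nS nP pr by (simp add: prime_dvd_mult_iff)
      then show ?thesis using False by (simp add: g_def)
    next
      case True
      define S1 where "S1 = \<Prod>(\<Omega> - {\<pi>})"
      have S: "S = \<pi> * S1" unfolding S_def S1_def using True \<Omega> by (simp add: prod.remove)
      have nS1: "\<not> \<pi> dvd S1" unfolding S1_def by (intro prime_not_dvd_prod_primes) (use \<Omega> pr in auto)
      define N' where "N' = (\<Sum>\<rho>\<in>\<Omega> - {\<pi>}. smult (a \<rho>) (pderiv \<rho>) * \<Prod>(\<Omega> - {\<rho>}))"
      have N': "N = smult (a \<pi>) (pderiv \<pi>) * S1 + N'"
        unfolding N_def N'_def S1_def using True \<Omega> by (subst sum.remove[of _ \<pi>]) auto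
      have "\<pi> dvd N'"
        unfolding N'_def using \<Omega> True by (intro dvd_sum dvd_mult dvd_prodI) auto
      then obtain N1 where N1: "N' = \<pi> * N1" by (auto simp: dvd_def)
      define A where "A = [:a \<pi>:]"
      have sA: "smult (a \<pi>) q = A * q" for q by (simp add: A_def)
      \<comment> \<open>Here \<open>\<pi>\<close> divides \<open>S\<close> as well, so all terms
        carry a factor \<open>\<pi>\<close>; once it is cancelled, the summand of \<open>N\<close>
        belonging to \<open>\<pi>\<close> survives modulo \<open>\<pi>\<close> and contributes
        \<open>A\<close>.\<close>
      have "\<pi> * (S1 * P * (P - pderiv \<pi> * Q1 + A * (pderiv \<pi> * Q1)))
          = \<pi> * (\<pi> * (b * Q1 ^ 2 - N1 * P * Q1 - S1 * pderiv P * Q1 + S1 * P * pderiv Q1))"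
        using ident unfolding dQ N' N1 S sA unfolding Q1 by algebra
      then have "S1 * P * (P - pderiv \<pi> * Q1 + A * (pderiv \<pi> * Q1))
          = \<pi> * (b * Q1 ^ 2 - N1 * P * Q1 - S1 * pderiv P * Q1 + S1 * P * pderiv Q1)"
        using pr by (metis mult_left_cancel not_prime_0)
      then have "\<pi> dvd S1 * P * (P - pderiv \<pi> * Q1 + A * (pderiv \<pi> * Q1))" by simp
      then have "\<pi> dvd P - pderiv \<pi> * Q1 + A * (pderiv \<pi> * Q1)"
        using nS1 nP pr by (simp add: prime_dvd_mult_iff)
      moreover have "P - pderiv \<pi> * Q1 + A * (pderiv \<pi> * Q1) = P - smult (g \<pi>) (pderiv \<pi> * Q1)"
        using True by (simp add: g_def smult_diff_left flip: sA)
      ultimately show ?thesis by simp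
    qed
    \<comment> \<open>A multiple pole would make \<open>\<pi>\<close> divide \<open>P\<close>,
      against coprimality; the residue condition itself forces poles to be simple.\<close>
    moreover have "\<not> \<pi> dvd Q1"
    proof
      assume "\<pi> dvd Q1"
      then have "\<pi> dvd smult (g \<pi>) (pderiv \<pi> * Q1)" by (simp add: dvd_smult)
      with dvdP have "\<pi> dvd (P - smult (g \<pi>) (pderiv \<pi> * Q1)) + smult (g \<pi>) (pderiv \<pi> * Q1)"
        by (rule dvd_add)
      with nP show False by simp
    qed
    ultimately show ?thesis using Q1 by blast
  qed
  have QF: "Q = \<Prod>F"
  proof -
    have "multiplicity \<pi> Q = 1" if \<pi>F: "\<pi> \<in> F" for \<pi>
    proof (rule multiplicity_eqI)
      obtain Q1 where Q1: "Q = \<pi> * Q1" "\<not> \<pi> dvd Q1" using pole[OF \<pi>F] by blast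
      then show "\<pi> ^ 1 dvd Q" by simp
      have "\<pi> \<noteq> 0" using F(2)[OF \<pi>F] by auto
      then show "\<not> \<pi> ^ Suc 1 dvd Q" using Q1 by simp
    qed
    moreover have "(\<Prod>\<pi>\<in>F. \<pi> ^ multiplicity \<pi> Q) = normalize Q"
      unfolding F_def using Q0 by (rule prod_prime_factors)
    ultimately show ?thesis using Q_norm by simp
  qed
  define M where "M = (\<Sum>\<pi>\<in>F. smult (g \<pi>) (pderiv \<pi>) * \<Prod>(F - {\<pi>}))"
  have "\<pi> dvd P - M" if \<pi>F: "\<pi> \<in> F" for \<pi>
  proof -
    obtain Q1 where Q1: "Q = \<pi> * Q1" "\<pi> dvd P - smult (g \<pi>) (pderiv \<pi> * Q1)" using pole[OF \<pi>F] by blast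
    have "\<pi> \<noteq> 0" using F(2)[OF that] by auto
    moreover have "\<pi> * \<Prod>(F - {\<pi>}) = \<pi> * Q1"
      unfolding Q1(1)[symmetric] QF using \<pi>F F by (simp add: prod.remove)
    ultimately have Q1': "\<Prod>(F - {\<pi>}) = Q1" by simp
    define M' where "M' = (\<Sum>\<rho>\<in>F - {\<pi>}. smult (g \<rho>) (pderiv \<rho>) * \<Prod>(F - {\<rho>}))"
    have M': "M = smult (g \<pi>) (pderiv \<pi>) * Q1 + M'"
      unfolding M_def M'_def using \<pi>F F by (subst sum.remove[of _ \<pi>]) (auto simp: Q1')
    have "\<pi> dvd M'"
      unfolding M'_def using F \<pi>F by (intro dvd_sum dvd_mult dvd_prodI) auto
    then have "\<pi> dvd (P - smult (g \<pi>) (pderiv \<pi> * Q1)) - M'"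
      by (rule dvd_diff[OF Q1(2)])
    then show ?thesis by (simp add: M' diff_diff_add)
  qed
  then have "Q dvd P - M" unfolding QF using F by (intro prod_primes_dvd)
  then obtain G where G: "P - M = Q * G" by (auto simp: dvd_def)
  have F0: "\<pi> \<noteq> 0" if "\<pi> \<in> F" for \<pi> using F(2)[OF that] by auto
  have ldsF: "lds F g = to_fract M / to_fract Q"
    unfolding M_def QF using F(1) F0 by (rule lds_quot)
  have "P = M + Q * G" using G by (simp add: algebra_simps)
  then have z_eq: "z = lds F g + to_fract G"
    using Q0 ldsF by (simp add: z add_divide_distrib)
  \<comment> \<open>A polynomial part of degree \<open>k\<close> would give \<open>z^2\<close> a
    term of degree \<open>2 k\<close>, while everything else has degree at most
    \<open>k - 1\<close>; even a nonzero constant is excluded.\<close>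
  have "G = 0"
  proof (rule ccontr)
    assume G0: "G \<noteq> 0"
    define k where "k = int (degree G)"
    define y where "y = lds F g"
    have y: "y \<in> Oinf (-1)" unfolding y_def by (rule lds_Oinf)
    have GO: "to_fract G \<in> Oinf k" by (simp add: Oinf_def fdeg_to_fract k_def)
    have zO: "z \<in> Oinf k" unfolding z_eq y_def[symmetric]
      by (intro Oinf_add GO Oinf_mono[OF y]) (simp add: k_def)
    have "to_fract G * to_fract G = to_fract b / to_fract (\<Prod>\<Omega>) - rderiv z - lds \<Omega> a * z
        - rC 2 * (y * to_fract G) - y * y"
      using eq by (simp add: z_eq y_def power2_eq_square algebra_simps)
    also have "\<dots> \<in> Oinf (k - 1)"
      by (intro Oinf_diff Oinf_rderiv zO Oinf_mult'[OF lds_Oinf zO] Oinf_smult Oinf_mult'[OF y GO]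
          Oinf_mult'[OF y y] Oinf_mono[OF inf]) (simp_all add: k_def)
    finally have "fdeg (to_fract G * to_fract G) \<le> k - 1" using G0 by (simp add: Oinf_def)
    then show False using G0 by (simp add: fdeg_mult fdeg_to_fract k_def)
  qed
  then have "z = lds F (\<lambda>\<pi>. if \<pi> \<in> \<Omega> then 1 - a \<pi> else 1)"
    using z_eq by (simp add: g_def[abs_def])
  with F that show ?thesis by blast
qed

lemma ld_to_fract_eq_lds:
  assumes P: "P \<noteq> 0" and F: "finite F" "prime_factors P \<subseteq> F" "\<And>\<pi>. \<pi> \<in> F \<Longrightarrow> prime \<pi>"
  shows "ld (to_fract P) = lds F (\<lambda>\<pi>. of_nat (multiplicity \<pi> P))"
proof -
  define c where "c = lead_coeff P"
  have c0: "c \<noteq> 0" using P by (simp add: c_def)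
  have "P = [:c:] * normalize P"
    using unit_factor_mult_normalize[of P] by (simp add: unit_factor_poly_def c_def)
  then have P_eq: "to_fract P = rC c * to_fract (normalize P)"
    by (metis rC_def to_fract_mult)
  have nz: "\<pi> \<noteq> 0" if "\<pi> \<in> prime_factors P" for \<pi>
    using in_prime_factors_imp_prime[OF that] by auto
  have "to_fract (normalize P) = (\<Prod>\<pi>\<in>prime_factors P. to_fract \<pi> ^ multiplicity \<pi> P)"
    unfolding prod_prime_factors[OF P, symmetric] to_fract_prod by simp
  then have "ld (to_fract (normalize P)) = (\<Sum>\<pi>\<in>prime_factors P. ld (to_fract \<pi> ^ multiplicity \<pi> P))"
    using nz by (simp add: ld_prod)
  also have "\<dots> = lds (prime_factors P) (\<lambda>\<pi>. of_nat (multiplicity \<pi> P))"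
    unfolding lds_def by (intro sum.cong) (auto simp: ld_power rC_of_nat nz)
  also have "\<dots> = lds F (\<lambda>\<pi>. of_nat (multiplicity \<pi> P))"
  proof (rule lds_mono_neutral[symmetric, OF F(1,2)])
    fix \<pi> assume "\<pi> \<in> F - prime_factors P"
    then have "\<not> \<pi> dvd P" using F(3) P by (auto simp: in_prime_factors_iff)
    then show "real (multiplicity \<pi> P) = 0" by (simp add: not_dvd_imp_multiplicity_0)
  qed
  finally show ?thesis
    unfolding P_eq using c0 P by (subst ld_mult) (auto simp: ld_def[of "rC c"])
qed

section \<open>Shape of the rational solutions and a uniform bound on their exponents\<close>

abbreviation X1 :: "real poly" where "X1 \<equiv> [:-1, 1:]"
abbreviation X2 :: "real poly" where "X2 \<equiv> [:1, 1:]"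

lemma prime_linear: "prime [:c, 1 :: real:]"
  unfolding prime_def using prime_elem_linear_field_poly[of 1 c]
  by (simp add: normalize_poly_def unit_factor_poly_def flip: one_pCons)

lemma to_fract_X1: "to_fract X1 = rX - 1" and to_fract_X2: "to_fract X2 = rX + 1"
  by (simp_all add: rX_def one_pCons flip: to_fract_1 to_fract_add to_fract_diff)

lemma ld_X1: "ld (to_fract X1) = 1 / (rX - 1)" and ld_X2: "ld (to_fract X2) = 1 / (rX + 1)"
  by (simp_all only: to_fract_X1 to_fract_X2 ld_def rderiv_add rderiv_diff rderiv_1 rderiv_rX) simp_all

text \<open>Subtracting the known solution \<open>ld h0\<close> from \<open>w\<close> eliminates
  \<open>r\<close>: the difference satisfies a Riccati equation with coefficient
  \<open>2 * ld h0 + eta \<alpha> \<beta>\<close> and right-hand side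
  \<open>(l - l0) / (x^2 - 1)\<close>. Its poles off the fixed set \<open>\<Omega>\<close> all have
  residue 1, so only \<open>\<Omega>\<close> can lower the exponent at infinity. Hence
  \<open>C\<close> depends neither on \<open>l\<close> nor on \<open>w\<close>.\<close>

lemma rational_solution_structure:
  assumes pm: "poly \<tau> 1 \<noteq> 0" "poly \<tau> (-1) \<noteq> 0"
    and h0: "h0 \<noteq> 0" "RJ r \<alpha> \<beta> (ld h0) = rC l0"
  shows "\<exists>C. \<forall>l w. RJ r \<alpha> \<beta> w = rC l \<longrightarrow>
    (\<exists>r1 r2 R. R \<noteq> 0 \<and> ld R \<in> Reg 1 \<and> ld R \<in> Reg (-1) \<and>
       w = rC r1 / (rX - 1) + rC r2 / (rX + 1) + ld R \<and> r1 + r2 + of_int (fdeg R) \<ge> - C)"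
proof -
  obtain y t where yt: "y \<noteq> 0" "t \<noteq> 0" "h0 = to_fract y / to_fract t"
    using h0(1) by (rule rfun_cases_nonzero)
  define \<Omega> where "\<Omega> = prime_factors y \<union> prime_factors t \<union> {X1, X2}"
  have \<Omega>: "finite \<Omega>" "\<And>\<pi>. \<pi> \<in> \<Omega> \<Longrightarrow> prime \<pi>"
    by (auto simp: \<Omega>_def intro: prime_linear)
  define m where "m \<pi> = int (multiplicity \<pi> y) - int (multiplicity \<pi> t)" for \<pi>
  have ldh: "ld h0 = lds \<Omega> (\<lambda>\<pi>. of_int (m \<pi>))"
  proof -
    have "ld h0 = ld (to_fract y) - ld (to_fract t)" using yt by (simp add: ld_divide)
    also have "\<dots> = lds \<Omega> (\<lambda>\<pi>. of_nat (multiplicity \<pi> y)) - lds \<Omega> (\<lambda>\<pi>. of_nat (multiplicity \<pi> t))"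
    proof -
      have "prime_factors y \<subseteq> \<Omega>" "prime_factors t \<subseteq> \<Omega>" by (auto simp: \<Omega>_def)
      then show ?thesis using ld_to_fract_eq_lds[OF _ \<Omega>(1) _ \<Omega>(2)] yt by simp
    qed
    finally show ?thesis
      by (simp add: lds_def m_def rC_diff left_diff_distrib sum_subtractf)
  qed
  define e where "e \<pi> = (if \<pi> = X1 then \<alpha> + 1 else if \<pi> = X2 then \<beta> + 1 else 0)" for \<pi>
  have eta: "eta \<alpha> \<beta> = lds \<Omega> e"
  proof -
    have "lds \<Omega> e = lds {X1, X2} e"
      using \<Omega> by (intro lds_mono_neutral) (auto simp: \<Omega>_def e_def)
    also have "\<dots> = eta \<alpha> \<beta>" by (simp add: lds_def ld_X1 ld_X2 e_def eta_def)
    finally show ?thesis ..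
  qed
  define a where "a \<pi> = 2 * of_int (m \<pi>) + e \<pi>" for \<pi>
  have A: "2 * ld h0 + eta \<alpha> \<beta> = lds \<Omega> a"
    unfolding ldh eta a_def lds_def sum_distrib_left sum.distrib[symmetric]
    by (intro sum.cong) (simp_all add: rC_hom algebra_simps)
  \<comment> \<open>A crude bound for the contribution of \<open>\<pi>\<close> to the exponent at
    infinity, whether or not \<open>z\<close> has a pole there.\<close>
  define d where "d \<pi> = (\<bar>of_int (m \<pi>)\<bar> + 1 + \<bar>1 - a \<pi>\<bar>) * of_nat (degree \<pi>)" for \<pi>
  define C where "C = sum d \<Omega>"
  show ?thesis
  proof (rule exI[of _ C], intro allI impI)
    fix l w assume w: "RJ r \<alpha> \<beta> w = rC l"
    define z where "z = w - ld h0"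
    define b where "b = [:l - l0:] * \<Prod>(\<Omega> - {X1, X2})"
    have prod_Omega: "\<Prod>\<Omega> = X1 * X2 * \<Prod>(\<Omega> - {X1, X2})"
    proof -
      have "\<Prod>\<Omega> = \<Prod>(\<Omega> - {X1, X2}) * \<Prod>{X1, X2}"
        using \<Omega> by (intro prod.subset_diff) (auto simp: \<Omega>_def)
      also have "\<Prod>{X1, X2} = X1 * X2" by (subst prod.insert) auto
      finally show ?thesis by (simp only: mult.commute)
    qed
    have pr0: "\<Prod>(\<Omega> - {X1, X2}) \<noteq> 0"
      using \<Omega>(1) \<Omega>(2)[of 0] by auto
    have rhs: "to_fract b / to_fract (\<Prod>\<Omega>) = rC (l - l0) / (rX ^ 2 - 1)"
    proof -
      have "to_fract b / to_fract (\<Prod>\<Omega>) = (rC (l - l0) * to_fract (\<Prod>(\<Omega> - {X1, X2})))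
          / (((rX - 1) * (rX + 1)) * to_fract (\<Prod>(\<Omega> - {X1, X2})))"
        by (simp only: b_def prod_Omega to_fract_mult to_fract_X1 to_fract_X2 rC_def)
      then show ?thesis using pr0 by (simp add: rX_square_minus_one)
    qed
    have "(rX ^ 2 - 1) * (rderiv z + z ^ 2 + (2 * ld h0 + eta \<alpha> \<beta>) * z) = rC (l - l0)"
    proof -
      have "RJ r \<alpha> \<beta> w - RJ r \<alpha> \<beta> (ld h0) = rC (l - l0)" by (simp add: w h0 rC_diff)
      then show ?thesis
        unfolding RJ_def eta_mult[symmetric] z_def rderiv_diff power2_eq_square[of "_ - _"]
        by (simp add: algebra_simps power2_eq_square[of w] power2_eq_square[of "ld h0"])
    qed
    then have eq: "rderiv z + z ^ 2 + lds \<Omega> a * z = to_fract b / to_fract (\<Prod>\<Omega>)"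
      unfolding rhs A by (metis nonzero_mult_div_cancel_left rX_pm_nonzero(3))
    have "rC (l - l0) / (rX ^ 2 - 1) \<in> Oinf (-2)"
    proof -
      have "fdeg (rX ^ 2 - 1) = 2"
        by (simp add: rX_square_minus_one fdeg_mult fdeg_to_fract flip: to_fract_X1 to_fract_X2)
      then show ?thesis by (cases "l = l0") (auto simp: Oinf_def fdeg_divide[OF _ rX_pm_nonzero(3)])
    qed
    then obtain F where F: "finite F" "\<And>\<pi>. \<pi> \<in> F \<Longrightarrow> prime \<pi>"
      and z: "z = lds F (\<lambda>\<pi>. if \<pi> \<in> \<Omega> then 1 - a \<pi> else 1)"
      using riccati_poles[OF \<Omega> eq] rhs by metis
    \<comment> \<open>Off \<open>X1\<close> and \<open>X2\<close> the coefficient is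
      \<open>m\<close>, \<open>1 - m\<close>, 1 or 0, an integer; so that part of \<open>w\<close>
      is the logarithmic derivative of a rational function.\<close>
    define k where "k \<pi> = (if \<pi> \<in> \<Omega> then m \<pi> else 0) +
       (if \<pi> \<in> F then if \<pi> \<in> \<Omega> then 1 - 2 * m \<pi> else 1 else 0)" for \<pi>
    define c where "c \<pi> = of_int (if \<pi> \<in> \<Omega> then m \<pi> else 0) +
       (if \<pi> \<in> F then if \<pi> \<in> \<Omega> then 1 - a \<pi> else 1 else 0)" for \<pi>
    have w_eq: "w = lds (\<Omega> \<union> F) c"
    proof -
      have "ld h0 = lds (\<Omega> \<union> F) (\<lambda>\<pi>. of_int (if \<pi> \<in> \<Omega> then m \<pi> else 0))"
      proof -
        have "lds (\<Omega> \<union> F) (\<lambda>\<pi>. of_int (if \<pi> \<in> \<Omega> then m \<pi> else 0)) =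
            lds \<Omega> (\<lambda>\<pi>. of_int (if \<pi> \<in> \<Omega> then m \<pi> else 0))"
          using \<Omega> F by (intro lds_mono_neutral) auto
        also have "\<dots> = ld h0" unfolding ldh lds_def by (intro sum.cong) auto
        finally show ?thesis ..
      qed
      moreover have "z = lds (\<Omega> \<union> F) (\<lambda>\<pi>. if \<pi> \<in> F then if \<pi> \<in> \<Omega> then 1 - a \<pi> else 1 else 0)"
      proof -
        have "lds (\<Omega> \<union> F) (\<lambda>\<pi>. if \<pi> \<in> F then if \<pi> \<in> \<Omega> then 1 - a \<pi> else 1 else 0) =
            lds F (\<lambda>\<pi>. if \<pi> \<in> F then if \<pi> \<in> \<Omega> then 1 - a \<pi> else 1 else 0)"
          using \<Omega> F by (intro lds_mono_neutral) auto
        also have "\<dots> = z" unfolding z lds_def by (intro sum.cong) auto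
        finally show ?thesis ..
      qed
      moreover have "w = ld h0 + z" by (simp add: z_def)
      ultimately show ?thesis
        unfolding lds_def c_def rC_add distrib_right sum.distrib by simp
    qed
    define E where "E = (\<Omega> \<union> F) - {X1, X2}"
    have E: "finite E" "\<And>\<pi>. \<pi> \<in> E \<Longrightarrow> prime \<pi>" using \<Omega> F by (auto simp: E_def)
    have ck: "c \<pi> = of_int (k \<pi>)" if "\<pi> \<in> E" for \<pi>
      using that by (auto simp: c_def k_def a_def e_def E_def)
    define R where "R = (\<Prod>\<pi>\<in>E. to_fract \<pi> powi k \<pi>)"
    have nzE: "to_fract \<pi> powi k \<pi> \<noteq> 0" "to_fract \<pi> \<noteq> (0 :: rfun)" if "\<pi> \<in> E" for \<pi>
      using E(2)[OF that] by (auto simp: power_int_eq_0_iff)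
    have R0: "R \<noteq> 0" unfolding R_def using E nzE by auto
    have ldR: "ld R = lds E c"
      unfolding R_def using E nzE by (auto simp: ld_prod ld_power_int lds_def ck intro!: sum.cong)
    have regR: "ld R \<in> Reg x0" if "x0 = 1 \<or> x0 = -1" for x0
      unfolding ldR lds_def
    proof (intro Reg_sum Reg_mult Reg_rC Reg_ld_to_fract)
      fix \<pi> assume \<pi>: "\<pi> \<in> E"
      show "poly \<pi> x0 \<noteq> 0"
      proof
        assume "poly \<pi> x0 = 0"
        then have "[:- x0, 1:] dvd \<pi>" by (simp add: poly_eq_0_iff_dvd)
        then have "[:- x0, 1:] = \<pi>" using primes_dvd_imp_eq prime_linear E(2)[OF \<pi>] by blast
        with that \<pi> show False by (auto simp: E_def)
      qed
    qed
    have split: "(\<Sum>\<pi>\<in>\<Omega> \<union> F. f \<pi>) = f X1 + f X2 + sum f E" for f :: "real poly \<Rightarrow> 'z :: comm_ring_1"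
    proof -
      have "sum f (\<Omega> \<union> F) = sum f E + sum f {X1, X2}"
        unfolding E_def using \<Omega> F by (intro sum.subset_diff) (auto simp: \<Omega>_def)
      then show ?thesis by (simp add: algebra_simps)
    qed
    have "w = rC (c X1) / (rX - 1) + rC (c X2) / (rX + 1) + ld R"
      unfolding w_eq ldR unfolding lds_def split ld_X1 ld_X2 by simp
    moreover have "c X1 + c X2 + of_int (fdeg R) \<ge> - C"
    proof -
      have "fdeg R = (\<Sum>\<pi>\<in>E. k \<pi> * int (degree \<pi>))"
        unfolding R_def using E nzE by (simp add: fdeg_prod fdeg_power_int fdeg_to_fract)
      then have "real_of_int (fdeg R) = (\<Sum>\<pi>\<in>E. c \<pi> * of_nat (degree \<pi>))"
        by (auto simp: ck intro!: sum.cong)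
      then have "c X1 + c X2 + of_int (fdeg R) = (\<Sum>\<pi>\<in>\<Omega> \<union> F. c \<pi> * of_nat (degree \<pi>))"
        by (simp add: split)
      also have "\<dots> \<ge> (\<Sum>\<pi>\<in>\<Omega> \<union> F. if \<pi> \<in> \<Omega> then - d \<pi> else 0)"
      proof (rule sum_mono)
        fix \<pi> assume \<pi>: "\<pi> \<in> \<Omega> \<union> F"
        show "(if \<pi> \<in> \<Omega> then - d \<pi> else 0) \<le> c \<pi> * of_nat (degree \<pi>)"
        proof (cases "\<pi> \<in> \<Omega>")
          case True
          then have "- (\<bar>of_int (m \<pi>)\<bar> + 1 + \<bar>1 - a \<pi>\<bar>) \<le> c \<pi>"
            unfolding c_def by (simp only: if_True split: if_split) linarith
          then have "- (\<bar>of_int (m \<pi>)\<bar> + 1 + \<bar>1 - a \<pi>\<bar>) * of_nat (degree \<pi>) \<le> c \<pi> * of_nat (degree \<pi>)"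
            by (intro mult_right_mono) auto
          then show ?thesis using True unfolding d_def by (simp only: if_True mult_minus_left)
        next
          case False
          then show ?thesis using \<pi> by (simp add: c_def)
        qed
      qed
      also have "(\<Sum>\<pi>\<in>\<Omega> \<union> F. if \<pi> \<in> \<Omega> then - d \<pi> else 0) = (\<Sum>\<pi>\<in>\<Omega>. - d \<pi>)"
        using \<Omega> F by (intro sum.mono_neutral_cong_right) auto
      finally show ?thesis by (simp add: C_def sum_negf)
    qed
    ultimately show "\<exists>r1 r2 R. R \<noteq> 0 \<and> ld R \<in> Reg 1 \<and> ld R \<in> Reg (-1) \<and>
       w = rC r1 / (rX - 1) + rC r2 / (rX + 1) + ld R \<and> r1 + r2 + of_int (fdeg R) \<ge> - C"
      using R0 regR by blast
  qed
qed

section \<open>Exponents at infinity and at x = 1, -1\<close>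

lemma inverse_rX_minus_1_Reg: "rC c / (rX - 1) \<in> Reg (-1)"
  and inverse_rX_plus_1_Reg: "rC c / (rX + 1) \<in> Reg 1"
  using Reg_quot[of X1 "-1" "[:c:]"] Reg_quot[of X2 1 "[:c:]"]
  by (simp_all add: to_fract_X1 to_fract_X2 rC_def)

lemma lds_asymptotics:
  assumes "R \<noteq> 0"
  shows "rC r1 / (rX - 1) + rC r2 / (rX + 1) + ld R - rC (r1 + r2 + of_int (fdeg R)) / rX \<in> Oinf (-2)"
proof -
  have "ld (to_fract X1) - rC 1 / rX \<in> Oinf (-2)" "ld (to_fract X2) - rC 1 / rX \<in> Oinf (-2)"
    using ld_asymptotics[of "to_fract X1"] ld_asymptotics[of "to_fract X2"]
    by (simp_all add: fdeg_to_fract)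
  then have "rC r1 * (ld (to_fract X1) - rC 1 / rX) + rC r2 * (ld (to_fract X2) - rC 1 / rX)
      + (ld R - rC (of_int (fdeg R)) / rX) \<in> Oinf (-2)"
    by (intro Oinf_add Oinf_smult ld_asymptotics assms)
  then show ?thesis
    unfolding ld_X1 ld_X2 by (simp add: rC_add right_diff_distrib add_divide_distrib algebra_simps)
qed

lemma leading_coeff_unique:
  assumes "w - rC s / rX \<in> Oinf (-2)" "w - rC t / rX \<in> Oinf (-2)"
  shows "s = t"
proof -
  have "has_res w s" "has_res w t"
    using assms unfolding has_res_def by (auto intro!: exI[of _ 0])
  then show ?thesis by (rule has_res_unique)
qed

text \<open>\<open>quasi w r1 r2 R\<close>: \<open>w\<close> is the logarithmic derivative of \<open>(x - 1)^r1 (x + 1)^r2 R\<close>, with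
  \<open>R\<close> rational and without zeros or poles at \<open>x = 1, -1\<close>.\<close>

definition quasi :: "rfun \<Rightarrow> real \<Rightarrow> real \<Rightarrow> rfun \<Rightarrow> bool" where
  "quasi w r1 r2 R \<longleftrightarrow> R \<noteq> 0 \<and> ld R \<in> Reg 1 \<and> ld R \<in> Reg (-1) \<and>
     w = rC r1 / (rX - 1) + rC r2 / (rX + 1) + ld R"

lemma Reg_right_unique:
  assumes "w - rC s / (rX - 1) \<in> Reg 1" "w - rC t / (rX - 1) \<in> Reg 1"
  shows "s = t"
proof -
  have "rC (s - t) / (rX - rC 1) \<in> Reg 1"
    using Reg_diff[OF assms(2,1)] by (simp add: rC_diff diff_divide_distrib)
  then show ?thesis using Reg_simple_pole by fastforce
qed

lemma Reg_left_unique: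
  assumes "w - rC s / (rX + 1) \<in> Reg (-1)" "w - rC t / (rX + 1) \<in> Reg (-1)"
  shows "s = t"
proof -
  have "rC (s - t) / (rX - rC (-1)) \<in> Reg (-1)"
    using Reg_diff[OF assms(2,1)] by (simp add: rC_diff diff_divide_distrib rC_uminus)
  then show ?thesis using Reg_simple_pole by fastforce
qed

lemma quasi_Reg:
  assumes "quasi w r1 r2 R"
  shows "w - rC r1 / (rX - 1) \<in> Reg 1" "w - rC r2 / (rX + 1) \<in> Reg (-1)"
proof -
  have eq: "w - rC r1 / (rX - 1) = rC r2 / (rX + 1) + ld R"
    "w - rC r2 / (rX + 1) = rC r1 / (rX - 1) + ld R" and reg: "ld R \<in> Reg 1" "ld R \<in> Reg (-1)"
    using assms by (simp_all add: quasi_def)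
  show "w - rC r1 / (rX - 1) \<in> Reg 1"
    unfolding eq(1) by (rule Reg_add[OF inverse_rX_plus_1_Reg reg(1)])
  show "w - rC r2 / (rX + 1) \<in> Reg (-1)"
    unfolding eq(2) by (rule Reg_add[OF inverse_rX_minus_1_Reg reg(2)])
qed

lemma quasi_unique: "quasi w r1 r2 R \<Longrightarrow> quasi w r1' r2' R' \<Longrightarrow> r1 = r1' \<and> r2 = r2'"
  using quasi_Reg Reg_right_unique Reg_left_unique by metis

lemma quasi_asym_type:
  assumes "quasi w r1 r2 R"
  shows "asym_type w = (if r1 = 0 \<and> r2 = 0 then 1 else if r1 \<noteq> 0 \<and> r2 \<noteq> 0 then 2
     else if r1 \<noteq> 0 then 3 else 4)"
proof -
  have "w \<in> Reg 1 \<longleftrightarrow> r1 = 0"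
    using quasi_Reg(1)[OF assms] Reg_right_unique[of w r1 0] by auto
  moreover have "w \<in> Reg (-1) \<longleftrightarrow> r2 = 0"
    using quasi_Reg(2)[OF assms] Reg_left_unique[of w r2 0] by auto
  ultimately show ?thesis by (simp add: asym_type_def has_pole_iff)
qed

text \<open>The integer is the order of vanishing at \<open>x0\<close>. It measures by how much the
  true exponent of an eigenfunction exceeds the one fixed by its gauge.\<close>

lemma Reg_ld_order:
  assumes "f \<noteq> 0" "f \<in> Reg x0"
  shows "\<exists>n::nat. ld f - rC (of_nat n) / (rX - rC x0) \<in> Reg x0"
proof -
  obtain P Q where 1: "poly Q x0 \<noteq> 0" "Q \<noteq> 0" "f = to_fract P / to_fract Q"
    using assms(2) by (rule RegE)
  have P0: "P \<noteq> 0" using assms 1 by auto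
  obtain P1 where P1: "P = [:- x0, 1:] ^ order x0 P * P1" "\<not> [:- x0, 1:] dvd P1"
    using order_decomp[OF P0] by blast
  have X: "to_fract [:- x0, 1:] = rX - rC x0"
    by (simp add: rX_def rC_def flip: to_fract_diff)
  have X0: "rX - rC x0 \<noteq> 0" unfolding X[symmetric] by simp
  have P10: "P1 \<noteq> 0" using P0 P1 by auto
  have "to_fract P = (rX - rC x0) ^ order x0 P * to_fract P1"
    by (subst P1(1)) (simp add: X)
  then have "ld (to_fract P) = of_nat (order x0 P) * ld (rX - rC x0) + ld (to_fract P1)"
    using X0 P10 by (simp add: ld_mult ld_power)
  moreover have "ld (rX - rC x0) = 1 / (rX - rC x0)" by (simp add: ld_def)
  ultimately have "ld f - rC (of_nat (order x0 P)) / (rX - rC x0) = ld (to_fract P1) - ld (to_fract Q)"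
    using 1 P0 by (simp add: ld_divide rC_of_nat)
  moreover have "poly P1 x0 \<noteq> 0" using P1(2) by (simp add: poly_eq_0_iff_dvd)
  ultimately have "ld f - rC (of_nat (order x0 P)) / (rX - rC x0) \<in> Reg x0"
    using 1 by (simp add: Reg_diff Reg_ld_to_fract)
  then show ?thesis by blast
qed

subsection \<open>Existence of quasi-rational eigenfunctions\<close>

text \<open>\<open>f\<close> may vanish at 1 and -1, so the actual exponents may exceed
  \<open>s1\<close> and \<open>s2\<close> by natural numbers.\<close>

definition gauge_sol :: "real poly \<Rightarrow> real \<Rightarrow> real \<Rightarrow> real \<Rightarrow> real \<Rightarrow> real \<Rightarrow> bool" where
  "gauge_sol \<tau> a b l s1 s2 \<longleftrightarrow> (\<exists>f. f \<noteq> 0 \<and> f \<in> Reg 1 \<and> f \<in> Reg (-1) \<and>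
     RJ (Vpot \<tau>) a b (rC s1 / (rX - 1) + rC s2 / (rX + 1) + ld f) = rC l)"

lemma RJ_shift_right: "RJ r a b (rC (- a) / (rX - 1) + w) = RJ r (- a) b w - rC (a * (b + 1))"
  using RJ_gauge_right[of r a b w] by (simp add: rC_uminus)

lemma RJ_shift_left: "RJ r a b (rC (- b) / (rX + 1) + w) = RJ r a (- b) w - rC (b * (a + 1))"
  using RJ_gauge_left[of r a b w] by (simp add: rC_uminus)

text \<open>The gauges are \<open>1\<close>, \<open>(x - 1)^(-a)\<close>,
  \<open>(x + 1)^(-b)\<close> and the product of the last two. For the product the shifts add up to
  \<open>a (b + 1) + b (1 - a) = a + b\<close>, because the second reflection takes place after
  \<open>a\<close> has changed sign.\<close>

lemma gauge_sol_of_reg_eigenvalue: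
  "reg_eigenvalue \<tau> a b l \<Longrightarrow> gauge_sol \<tau> a b l 0 0"
  "reg_eigenvalue \<tau> (- a) b (l + a * (b + 1)) \<Longrightarrow> gauge_sol \<tau> a b l (- a) 0"
  "reg_eigenvalue \<tau> a (- b) (l + b * (a + 1)) \<Longrightarrow> gauge_sol \<tau> a b l 0 (- b)"
  "reg_eigenvalue \<tau> (- a) (- b) (l + a + b) \<Longrightarrow> gauge_sol \<tau> a b l (- a) (- b)"
proof -
  assume "reg_eigenvalue \<tau> a b l"
  then show "gauge_sol \<tau> a b l 0 0"
    unfolding reg_eigenvalue_def gauge_sol_def by (auto simp: LJ_eigen_iff)
next
  assume "reg_eigenvalue \<tau> (- a) b (l + a * (b + 1))"
  then obtain f where f: "f \<noteq> 0" "f \<in> Reg 1" "f \<in> Reg (-1)"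
      "RJ (Vpot \<tau>) (- a) b (ld f) = rC (l + a * (b + 1))"
    unfolding reg_eigenvalue_def by (auto simp: LJ_eigen_iff)
  then have "RJ (Vpot \<tau>) a b (rC (- a) / (rX - 1) + (rC 0 / (rX + 1) + ld f)) = rC l"
    unfolding RJ_shift_right by (simp add: rC_add)
  with f show "gauge_sol \<tau> a b l (- a) 0"
    unfolding gauge_sol_def by (auto simp: add.assoc)
next
  assume "reg_eigenvalue \<tau> a (- b) (l + b * (a + 1))"
  then obtain f where f: "f \<noteq> 0" "f \<in> Reg 1" "f \<in> Reg (-1)"
      "RJ (Vpot \<tau>) a (- b) (ld f) = rC (l + b * (a + 1))"
    unfolding reg_eigenvalue_def by (auto simp: LJ_eigen_iff)
  then have "RJ (Vpot \<tau>) a b (rC (- b) / (rX + 1) + ld f) = rC l"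
    unfolding RJ_shift_left by (simp add: rC_add)
  with f show "gauge_sol \<tau> a b l 0 (- b)"
    unfolding gauge_sol_def by auto
next
  assume "reg_eigenvalue \<tau> (- a) (- b) (l + a + b)"
  then obtain f where f: "f \<noteq> 0" "f \<in> Reg 1" "f \<in> Reg (-1)"
      "RJ (Vpot \<tau>) (- a) (- b) (ld f) = rC (l + a + b)"
    unfolding reg_eigenvalue_def by (auto simp: LJ_eigen_iff)
  have "RJ (Vpot \<tau>) a b (rC (- a) / (rX - 1) + (rC (- b) / (rX + 1) + ld f)) =
     rC (l + a + b - b * (- a + 1) - a * (b + 1))"
    unfolding RJ_shift_right RJ_shift_left f(4) by (simp only: rC_diff)
  also have "l + a + b - b * (- a + 1) - a * (b + 1) = l" by (simp add: algebra_simps)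
  finally show "gauge_sol \<tau> a b l (- a) (- b)"
    unfolding gauge_sol_def using f by (auto simp: add.assoc)
qed

definition ev :: "real \<Rightarrow> real \<Rightarrow> real \<Rightarrow> real" where
  "ev a b s = s * (s + a + b + 1)"

lemma ev_square: "ev a b s = (s + (a + b + 1) / 2) ^ 2 - ((a + b + 1) / 2) ^ 2"
  by (simp add: ev_def power2_eq_square field_simps)

text \<open>The reflection of \<open>s\<close> to \<open>- a - b - 1 - s\<close> leaves
  \<open>ev a b\<close> unchanged, so the four gauges form two pairs; the gauges of a pair run
  through one sequence of eigenvalues in opposite directions.\<close>

lemma ev_eq_eJ:
  "ev a b (0 + 0 + of_int n) = eJ a b n"
  "ev a b (- a + - b + of_int n) = eJ a b (- 1 - n)"
  "ev a b (- a + 0 + of_int n) = eJ (- a) b n - a * (b + 1)"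
  "ev a b (0 + - b + of_int n) = eJ (- a) b (- 1 - n) - a * (b + 1)"
  by (simp_all add: ev_def eJ_def algebra_simps)

text \<open>The eigenvalue theorem is applied to \<open>(a, b)\<close> and to
  \<open>(- a, b)\<close>; each application also covers the doubly reflected parameters, which
  yields all four gauges. For large \<open>n\<close> the gauge is prescribed, as the labels require;
  for every \<open>n\<close> some gauge yields a solution, which suffices for the spectrum.\<close>

lemma gauge_solutions:
  assumes "admissible \<tau> a b"
  shows "\<exists>K::int. \<forall>s1\<in>{0, - a}. \<forall>s2\<in>{0, - b}. \<forall>n.
     (K \<le> n \<longrightarrow> gauge_sol \<tau> a b (ev a b (s1 + s2 + of_int n)) s1 s2) \<and>
     (\<exists>t1 t2. gauge_sol \<tau> a b (ev a b (s1 + s2 + of_int n)) t1 t2)"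
proof -
  obtain K1 where K1: "\<And>i. K1 \<le> i \<Longrightarrow> reg_eigenvalue \<tau> a b (eJ a b i)"
    "\<And>i. i \<le> - K1 \<Longrightarrow> reg_eigenvalue \<tau> (- a) (- b) (eJ a b i + a + b)"
    "\<And>i. reg_eigenvalue \<tau> a b (eJ a b i) \<or> reg_eigenvalue \<tau> (- a) (- b) (eJ a b i + a + b)"
    using admissible_eigenvalues[OF assms] by blast
  define l where "l i = eJ (- a) b i - a * (b + 1)" for i
  have l: "eJ (- a) b i = l i + a * (b + 1)" "eJ (- a) b i + - a + b = l i + b * (a + 1)" for i
    by (simp_all add: l_def algebra_simps)
  obtain K2 where K2': "\<And>i. K2 \<le> i \<Longrightarrow> reg_eigenvalue \<tau> (- a) b (eJ (- a) b i)"
    "\<And>i. i \<le> - K2 \<Longrightarrow> reg_eigenvalue \<tau> (- (- a)) (- b) (eJ (- a) b i + - a + b)"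
    "\<And>i. reg_eigenvalue \<tau> (- a) b (eJ (- a) b i) \<or>
       reg_eigenvalue \<tau> (- (- a)) (- b) (eJ (- a) b i + - a + b)"
    using admissible_eigenvalues[OF admissible_reflect[OF assms]] by blast
  have K2: "K2 \<le> i \<Longrightarrow> reg_eigenvalue \<tau> (- a) b (l i + a * (b + 1))"
    "i \<le> - K2 \<Longrightarrow> reg_eigenvalue \<tau> a (- b) (l i + b * (a + 1))"
    "reg_eigenvalue \<tau> (- a) b (l i + a * (b + 1)) \<or> reg_eigenvalue \<tau> a (- b) (l i + b * (a + 1))" for i
    using K2'[of i] unfolding l(2) unfolding l(1) minus_minus by blast+
  \<comment> \<open>Two of the gauges meet their sequence at index \<open>-1 - n\<close>, so
    \<open>K\<close> has to control indices on both sides.\<close>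
  define K where "K = max \<bar>K1\<bar> \<bar>K2\<bar>"
  have K: "K1 \<le> n" "K2 \<le> n" "- 1 - n \<le> - K1" "- 1 - n \<le> - K2" if "K \<le> n" for n
    using that by (auto simp: K_def)
  show ?thesis
  proof (rule exI[of _ K], intro ballI allI conjI impI)
    fix s1 s2 n assume s: "s1 \<in> {0, - a}" "s2 \<in> {0, - b}"
    then consider "s1 = 0 \<and> s2 = 0" | "s1 = - a \<and> s2 = 0" | "s1 = 0 \<and> s2 = - b"
      | "s1 = - a \<and> s2 = - b" by blast
    then have "(K \<le> n \<longrightarrow> gauge_sol \<tau> a b (ev a b (s1 + s2 + of_int n)) s1 s2) \<and>
      (\<exists>t1 t2. gauge_sol \<tau> a b (ev a b (s1 + s2 + of_int n)) t1 t2)"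
    proof cases
      case 1
      have "ev a b (s1 + s2 + of_int n) = eJ a b n"
        using ev_eq_eJ(1)[of a b n] 1 by (simp add: l_def)
      then show ?thesis
        using K1(1)[of "n"] K1(3)[of "n"] K[of n] 1
          gauge_sol_of_reg_eigenvalue(1)[of \<tau> a b "eJ a b n"]
          gauge_sol_of_reg_eigenvalue(4)[of \<tau> a b "eJ a b n"]
        by auto
    next
      case 2
      have "ev a b (s1 + s2 + of_int n) = l n"
        using ev_eq_eJ(3)[of a b n] 2 by (simp add: l_def)
      then show ?thesis
        using K2(1)[of "n"] K2(3)[of "n"] K[of n] 2
          gauge_sol_of_reg_eigenvalue(2)[of \<tau> a b "l n"]
          gauge_sol_of_reg_eigenvalue(3)[of \<tau> a b "l n"]
        by auto
    next
      case 3
      have "ev a b (s1 + s2 + of_int n) = l (- 1 - n)"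
        using ev_eq_eJ(4)[of a b n] 3 by (simp add: l_def)
      then show ?thesis
        using K2(2)[of "- 1 - n"] K2(3)[of "- 1 - n"] K[of n] 3
          gauge_sol_of_reg_eigenvalue(2)[of \<tau> a b "l (- 1 - n)"]
          gauge_sol_of_reg_eigenvalue(3)[of \<tau> a b "l (- 1 - n)"]
        by auto
    next
      case 4
      have "ev a b (s1 + s2 + of_int n) = eJ a b (- 1 - n)"
        using ev_eq_eJ(2)[of a b n] 4 by (simp add: l_def)
      then show ?thesis
        using K1(2)[of "- 1 - n"] K1(3)[of "- 1 - n"] K[of n] 4
          gauge_sol_of_reg_eigenvalue(1)[of \<tau> a b "eJ a b (- 1 - n)"]
          gauge_sol_of_reg_eigenvalue(4)[of \<tau> a b "eJ a b (- 1 - n)"]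
        by auto
    qed
    then show "K \<le> n \<Longrightarrow> gauge_sol \<tau> a b (ev a b (s1 + s2 + of_int n)) s1 s2"
      "\<exists>t1 t2. gauge_sol \<tau> a b (ev a b (s1 + s2 + of_int n)) t1 t2" by blast+
  qed
qed

subsection \<open>The spectral diagram\<close>

lemma Ric_T_rg: "Ric (T_rg \<tau> a b) l = {w. RJ (Vpot \<tau>) a b w = rC l}"
  by (simp add: Ric_def T_rg_def RJ_def Vpot_def Let_def eta_mult)

lemma T_rg_1: "T_rg 1 a b = jacobi_op a b"
  by (simp add: T_rg_def jacobi_op_def logder_def)

text \<open>The possible exponents at infinity; \<open>\<tau>\<close> does not enter, hence it does
  not enter the spectrum either.\<close>

definition exponents :: "real \<Rightarrow> real \<Rightarrow> real set" where
  "exponents a b = {s1 + s2 + of_int n |s1 s2 n. s1 \<in> {0, - a} \<and> s2 \<in> {0, - b}}"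

lemma solution_structure:
  assumes "admissible \<tau> a b"
  shows "\<exists>C. \<forall>l w. RJ (Vpot \<tau>) a b w = rC l \<longrightarrow>
    (\<exists>r1 r2 R. quasi w r1 r2 R \<and> r1 \<in> {0, - a} \<and> r2 \<in> {0, - b} \<and>
       l = ev a b (r1 + r2 + of_int (fdeg R)) \<and> r1 + r2 + of_int (fdeg R) \<ge> - C)"
proof -
  have pm: "poly \<tau> 1 \<noteq> 0" "poly \<tau> (-1) \<noteq> 0" using assms by (auto simp: admissible_def)
  obtain K :: int where "gauge_sol \<tau> a b (ev a b (0 + 0 + of_int K)) 0 0"
    using gauge_solutions[OF assms] by blast
  then obtain f where "f \<noteq> 0" "RJ (Vpot \<tau>) a b (ld f) = rC (ev a b (0 + 0 + of_int K))"
    by (auto simp: gauge_sol_def)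
  from rational_solution_structure[OF pm this]
  obtain C where C: "\<And>l w. RJ (Vpot \<tau>) a b w = rC l \<Longrightarrow> \<exists>r1 r2 R. R \<noteq> 0 \<and> ld R \<in> Reg 1 \<and> ld R \<in> Reg (-1) \<and>
       w = rC r1 / (rX - 1) + rC r2 / (rX + 1) + ld R \<and> r1 + r2 + of_int (fdeg R) \<ge> - C"
    by blast
  show ?thesis
  proof (rule exI[of _ C], intro allI impI)
    fix l w assume w: "RJ (Vpot \<tau>) a b w = rC l"
    then obtain r1 r2 R where R: "quasi w r1 r2 R" "r1 + r2 + of_int (fdeg R) \<ge> - C"
      using C[OF w] by (auto simp: quasi_def)
    have "RJ (Vpot \<tau>) a b (rC r1 / (rX - 1) + (w - rC r1 / (rX - 1))) = rC l" using w by simp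
    from indicial_right[OF quasi_Reg(1)[OF R(1)] Vpot_Reg[OF pm(1)] this]
    have r1: "r1 \<in> {0, - a}" by simp
    have "RJ (Vpot \<tau>) a b (rC r2 / (rX + 1) + (w - rC r2 / (rX + 1))) = rC l" using w by simp
    from indicial_left[OF quasi_Reg(2)[OF R(1)] Vpot_Reg[OF pm(2)] this]
    have r2: "r2 \<in> {0, - b}" by simp
    have "w - rC (r1 + r2 + of_int (fdeg R)) / rX \<in> Oinf (-2)"
      using lds_asymptotics R(1) by (auto simp: quasi_def)
    from RJ_exponent[OF Vpot_Oinf this w] have "l = ev a b (r1 + r2 + of_int (fdeg R))"
      by (simp add: ev_def)
    with R r1 r2 show "\<exists>r1 r2 R. quasi w r1 r2 R \<and> r1 \<in> {0, - a} \<and> r2 \<in> {0, - b} \<and>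
       l = ev a b (r1 + r2 + of_int (fdeg R)) \<and> r1 + r2 + of_int (fdeg R) \<ge> - C" by blast
  qed
qed

theorem sigma_qr_admissible:
  assumes "admissible \<tau> a b"
  shows "sigma_qr (T_rg \<tau> a b) = ev a b ` exponents a b"
proof (intro equalityI subsetI)
  fix l assume "l \<in> sigma_qr (T_rg \<tau> a b)"
  then obtain w where "RJ (Vpot \<tau>) a b w = rC l" by (auto simp: sigma_qr_def Ric_T_rg)
  then show "l \<in> ev a b ` exponents a b"
    using solution_structure[OF assms] unfolding exponents_def by blast
next
  fix l assume "l \<in> ev a b ` exponents a b"
  then obtain s1 s2 n where "l = ev a b (s1 + s2 + of_int n)" "s1 \<in> {0, - a}" "s2 \<in> {0, - b}"
    by (auto simp: exponents_def)
  then have "\<exists>t1 t2. gauge_sol \<tau> a b l t1 t2"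
    using gauge_solutions[OF assms] by blast
  then show "l \<in> sigma_qr (T_rg \<tau> a b)"
    by (auto simp: gauge_sol_def sigma_qr_def Ric_T_rg)
qed

text \<open>If all solutions share the exponent \<open>s\<close> at infinity, two of them cannot differ by the
  logarithmic derivative of a rational function \<open>Q\<close>: normalising \<open>Q\<close> to a finite limit \<open>c\<close>
  at infinity, \<open>Q - c\<close> would produce a solution with a smaller exponent.\<close>

lemma solutions_not_commensurable:
  assumes eq: "RJ r a b w1 = rC l" "RJ r a b w2 = rC l"
    and exponent: "\<And>w. RJ r a b w = rC l \<Longrightarrow> w - rC s / rX \<in> Oinf (-2)"
    and Q: "Q \<noteq> 0" "w2 - w1 = ld Q"
  shows "w1 = w2"
proof (rule ccontr)
  assume ne: "w1 \<noteq> w2"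
  have "w2 - w1 \<in> Oinf (-2)"
    using Oinf_diff[OF exponent[OF eq(2)] exponent[OF eq(1)]] by simp
  then have "ld Q - rC 0 / rX \<in> Oinf (-2)" using Q by simp
  then have "fdeg Q = 0" using leading_coeff_unique[OF ld_asymptotics[OF Q(1)]] by fastforce
  then obtain c where c: "Q - rC c * 1 \<in> Oinf (-1)"
    using leading_term[OF Q(1), of 1] by auto
  define Y where "Y = Q - rC c"
  have Y: "Y \<in> Oinf (-1)" using c by (simp add: Y_def)
  have Y0: "Y \<noteq> 0"
  proof
    assume "Y = 0"
    then have "Q = rC c" by (simp add: Y_def)
    then have "ld Q = 0" by (simp add: ld_def)
    with Q ne show False by simp
  qed
  \<comment> \<open>Multiplying an eigenfunction by \<open>Z\<close> adds only terms in derivatives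
    of \<open>Z\<close>, so \<open>Q\<close> and \<open>Q - c\<close> produce the same extra
    terms.\<close>
  have var: "RJ r a b (w1 + ld Z) * Z = RJ r a b w1 * Z +
      ((rX ^ 2 - 1) * (2 * w1 * rderiv Z + rderiv (rderiv Z)) + qJ a b * rderiv Z)" if "Z \<noteq> 0" for Z
    unfolding RJ_def rderiv2_eq_ld[OF that] rderiv_add unfolding rderiv_eq_ld[OF that]
    by (simp add: algebra_simps power2_eq_square)
  have "w1 + ld Q = w2" using Q by simp
  then have "(rX ^ 2 - 1) * (2 * w1 * rderiv Q + rderiv (rderiv Q)) + qJ a b * rderiv Q = 0"
    using var[OF Q(1)] eq by simp
  then have "RJ r a b (w1 + ld Y) * Y = RJ r a b w1 * Y"
    using var[OF Y0] by (simp add: Y_def)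
  then have "RJ r a b (w1 + ld Y) = rC l" using Y0 eq by simp
  then have "w1 + ld Y - rC s / rX \<in> Oinf (-2)" by (rule exponent)
  then have "w1 + ld Y - rC s / rX - (w1 - rC s / rX) \<in> Oinf (-2)"
    using exponent[OF eq(1)] by (rule Oinf_diff)
  then have "ld Y - rC 0 / rX \<in> Oinf (-2)" by simp
  then have "fdeg Y = 0" using leading_coeff_unique[OF ld_asymptotics[OF Y0]] by fastforce
  then show False using Y Y0 by (simp add: Oinf_def)
qed

text \<open>The pairs of exponents at \<open>x = 1\<close> and \<open>x = -1\<close> of the quasi-rational eigenfunctions that
  grow like \<open>x^s\<close>, for large \<open>s\<close>. When an exponent difference is an integer, only the larger
  exponent occurs.\<close>

definition exponent_pairs :: "real \<Rightarrow> real \<Rightarrow> real \<Rightarrow> (real \<times> real) set" where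
  "exponent_pairs a b s = {(r1, r2). r1 \<in> {0, - a} \<and> r2 \<in> {0, - b} \<and>
     (a \<in> \<int> \<longrightarrow> r1 = max 0 (- a)) \<and> (b \<in> \<int> \<longrightarrow> r2 = max 0 (- b)) \<and> s - r1 - r2 \<in> \<int>}"

definition pair_type :: "real \<times> real \<Rightarrow> nat" where
  "pair_type = (\<lambda>(r1, r2). if r1 = 0 \<and> r2 = 0 then 1 else if r1 \<noteq> 0 \<and> r2 \<noteq> 0 then 2
     else if r1 \<noteq> 0 then 3 else 4)"

text \<open>Used to see that the regular factor of an eigenfunction does not vanish at 1 or -1: two
  exponents differing by a nonzero integer force \<open>a\<close> to be an integer, and then
  \<open>r\<close> was already the larger one.\<close>

lemma shifted_exponent:
  assumes "r \<in> {0, - a}" "r' \<in> {0, - a}" "r' = r + of_nat n" "a \<in> \<int> \<longrightarrow> r = max 0 (- a)"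
  shows "r' = (r :: real)"
proof (cases "a \<in> \<int>")
  case True
  then show ?thesis using assms by (auto simp: max_def split: if_splits)
next
  case False
  have "a = of_nat n \<or> a = - of_nat n" if "r' \<noteq> r" using assms that by auto
  moreover have "(of_nat n :: real) \<in> \<int>" "- (of_nat n :: real) \<in> \<int>" by auto
  ultimately show ?thesis using False by metis
qed

text \<open>For the eigenvalue \<open>\<kappa>^2 - \<rho>^2\<close> the exponents at infinity are
  \<open>\<kappa> - \<rho>\<close> and \<open>- \<kappa> - \<rho>\<close>; the uniform lower bound
  discards the second for large \<open>\<kappa>\<close>. The solutions are then in bijection with
  the pairs of exponents at 1 and -1, which do not involve \<open>\<tau>\<close>.\<close>

lemma label_large_eigenvalue:
  assumes "admissible \<tau> a b"
  defines "\<rho> \<equiv> (a + b + 1) / 2"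
  shows "\<exists>K0. \<forall>\<kappa>>K0. label (T_rg \<tau> a b) (\<kappa> ^ 2 - \<rho> ^ 2) =
     (enat (card (exponent_pairs a b (\<kappa> - \<rho>))), pair_type ` exponent_pairs a b (\<kappa> - \<rho>))"
proof -
  obtain C where C: "\<And>l w. RJ (Vpot \<tau>) a b w = rC l \<Longrightarrow>
      \<exists>r1 r2 R. quasi w r1 r2 R \<and> r1 \<in> {0, - a} \<and> r2 \<in> {0, - b} \<and>
       l = ev a b (r1 + r2 + of_int (fdeg R)) \<and> r1 + r2 + of_int (fdeg R) \<ge> - C"
    using solution_structure[OF assms(1)] by blast
  obtain K :: int where K: "\<And>s1 s2 n. s1 \<in> {0, - a} \<Longrightarrow> s2 \<in> {0, - b} \<Longrightarrow> K \<le> n \<Longrightarrow>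
      gauge_sol \<tau> a b (ev a b (s1 + s2 + of_int n)) s1 s2"
    using gauge_solutions[OF assms(1)] by blast
  \<comment> \<open>The first entry excludes \<open>- \<kappa> - \<rho> \<ge> - C\<close>; the
    second makes \<open>n = \<kappa> - \<rho> - r1 - r2\<close> at least \<open>K\<close>.\<close>
  define K0 where "K0 = max (C - \<rho>) (of_int K + \<rho> + \<bar>a\<bar> + \<bar>b\<bar>)"
  have ev_sq: "ev a b s = (s + \<rho>) ^ 2 - \<rho> ^ 2" for s
    unfolding \<rho>_def by (rule ev_square)
  show ?thesis
  proof (rule exI[of _ K0], intro allI impI)
    fix \<kappa> assume \<kappa>: "\<kappa> > K0"
    define l where "l = \<kappa> ^ 2 - \<rho> ^ 2"
    define s where "s = \<kappa> - \<rho>"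
    define Sol where "Sol = {w. RJ (Vpot \<tau>) a b w = rC l}"
    define A where "A = exponent_pairs a b s"
    have l_ev: "l = ev a b s" by (simp add: l_def s_def ev_sq)
    have struct: "\<exists>r1 r2 R. quasi w r1 r2 R \<and> r1 \<in> {0, - a} \<and> r2 \<in> {0, - b} \<and> r1 + r2 + of_int (fdeg R) = s"
      if w: "w \<in> Sol" for w
    proof -
      obtain r1 r2 R where R: "quasi w r1 r2 R" "r1 \<in> {0, - a}" "r2 \<in> {0, - b}"
        "l = ev a b (r1 + r2 + of_int (fdeg R))" "r1 + r2 + of_int (fdeg R) \<ge> - C"
        using C[of w l] w by (auto simp: Sol_def)
      define t where "t = r1 + r2 + of_int (fdeg R)"
      have "(t + \<rho>) ^ 2 = \<kappa> ^ 2" using R(4) by (simp add: ev_sq l_def t_def)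
      then have "t + \<rho> = \<kappa> \<or> t + \<rho> = - \<kappa>" by (simp add: power2_eq_iff)
      moreover have "t + \<rho> \<ge> - C + \<rho>" using R(5) by (simp add: t_def)
      ultimately have "t = s" using \<kappa> by (auto simp: K0_def s_def)
      with R show ?thesis unfolding t_def by blast
    qed
    have exponent: "w - rC s / rX \<in> Oinf (-2)" if w: "w \<in> Sol" for w
    proof -
      obtain r1 r2 R where "quasi w r1 r2 R" "r1 + r2 + of_int (fdeg R) = s"
        using struct[OF w] by blast
      then show ?thesis using lds_asymptotics[of R r1 r2] by (auto simp: quasi_def)
    qed
    have unique: "w = w'" if w: "w \<in> Sol" "w' \<in> Sol" "quasi w r1 r2 R" "quasi w' r1' r2' R'"
      "r1' - r1 \<in> \<int>" "r2' - r2 \<in> \<int>" for w w' r1 r2 R r1' r2' R'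
    proof -
      obtain k1 k2 where k: "r1' - r1 = of_int k1" "r2' - r2 = of_int k2"
        using w(5,6) by (auto elim!: Ints_cases)
      \<comment> \<open>The quotient of the two eigenfunctions, rational because their exponents
        differ by integers.\<close>
      define Q where "Q = to_fract X1 powi k1 * to_fract X2 powi k2 * (R' / R)"
      have X: "to_fract X1 \<noteq> (0 :: rfun)" "to_fract X2 \<noteq> (0 :: rfun)" by simp_all
      have R: "R \<noteq> 0" "R' \<noteq> 0" using w by (auto simp: quasi_def)
      have pX: "to_fract X1 powi k1 \<noteq> (0 :: rfun)" "to_fract X2 powi k2 \<noteq> (0 :: rfun)"
        using X by (simp_all add: power_int_eq_0_iff)
      have "ld Q = rC (of_int k1) * ld (to_fract X1) + rC (of_int k2) * ld (to_fract X2) + (ld R' - ld R)"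
        unfolding Q_def using pX R X by (simp add: ld_mult ld_divide ld_power_int)
      also have "\<dots> = w' - w"
        using w(3,4) unfolding quasi_def ld_X1 ld_X2 k[symmetric]
        by (simp add: rC_diff diff_divide_distrib)
      finally have "w' - w = ld Q" ..
      moreover have "Q \<noteq> 0" unfolding Q_def using pX R by simp
      ultimately show "w = w'"
        using solutions_not_commensurable[of "Vpot \<tau>" a b w l w' s Q] exponent w(1,2)
        by (simp add: Sol_def)
    qed
    have ex: "\<exists>w\<in>Sol. \<exists>R. quasi w r1 r2 R" if r: "(r1, r2) \<in> A" for r1 r2
    proof -
      have r12: "r1 \<in> {0, - a}" "r2 \<in> {0, - b}" "a \<in> \<int> \<longrightarrow> r1 = max 0 (- a)"
        "b \<in> \<int> \<longrightarrow> r2 = max 0 (- b)" and "s - r1 - r2 \<in> \<int>"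
        using r by (auto simp: A_def exponent_pairs_def)
      then obtain n where n: "s - r1 - r2 = of_int n" by (auto elim!: Ints_cases)
      then have s: "s = r1 + r2 + of_int n" by simp
      have "of_int n \<ge> (of_int K :: real)"
        using n r12(1,2) \<kappa> by (auto simp: s_def K0_def)
      then have "gauge_sol \<tau> a b l r1 r2"
        unfolding l_ev s using r12 by (intro K) auto
      then obtain f where f: "f \<noteq> 0" "f \<in> Reg 1" "f \<in> Reg (-1)"
        "RJ (Vpot \<tau>) a b (rC r1 / (rX - 1) + rC r2 / (rX + 1) + ld f) = rC l"
        by (auto simp: gauge_sol_def)
      define w where "w = rC r1 / (rX - 1) + rC r2 / (rX + 1) + ld f"
      have w: "w \<in> Sol" using f by (simp add: w_def Sol_def)
      obtain r1' r2' R where R: "quasi w r1' r2' R" "r1' \<in> {0, - a}" "r2' \<in> {0, - b}"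
        using struct[OF w] by blast
      obtain n1 :: nat where n1: "ld f - rC (of_nat n1) / (rX - rC 1) \<in> Reg 1"
        using Reg_ld_order[OF f(1,2)] by blast
      have "w - rC (r1 + of_nat n1) / (rX - 1)
          = rC r2 / (rX + 1) + (ld f - rC (of_nat n1) / (rX - rC 1))"
        by (simp add: w_def rC_add add_divide_distrib)
      then have "w - rC (r1 + of_nat n1) / (rX - 1) \<in> Reg 1"
        using n1 by (simp only: Reg_add inverse_rX_plus_1_Reg)
      then have r1': "r1' = r1 + of_nat n1"
        using Reg_right_unique quasi_Reg(1)[OF R(1)] by blast
      obtain n2 :: nat where n2: "ld f - rC (of_nat n2) / (rX - rC (-1)) \<in> Reg (-1)"
        using Reg_ld_order[OF f(1,3)] by blast
      have "w - rC (r2 + of_nat n2) / (rX + 1)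
          = rC r1 / (rX - 1) + (ld f - rC (of_nat n2) / (rX - rC (-1)))"
        by (simp add: w_def rC_add rC_uminus add_divide_distrib)
      then have "w - rC (r2 + of_nat n2) / (rX + 1) \<in> Reg (-1)"
        using n2 by (simp only: Reg_add inverse_rX_minus_1_Reg)
      then have r2': "r2' = r2 + of_nat n2"
        using Reg_left_unique quasi_Reg(2)[OF R(1)] by blast
      have "r1' = r1" using r12(1) R(2) r1' r12(3) by (rule shifted_exponent)
      moreover have "r2' = r2" using r12(2) R(3) r2' r12(4) by (rule shifted_exponent)
      ultimately show ?thesis using R(1) w by blast
    qed
    have mem: "\<exists>r1 r2 R. quasi w r1 r2 R \<and> (r1, r2) \<in> A" if w: "w \<in> Sol" for w
    proof -
      obtain r1 r2 R where R: "quasi w r1 r2 R" "r1 \<in> {0, - a}" "r2 \<in> {0, - b}"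
        "r1 + r2 + of_int (fdeg R) = s"
        using struct[OF w] by blast
      \<comment> \<open>For an integer parameter the exponent of \<open>w\<close> is replaced by the
        larger one. The solution that exists for the new pair has integer exponent differences to
        \<open>w\<close>, hence equals \<open>w\<close>.\<close>
      define q1 where "q1 = (if a \<in> \<int> then max 0 (- a) else r1)"
      define q2 where "q2 = (if b \<in> \<int> then max 0 (- b) else r2)"
      have q1: "q1 - r1 \<in> \<int>" using R(2) by (auto simp: q1_def max_def)
      have q2: "q2 - r2 \<in> \<int>" using R(3) by (auto simp: q2_def max_def)
      have "s - q1 - q2 = of_int (fdeg R) - (q1 - r1) - (q2 - r2)" using R(4) by simp
      then have "s - q1 - q2 \<in> \<int>" using q1 q2 by (simp only: Ints_diff Ints_of_int)
      then have qA: "(q1, q2) \<in> A"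
        using R(2,3) by (auto simp: A_def exponent_pairs_def q1_def q2_def max_def)
      then obtain w' R' where w': "w' \<in> Sol" "quasi w' q1 q2 R'" using ex by blast
      then have "w = w'" using unique[OF w w'(1) R(1) w'(2) q1 q2] by simp
      with w' qA show ?thesis by blast
    qed
    define \<phi> where "\<phi> p = (SOME w. w \<in> Sol \<and> (\<exists>R. quasi w (fst p) (snd p) R))" for p
    have \<phi>: "\<phi> p \<in> Sol \<and> (\<exists>R. quasi (\<phi> p) (fst p) (snd p) R)" if "p \<in> A" for p
      unfolding \<phi>_def by (rule someI_ex) (use ex[of "fst p" "snd p"] that in auto)
    have bij: "bij_betw \<phi> A Sol"
      unfolding bij_betw_def
    proof
      show "inj_on \<phi> A"
        using \<phi> quasi_unique by (intro inj_onI prod_eqI) metis+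
      show "\<phi> ` A = Sol"
      proof (intro equalityI subsetI)
        fix w assume w: "w \<in> Sol"
        then obtain r1 r2 R where R: "quasi w r1 r2 R" "(r1, r2) \<in> A" using mem by blast
        obtain R' where "\<phi> (r1, r2) \<in> Sol" "quasi (\<phi> (r1, r2)) r1 r2 R'" using \<phi>[OF R(2)] by auto
        then have "\<phi> (r1, r2) = w" using unique[OF _ w _ R(1)] by simp
        with R(2) show "w \<in> \<phi> ` A" by blast
      qed (use \<phi> in blast)
    qed
    have finA: "finite A"
    proof (rule finite_subset)
      show "A \<subseteq> {0, - a} \<times> {0, - b}" by (auto simp: A_def exponent_pairs_def)
    qed simp
    have Ric: "Ric (T_rg \<tau> a b) l = Sol" by (simp add: Ric_T_rg Sol_def)
    have "set_card Sol = enat (card A)"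
      using bij finA bij_betw_finite[OF bij] bij_betw_same_card[OF bij] by (simp add: set_card_def)
    moreover have "asym_type ` Sol = pair_type ` A"
    proof -
      have "asym_type ` Sol = (\<lambda>p. asym_type (\<phi> p)) ` A"
        using bij_betw_imp_surj_on[OF bij] by (metis image_image)
      also have "\<dots> = pair_type ` A"
        using \<phi> quasi_asym_type by (intro image_cong) (fastforce simp: pair_type_def split_beta)+
      finally show ?thesis .
    qed
    ultimately show "label (T_rg \<tau> a b) (\<kappa> ^ 2 - \<rho> ^ 2) =
     (enat (card (exponent_pairs a b (\<kappa> - \<rho>))), pair_type ` exponent_pairs a b (\<kappa> - \<rho>))"
      by (simp add: label_def Ric A_def s_def flip: l_def)
  qed
qed

text \<open>\<open>ev\<close> is a square minus a constant, and the exponents form finitely many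
  translates of the integers.\<close>

lemma finite_small_eigenvalues:
  "finite {l \<in> ev a b ` exponents a b. l \<le> B}"
proof -
  define \<rho> where "\<rho> = (a + b + 1) / 2"
  \<comment> \<open>The summand 1 gives \<open>M \<ge> 1\<close>, so that \<open>t^2 \<le> M\<close>
    implies \<open>t \<le> M\<close>.\<close>
  define M where "M = \<bar>B\<bar> + \<rho> ^ 2 + 1"
  have fin: "finite {n::int. \<bar>of_int n + c\<bar> \<le> M}" for c :: real
  proof (rule finite_subset)
    show "{n::int. \<bar>of_int n + c\<bar> \<le> M} \<subseteq> {\<lfloor>- M - c\<rfloor>..\<lceil>M - c\<rceil>}"
      by (auto simp: floor_le_iff le_ceiling_iff abs_le_iff)
  qed simp
  have "{l \<in> ev a b ` exponents a b. l \<le> B} \<subseteq>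
     (\<Union>s1\<in>{0, - a}. \<Union>s2\<in>{0, - b}. (\<lambda>n. ev a b (s1 + s2 + of_int n)) ` {n. \<bar>of_int n + (s1 + s2 + \<rho>)\<bar> \<le> M})"
  proof
    fix l assume "l \<in> {l \<in> ev a b ` exponents a b. l \<le> B}"
    then obtain s1 s2 n where n: "l = ev a b (s1 + s2 + of_int n)" "s1 \<in> {0, - a}" "s2 \<in> {0, - b}" "l \<le> B"
      by (auto simp: exponents_def)
    define t where "t = \<bar>of_int n + (s1 + s2 + \<rho>)\<bar>"
    have "t ^ 2 = (s1 + s2 + of_int n + \<rho>) ^ 2"
      unfolding t_def power2_abs by (simp add: algebra_simps)
    then have "l = t ^ 2 - \<rho> ^ 2"
      by (simp only: n(1) ev_square \<rho>_def)
    then have "t ^ 2 \<le> M" using n(4) by (simp add: M_def)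
    moreover have "M \<le> M ^ 2"
      using mult_right_mono[of 1 M M] by (simp add: M_def power2_eq_square)
    ultimately have "t ^ 2 \<le> M ^ 2" by linarith
    then have "t \<le> M" by (rule power2_le_imp_le) (simp add: M_def)
    then show "l \<in> (\<Union>s1\<in>{0, - a}. \<Union>s2\<in>{0, - b}.
        (\<lambda>n. ev a b (s1 + s2 + of_int n)) ` {n. \<bar>of_int n + (s1 + s2 + \<rho>)\<bar> \<le> M})"
      using n unfolding t_def by blast
  qed
  then show ?thesis by (rule finite_subset) (intro finite_UN_I finite_imageI fin; simp)
qed

theorem mainTheorem4:
  fixes \<tau> :: "real poly" and \<alpha> \<beta> :: real
  assumes "exceptional_jacobi \<tau> \<alpha> \<beta>"
  shows "\<exists>a b c :: real.
           sigma_qr (T_rg \<tau> \<alpha> \<beta>) = (\<lambda>l. l + c) ` sigma_qr (jacobi_op a b) \<and>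
           finite {l \<in> sigma_qr (jacobi_op a b).
                     label (T_rg \<tau> \<alpha> \<beta>) (l + c) \<noteq> label (jacobi_op a b) l}"
proof -
  define \<rho> where "\<rho> = (\<alpha> + \<beta> + 1) / 2"
  note adm = exceptional_imp_admissible[OF assms] admissible_1[of \<alpha> \<beta>]
  note sigma = sigma_qr_admissible[OF adm(1)] sigma_qr_admissible[OF adm(2), unfolded T_rg_1]
  obtain K1 where K1: "\<And>\<kappa>. \<kappa> > K1 \<Longrightarrow> label (T_rg \<tau> \<alpha> \<beta>) (\<kappa> ^ 2 - \<rho> ^ 2) =
     (enat (card (exponent_pairs \<alpha> \<beta> (\<kappa> - \<rho>))), pair_type ` exponent_pairs \<alpha> \<beta> (\<kappa> - \<rho>))"
    using label_large_eigenvalue[OF adm(1)] unfolding \<rho>_def by blast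
  obtain K2 where K2: "\<And>\<kappa>. \<kappa> > K2 \<Longrightarrow> label (jacobi_op \<alpha> \<beta>) (\<kappa> ^ 2 - \<rho> ^ 2) =
     (enat (card (exponent_pairs \<alpha> \<beta> (\<kappa> - \<rho>))), pair_type ` exponent_pairs \<alpha> \<beta> (\<kappa> - \<rho>))"
    using label_large_eigenvalue[OF adm(2), unfolded T_rg_1] unfolding \<rho>_def by blast
  \<comment> \<open>For \<open>l > M^2\<close> the number
    \<open>\<kappa> = sqrt (l + \<rho>^2)\<close> exceeds both thresholds, so every label change
    happens at or below \<open>M^2\<close>, where only finitely many eigenvalues lie.\<close>
  define M where "M = \<bar>K1\<bar> + \<bar>K2\<bar> + 1"
  have "label (T_rg \<tau> \<alpha> \<beta>) l = label (jacobi_op \<alpha> \<beta>) l" if "l > M ^ 2" for l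
  proof -
    have "M ^ 2 < l + \<rho> ^ 2" using that by (smt (verit) zero_le_power2)
    then have "M < sqrt (l + \<rho> ^ 2)" by (rule real_less_rsqrt)
    then have "sqrt (l + \<rho> ^ 2) > K1" "sqrt (l + \<rho> ^ 2) > K2" by (auto simp: M_def)
    moreover have "(sqrt (l + \<rho> ^ 2)) ^ 2 - \<rho> ^ 2 = l"
      using \<open>M ^ 2 < l + \<rho> ^ 2\<close> by (smt (verit) real_sqrt_pow2 zero_le_power2)
    ultimately show ?thesis using K1[of "sqrt (l + \<rho> ^ 2)"] K2[of "sqrt (l + \<rho> ^ 2)"] by simp
  qed
  then have "{l \<in> sigma_qr (jacobi_op \<alpha> \<beta>). label (T_rg \<tau> \<alpha> \<beta>) (l + 0) \<noteq> label (jacobi_op \<alpha> \<beta>) l}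
      \<subseteq> {l \<in> ev \<alpha> \<beta> ` exponents \<alpha> \<beta>. l \<le> M ^ 2}"
    unfolding sigma by (auto simp: not_less[symmetric])
  then have "finite {l \<in> sigma_qr (jacobi_op \<alpha> \<beta>).
      label (T_rg \<tau> \<alpha> \<beta>) (l + 0) \<noteq> label (jacobi_op \<alpha> \<beta>) l}"
    using finite_small_eigenvalues finite_subset by blast
  moreover have "sigma_qr (T_rg \<tau> \<alpha> \<beta>) = (\<lambda>l. l + 0) ` sigma_qr (jacobi_op \<alpha> \<beta>)"
    using sigma by simp
  ultimately show ?thesis by blast
qed

end
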